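(* Consider the time-changed Brownian motion structural credit model described in the context, with log-leverage process $L_t=X_{G_t}$, $X_t=x+\sigma W_t+\beta\sigma^2t$, $\sigma>0$, $\beta<0$, time change $G_t=\alpha_1G^{(1)}_t+\alpha_2G^{(2)}_t+\alpha_3G^{(3)}_t$, spot interest rate $r_t=\tilde r_t+m_1\lambda^{(1)}_t+m_2\lambda^{(2)}_t$, default time $t^{(2)}$ and constant recovery fraction $R<1$. Let the initial credit state of the firm be specified by $L_0=x>0$ and $Z_0=[\tilde r_0,\lambda^{(1)}_0,\lambda^{(2)}_0]$. Then: 1. The probability that default occurs before $t>0$ is $$P[t^{(2)}\le t]=1-\frac{e^{-\beta x}}{\pi}\int_{-\infty}^{\infty}\frac{z\sin(zx)}{z^2+\beta^2}\exp\left[-\sum_{i=1,2}\psi^{(i)}\left(\alpha_i\sigma^2(z^2+\beta^2)/2,\,t;\lambda^{(i)}_0\right)-\psi^{(3)}\left(\alpha_3\sigma^2(z^2+\beta^2)/2,\,t\right)\right]dz.$$ 2. The time $0$ price $P_0(T)$ of the default-free zero coupon bond with maturity $T$ is $$P_0(T)=\exp\left[-\psi^{\tilde r}(1,T;\tilde r_0)-\sum_{i=1,2}\psi^{(i)}(m_i,T;\lambda^{(i)}_0)\right].$$ 3. The time $0$ price of the defaultable zero coupon bond with maturity $T$, under constant fractional recovery of treasury, is $$\bar P^{RT}_0(T)=(1-R)\,\bar P^0_0(T)+R\,P_0(T),$$ where $\bar P^0_0(T)$, the price of the zero recovery defaultable zero coupon bond, is given by $$\bar P^0_0(T)=\frac{e^{-\beta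 x-\psi^{\tilde r}(1,T;\tilde r_0)}}{\pi}\int_{-\infty}^{\infty}\frac{z\sin(zx)}{z^2+\beta^2}\exp\left[-\sum_{i=1,2}\psi^{(i)}\left(m_i+\alpha_i\sigma^2(z^2+\beta^2)/2,\,T;\lambda^{(i)}_0\right)-\psi^{(3)}\left(\alpha_3\sigma^2(z^2+\beta^2)/2,\,T\right)\right]dz.$$
   Context: The model. All expectations are under the (risk-neutral) probability measure $P$. Factors: $Z_t=[\tilde r_t,\lambda^{(1)}_t,\lambda^{(2)}_t]$ is a vector of independent nonnegative processes. - $\lambda^{(1)}$ is a CIR process: $d\lambda^{(1)}_t=(a-b\lambda^{(1)}_t)\,dt+\sqrt{2c\lambda^{(1)}_t}\,dW^{(1)}_t$ with $a,b,c>0$ and $W^{(1)}$ a Brownian motion. - $\lambda^{(2)}$ solves $d\lambda^{(2)}_t=-\tilde b\lambda^{(2)}_t\,dt+dJ_t$ with $\tilde b>0$, where $J$ is the driftless Lévy subordinator with Lévy measure $\tilde a\tilde c\,e^{-\tilde a z}\,dz$ on $(0,\infty)$, $\tilde a,\tilde c>0$. - $\tilde r$ is a CIR process (same form of SDE as $\lambda^{(1)}$, with its own positive parameters). Time change: $G^{(i)}_t=\int_0^t\lambda^{(i)}_s\,ds$ for $i=1,2$, and $G^{(3)}$ is a Lévy subordinator. $G_t=\alpha_1G^{(1)}_t+\alpha_2G^{(2)}_t+\alpha_3G^{(3)}_t$ with $0\le\alpha_1,\alpha_2,\alpha_3\le1$, $\alpha_1+\alpha_2+\alpha_3=1$. As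 a time change, $G$ is a strictly increasing càdlàg process with $G_0=0$, normalized by $\lim_{T\to\infty}T^{-1}E[G_T]=1$. The processes $W,\tilde r,\lambda^{(1)},\lambda^{(2)},G^{(3)}$ are mutually independent, where $W$ is a standard Brownian motion. Laplace exponents: $\psi^{(i)}(u,t;\lambda)=-\log E[e^{-uG^{(i)}_t}\mid\lambda^{(i)}_0=\lambda]$ for $i=1,2$; $\psi^{(3)}(u,t)=-\log E[e^{-uG^{(3)}_t}]$; $\psi^{\tilde r}(u,t;\rho)=-\log E[e^{-u\int_0^t\tilde r_s\,ds}\mid\tilde r_0=\rho]$. Firm value and default: the log-leverage process is $L_t=\log(V_t/K(t))=X_{G_t}$ with $X_t=x+\sigma W_t+\beta\sigma^2t$ ($V$ is the firm value, $K$ the default threshold). The default time is the first passage time of the second kind $t^{(2)}=\inf\{t:G_t\ge t^*\}$, where $t^*=\inf\{t:X_t\le0\}$. Interest rate: $r_t=\tilde r_t+m_1\lambda^{(1)}_t+m_2\lambda^{(2)}_t$ with $m_1,m_2\ge0$. Prices: the default-free zero coupon bond price at time $s\le T$ is the conditional expectation $P_s(T)$ of $e^{-\int_s^Tr_u\,du}$ given the information at time $s$, so $P_0(T)=E[e^{-\int_0^Tr_s\,ds}]$. The zero recovery defaultable bond has price $\bar P^0_0(T)=E[e^{-\int_0^Tr_s\,ds}\mathbf{1}_{\{T<t^{(2)}\}}]$. Under constant fractional recovery of treasury, the defaultable bond pays $1$ at $T$ if $T<t^{(2)}$, and if $t^{(2)}\le T$ it pays at the default time the fraction $R$ of the value of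 the default-free bond of the same maturity (equivalently, it pays $R$ at time $T$), so $\bar P^{RT}_0(T)=E[e^{-\int_0^Tr_s\,ds}(\mathbf{1}_{\{T<t^{(2)}\}}+R\,\mathbf{1}_{\{t^{(2)}\le T\}})]$. *)

theory Defs
  imports "HOL-Probability.Probability"
begin

text \<open>
  Processes are functions \<open>real \<Rightarrow> 'a \<Rightarrow> real\<close>; only times \<open>t \<ge> 0\<close> matter.
  Path regularity and monotonicity of the building blocks are required of every path, so that the
  events below are measurable without completing the space; initial values and stochastic (differential)
  equations are required almost surely.
\<close>

definition cadlag :: "(real \<Rightarrow> real) \<Rightarrow> bool" where
  "cadlag f \<longleftrightarrow> (\<forall>t\<ge>0. continuous (at_right t) f) \<and> (\<forall>t>0. \<exists>l. (f \<longlongrightarrow> l) (at_left t))"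

definition is_filtration :: "'a measure \<Rightarrow> (real \<Rightarrow> 'a measure) \<Rightarrow> bool" where
  "is_filtration M F \<longleftrightarrow> filtration (space M) F \<and> (\<forall>t. sets (F t) \<subseteq> sets M)"

definition natural_filtration :: "'a measure \<Rightarrow> (real \<Rightarrow> 'a \<Rightarrow> real) \<Rightarrow> real \<Rightarrow> 'a measure" where
  "natural_filtration M Y t =
     sigma (space M) {Y s -` A \<inter> space M | s A. 0 \<le> s \<and> s \<le> t \<and> A \<in> sets borel}"

definition adapted :: "(real \<Rightarrow> 'a measure) \<Rightarrow> (real \<Rightarrow> 'a \<Rightarrow> real) \<Rightarrow> bool" where
  "adapted F Y \<longleftrightarrow> (\<forall>t\<ge>0. Y t \<in> borel_measurable (F t))"

definition progressively_measurable ::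
    "(real \<Rightarrow> 'a measure) \<Rightarrow> (real \<Rightarrow> 'a \<Rightarrow> real) \<Rightarrow> bool" where
  "progressively_measurable F Y \<longleftrightarrow>
     (\<forall>t\<ge>0. (\<lambda>(s, \<omega>). Y s \<omega>) \<in> borel_measurable (restrict_space borel {0..t} \<Otimes>\<^sub>M F t))"

definition indep_increments ::
    "'a measure \<Rightarrow> (real \<Rightarrow> 'a measure) \<Rightarrow> (real \<Rightarrow> 'a \<Rightarrow> real) \<Rightarrow> bool" where
  "indep_increments M F Y \<longleftrightarrow>
     (\<forall>s t. 0 \<le> s \<and> s \<le> t \<longrightarrow>
        prob_space.indep_set M (sets (F s))
          (sets (vimage_algebra (space M) (\<lambda>\<omega>. Y t \<omega> - Y s \<omega>) borel)))"

text \<open>Mutual independence of whole processes, viewed as random elements of path space.\<close>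

definition indep_processes :: "'a measure \<Rightarrow> (real \<Rightarrow> 'a \<Rightarrow> real) list \<Rightarrow> bool" where
  "indep_processes M Ys \<longleftrightarrow>
     prob_space.indep_vars M (\<lambda>_. \<Pi>\<^sub>M t\<in>{0..}. borel)
       (\<lambda>i \<omega>. \<lambda>t\<in>{0..}. (Ys ! i) t \<omega>) {..<length Ys}"

definition tends_to_0_in_prob :: "'a measure \<Rightarrow> (nat \<Rightarrow> 'a \<Rightarrow> ennreal) \<Rightarrow> bool" where
  "tends_to_0_in_prob M D \<longleftrightarrow>
     (\<forall>n. D n \<in> borel_measurable M) \<and>
     (\<forall>\<epsilon>>0. (\<lambda>n. measure M {\<omega> \<in> space M. \<epsilon> < D n \<omega>}) \<longlonglongrightarrow> 0)"

definition brownian_motion ::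
    "'a measure \<Rightarrow> (real \<Rightarrow> 'a measure) \<Rightarrow> (real \<Rightarrow> 'a \<Rightarrow> real) \<Rightarrow> bool" where
  "brownian_motion M F B \<longleftrightarrow>
     is_filtration M F \<and> adapted F B \<and> indep_increments M F B \<and>
     (AE \<omega> in M. B 0 \<omega> = 0) \<and>
     (\<forall>\<omega>\<in>space M. continuous_on {0..} (\<lambda>t. B t \<omega>)) \<and>
     (\<forall>s t. 0 \<le> s \<and> s < t \<longrightarrow>
        distributed M lborel (\<lambda>\<omega>. B t \<omega> - B s \<omega>) (normal_density 0 (sqrt (t - s))))"

definition standard_brownian_motion :: "'a measure \<Rightarrow> (real \<Rightarrow> 'a \<Rightarrow> real) \<Rightarrow> bool" where
  "standard_brownian_motion M B \<longleftrightarrow> brownian_motion M (natural_filtration M B) B"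

definition subordinator :: "'a measure \<Rightarrow> (real \<Rightarrow> 'a \<Rightarrow> real) \<Rightarrow> bool" where
  "subordinator M Y \<longleftrightarrow>
     (\<forall>t\<ge>0. Y t \<in> borel_measurable M) \<and>
     (AE \<omega> in M. Y 0 \<omega> = 0) \<and>
     (\<forall>\<omega>\<in>space M. cadlag (\<lambda>t. Y t \<omega>) \<and> mono_on {0..} (\<lambda>t. Y t \<omega>)) \<and>
     indep_increments M (natural_filtration M Y) Y \<and>
     (\<forall>s t. 0 \<le> s \<and> s \<le> t \<longrightarrow>
        distr M borel (\<lambda>\<omega>. Y t \<omega> - Y s \<omega>) = distr M borel (Y (t - s)))"

text \<open>Drift \<open>d\<close> and Levy measure \<open>\<nu>\<close> of a subordinator, via its Levy--Khintchine formula.\<close>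

definition levy_khintchine ::
    "'a measure \<Rightarrow> (real \<Rightarrow> 'a \<Rightarrow> real) \<Rightarrow> real \<Rightarrow> real measure \<Rightarrow> bool" where
  "levy_khintchine M Y d \<nu> \<longleftrightarrow>
     sets \<nu> = sets borel \<and> emeasure \<nu> {..0} = 0 \<and> (\<integral>\<^sup>+z. ennreal (min 1 z) \<partial>\<nu>) < \<infinity> \<and>
     (\<forall>u\<ge>0. \<forall>t\<ge>0. (\<integral>\<omega>. exp (- u * Y t \<omega>) \<partial>M)
        = exp (- t * (d * u + (\<integral>z. 1 - exp (- u * z) \<partial>\<nu>))))"

definition exponential_levy_measure :: "real \<Rightarrow> real \<Rightarrow> real measure" where
  "exponential_levy_measure a c =
     density lborel (\<lambda>z. ennreal (a * c * exp (- a * z)) * indicator {0<..} z)"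

text \<open>
  A simple integrand is a step process \<open>\<Sum>k<n. \<xi>\<^sub>k 1\<^bsub>(\<tau>\<^sub>k, \<tau>\<^sub>k\<^sub>+\<^sub>1]\<^esub>\<close> with
  deterministic grid and bounded \<open>F \<tau>\<^sub>k\<close>-measurable coefficients.
\<close>

definition simple_integrand ::
    "'a measure \<Rightarrow> (real \<Rightarrow> 'a measure) \<Rightarrow> nat \<Rightarrow> (nat \<Rightarrow> real) \<Rightarrow> (nat \<Rightarrow> 'a \<Rightarrow> real) \<Rightarrow> bool" where
  "simple_integrand M F n \<tau> \<xi> \<longleftrightarrow>
     0 \<le> \<tau> 0 \<and> mono \<tau> \<and>
     (\<forall>k<n. \<xi> k \<in> borel_measurable (F (\<tau> k)) \<and> (\<exists>C. \<forall>\<omega>\<in>space M. \<bar>\<xi> k \<omega>\<bar> \<le> C))"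

definition simple_process ::
    "nat \<Rightarrow> (nat \<Rightarrow> real) \<Rightarrow> (nat \<Rightarrow> 'a \<Rightarrow> real) \<Rightarrow> real \<Rightarrow> 'a \<Rightarrow> real" where
  "simple_process n \<tau> \<xi> s \<omega> = (\<Sum>k<n. \<xi> k \<omega> * indicator {\<tau> k<..\<tau> (Suc k)} s)"

definition simple_ito_integral ::
    "(real \<Rightarrow> 'a \<Rightarrow> real) \<Rightarrow> real \<Rightarrow> nat \<Rightarrow> (nat \<Rightarrow> real) \<Rightarrow> (nat \<Rightarrow> 'a \<Rightarrow> real) \<Rightarrow> 'a \<Rightarrow> real" where
  "simple_ito_integral B t n \<tau> \<xi> \<omega> =
     (\<Sum>k<n. \<xi> k \<omega> * (B (min (\<tau> (Suc k)) t) \<omega> - B (min (\<tau> k) t) \<omega>))"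

text \<open>
  \<open>I\<close> is (a version of) \<open>\<integral>\<^sub>0\<^sup>t H dB\<close>: it is the limit in probability of integrals of simple
  processes \<open>H\<^sub>n\<close> for which \<open>\<integral>\<^sub>0\<^sup>t (H\<^sub>n - H)\<^sup>2 ds\<close> tends to 0 in probability. This limit is
  a.s. unique.
\<close>

definition has_ito_integral ::
    "'a measure \<Rightarrow> (real \<Rightarrow> 'a measure) \<Rightarrow> (real \<Rightarrow> 'a \<Rightarrow> real) \<Rightarrow> (real \<Rightarrow> 'a \<Rightarrow> real) \<Rightarrow> real
      \<Rightarrow> ('a \<Rightarrow> real) \<Rightarrow> bool" where
  "has_ito_integral M F B H t I \<longleftrightarrow>
     progressively_measurable F H \<and> I \<in> borel_measurable M \<and>
     (\<exists>n \<tau> \<xi>.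
        (\<forall>j. simple_integrand M F (n j) (\<tau> j) (\<xi> j)) \<and>
        tends_to_0_in_prob M (\<lambda>j \<omega>. \<integral>\<^sup>+s\<in>{0..t}.
            ennreal ((simple_process (n j) (\<tau> j) (\<xi> j) s \<omega> - H s \<omega>)\<^sup>2) \<partial>lborel) \<and>
        tends_to_0_in_prob M (\<lambda>j \<omega>. ennreal \<bar>simple_ito_integral B t (n j) (\<tau> j) (\<xi> j) \<omega> - I \<omega>\<bar>))"

definition time_integral :: "(real \<Rightarrow> 'a \<Rightarrow> real) \<Rightarrow> real \<Rightarrow> 'a \<Rightarrow> real" where
  "time_integral Y t \<omega> = (LBINT s:{0..t}. Y s \<omega>)"

text \<open>\<open>dY = (a - b Y) dt + sqrt (2 c Y) dB\<close>, in integrated form.\<close>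

definition CIR_process ::
    "'a measure \<Rightarrow> real \<Rightarrow> real \<Rightarrow> real \<Rightarrow> (real \<Rightarrow> 'a \<Rightarrow> real) \<Rightarrow> (real \<Rightarrow> 'a \<Rightarrow> real) \<Rightarrow> bool" where
  "CIR_process M a b c B Y \<longleftrightarrow>
     (\<exists>F. brownian_motion M F B \<and> adapted F Y \<and>
       (\<forall>\<omega>\<in>space M. continuous_on {0..} (\<lambda>t. Y t \<omega>) \<and> (\<forall>t\<ge>0. 0 \<le> Y t \<omega>)) \<and>
       (\<forall>t\<ge>0. has_ito_integral M F B (\<lambda>s \<omega>. sqrt (2 * c * Y s \<omega>)) t
          (\<lambda>\<omega>. Y t \<omega> - Y 0 \<omega> - (LBINT s:{0..t}. a - b * Y s \<omega>))))"

text \<open>\<open>dY = - b Y dt + dJ\<close>, in integrated form (with \<open>J 0 = 0\<close>).\<close>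

definition jump_OU_process ::
    "'a measure \<Rightarrow> real \<Rightarrow> (real \<Rightarrow> 'a \<Rightarrow> real) \<Rightarrow> (real \<Rightarrow> 'a \<Rightarrow> real) \<Rightarrow> bool" where
  "jump_OU_process M b J Y \<longleftrightarrow>
     (\<forall>t\<ge>0. Y t \<in> borel_measurable M) \<and>
     (\<forall>\<omega>\<in>space M. cadlag (\<lambda>t. Y t \<omega>) \<and> (\<forall>t\<ge>0. 0 \<le> Y t \<omega>)) \<and>
     (AE \<omega> in M. \<forall>t\<ge>0. Y t \<omega> = Y 0 \<omega> - b * time_integral Y t \<omega> + J t \<omega>)"

definition normalized_time_change :: "'a measure \<Rightarrow> (real \<Rightarrow> 'a \<Rightarrow> real) \<Rightarrow> bool" where
  "normalized_time_change M G \<longleftrightarrow>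
     (AE \<omega> in M. G 0 \<omega> = 0 \<and> cadlag (\<lambda>t. G t \<omega>) \<and> strict_mono_on {0..} (\<lambda>t. G t \<omega>)) \<and>
     ((\<lambda>T. (\<integral>\<omega>. G T \<omega> \<partial>M) / T) \<longlongrightarrow> 1) at_top"

definition laplace_exponent :: "'a measure \<Rightarrow> (real \<Rightarrow> 'a \<Rightarrow> real) \<Rightarrow> real \<Rightarrow> real \<Rightarrow> real" where
  "laplace_exponent M Y u t = - ln (\<integral>\<omega>. exp (- u * Y t \<omega>) \<partial>M)"

text \<open>
  Laplace exponent of \<open>\<integral>\<^sub>0\<^sup>t Y ds\<close> conditional on the event \<open>Y 0 = y\<close>, which has to have
  positive probability.
\<close>

definition laplace_exponent_given ::
    "'a measure \<Rightarrow> (real \<Rightarrow> 'a \<Rightarrow> real) \<Rightarrow> real \<Rightarrow> real \<Rightarrow> real \<Rightarrow> real" where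
  "laplace_exponent_given M Y u t y =
     laplace_exponent (uniform_measure M {\<omega> \<in> space M. Y 0 \<omega> = y}) (time_integral Y) u t"

definition first_passage_time :: "(real \<Rightarrow> 'a \<Rightarrow> real) \<Rightarrow> 'a \<Rightarrow> ereal" where
  "first_passage_time X \<omega> = Inf {ereal t | t. 0 \<le> t \<and> X t \<omega> \<le> 0}"

definition default_time :: "(real \<Rightarrow> 'a \<Rightarrow> real) \<Rightarrow> (real \<Rightarrow> 'a \<Rightarrow> real) \<Rightarrow> 'a \<Rightarrow> ereal" where
  "default_time X G \<omega> = Inf {ereal t | t. 0 \<le> t \<and> first_passage_time X \<omega> \<le> ereal (G t \<omega>)}"

definition bond_price :: "'a measure \<Rightarrow> (real \<Rightarrow> 'a \<Rightarrow> real) \<Rightarrow> real \<Rightarrow> real" where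
  "bond_price M r T = (\<integral>\<omega>. exp (- time_integral r T \<omega>) \<partial>M)"

definition zero_recovery_price ::
    "'a measure \<Rightarrow> (real \<Rightarrow> 'a \<Rightarrow> real) \<Rightarrow> ('a \<Rightarrow> ereal) \<Rightarrow> real \<Rightarrow> real" where
  "zero_recovery_price M r \<delta> T =
     (\<integral>\<omega>. exp (- time_integral r T \<omega>) * indicator {\<omega>. ereal T < \<delta> \<omega>} \<omega> \<partial>M)"

definition treasury_recovery_price ::
    "'a measure \<Rightarrow> (real \<Rightarrow> 'a \<Rightarrow> real) \<Rightarrow> ('a \<Rightarrow> ereal) \<Rightarrow> real \<Rightarrow> real \<Rightarrow> real" where
  "treasury_recovery_price M r \<delta> R T =
     (\<integral>\<omega>. exp (- time_integral r T \<omega>) *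
        (indicator {\<omega>. ereal T < \<delta> \<omega>} \<omega> + R * indicator {\<omega>. \<delta> \<omega> \<le> ereal T} \<omega>) \<partial>M)"

end

theory Submission
  imports Defs
begin

text \<open>
  Let \<open>\<tau>\<close> be the first passage time of \<open>X\<close> to 0. Since \<open>G\<close> is nondecreasing and right-continuous,
  default happens by time \<open>t\<close> iff \<open>\<tau> \<le> G t\<close>, and \<open>\<tau>\<close> is independent of \<open>(r, G)\<close>; so everything
  reduces to averaging \<open>P (\<tau> > s)\<close> over an independent \<open>s\<close>.

  Let \<open>\<phi>\<close> be 1 on the positive half-line and extended so that \<open>e\<^bsup>\<beta> y\<^esup> \<phi> y\<close> is odd. By symmetry
  \<open>E (\<phi> (y + \<sigma> W\<^sub>s + \<beta> \<sigma>\<^sup>2 s))\<close> vanishes at \<open>y = 0\<close>, so it is a martingale along \<open>X\<close> that is 0 when \<open>X\<close>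
  first hits 0, and optional stopping identifies it with \<open>P (\<tau> > s)\<close>. Fourier inversion of
  \<open>e\<^bsup>\<beta> y\<^esup> \<phi> y\<close>, whose sine transform is \<open>z / (z\<^sup>2 + \<beta>\<^sup>2)\<close> up to a constant, gives the integral formula.

  The integral over \<open>z\<close> need not converge absolutely. By the second mean value theorem the
  integrals over \<open>[- N, N]\<close> converge at rate \<open>1 / N\<close> uniformly in \<open>s \<ge> 0\<close>, so Fubini is only applied on
  \<open>[- N, N]\<close>, and the outer integral is the gauge integral over the whole line.
\<close>

subsection \<open>Cadlag paths and passage times\<close>

text \<open>The drift of X is \<beta> times its variance rate. Hence the normal density of an
  increment with variance v is the centred one times exp (\<beta> w - \<open>\<beta>\<^sup>2\<close>
  v / 2), and averaging the payoff becomes a centred Gaussian average of an odd function. The tilt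
  yields the prefactor exp (- \<beta> x) and completes \<open>z\<^sup>2\<close> to
  \<open>z\<^sup>2 + \<beta>\<^sup>2\<close> in the exponents; the same sum in the denominator is
  the sine transform of exp (\<beta> w) on w > 0. Both that transform and the boundedness of the
  payoff rest on \<beta> < 0. Optional stopping is carried out on finite grids, where it is a finite
  sum. The obstacle is the overshoot: at the first nonpositive grid point X is only close to 0. The
  survival function is Lipschitz in the starting point, but the bound degrades as the remaining
  variance tends to 0, so hits just before the horizon s could be harmful. Almost surely X is
  nonzero at s, hence a hit with a small value stays away from s and contributes little.
  Independence is used for functionals such as passage times that are not measurable on the space of
  all functions of time; it is transferred through the sigma-algebras generated by the actual
  paths.\<close>

lemma continuous_on_imp_cadlag:
  fixes f :: "real \<Rightarrow> real"
  assumes "continuous_on {0..} f"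
  shows "cadlag f"
proof -
  have r: "(f \<longlongrightarrow> f t) (at_right t)" if "0 \<le> t" for t
  proof -
    have "(f \<longlongrightarrow> f t) (at t within {0..})"
      using assms that by (auto simp: continuous_on_def)
    then show ?thesis
      by (rule tendsto_within_subset) (use that in auto)
  qed
  have l: "(f \<longlongrightarrow> f t) (at_left t)" if "0 < t" for t
  proof -
    have "isCont f t"
      using assms that by (intro continuous_on_interior[of "{0..}"]) (auto simp: interior_Ici)
    then show ?thesis
      by (auto simp: isCont_def intro: filterlim_at_within_not_equal filterlim_mono at_le)
  qed
  show ?thesis
    unfolding cadlag_def continuous_within using r l by blast
qed

text \<open>The one-sided limits bound the path near each point, and compactness of
  \<open>{0..t}\<close> makes finitely many local bounds suffice. At time 0 there is nothing to
  bound on the left, which the guard \<open>0 \<le> y\<close> records.\<close>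

lemma cadlag_bounded:
  assumes "cadlag f"
  shows "\<exists>B. \<forall>s\<in>{0..t}. \<bar>f s\<bar> \<le> B"
proof -
  have loc: "\<exists>B. eventually (\<lambda>y. 0 \<le> y \<longrightarrow> \<bar>f y\<bar> \<le> B) (nhds s)" if "0 \<le> s" for s
  proof -
    have R: "\<exists>B. eventually (\<lambda>y. 0 \<le> y \<longrightarrow> \<bar>f y\<bar> \<le> B) (at_right s)"
    proof -
      have "((\<lambda>y. \<bar>f y\<bar>) \<longlongrightarrow> \<bar>f s\<bar>) (at_right s)"
        using assms that unfolding cadlag_def continuous_within by (intro tendsto_intros) blast
      then have "eventually (\<lambda>y. \<bar>f y\<bar> < \<bar>f s\<bar> + 1) (at_right s)"
        by (rule order_tendstoD) simp
      then show ?thesis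
        by (intro exI[of _ "\<bar>f s\<bar> + 1"]) (auto elim: eventually_mono)
    qed
    have L: "\<exists>B. eventually (\<lambda>y. 0 \<le> y \<longrightarrow> \<bar>f y\<bar> \<le> B) (at_left s)"
    proof (cases "s = 0")
      case True
      have "eventually (\<lambda>y. y < 0) (at_left (0::real))"
        by (simp add: eventually_at_filter)
      then have "eventually (\<lambda>y. 0 \<le> y \<longrightarrow> \<bar>f y\<bar> \<le> 0) (at_left s)"
        using True by (auto elim: eventually_mono)
      then show ?thesis ..
    next
      case False
      with that have "0 < s" by simp
      moreover have "\<forall>t>0. \<exists>l. (f \<longlongrightarrow> l) (at_left t)"
        using assms by (simp add: cadlag_def)
      ultimately obtain l where "(f \<longlongrightarrow> l) (at_left s)"
        by blast
      then have "((\<lambda>y. \<bar>f y\<bar>) \<longlongrightarrow> \<bar>l\<bar>) (at_left s)"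
        by (intro tendsto_intros)
      then have "eventually (\<lambda>y. \<bar>f y\<bar> < \<bar>l\<bar> + 1) (at_left s)"
        by (rule order_tendstoD) simp
      then show ?thesis
        by (intro exI[of _ "\<bar>l\<bar> + 1"]) (auto elim: eventually_mono)
    qed
    obtain B1 B2 where "eventually (\<lambda>y. 0 \<le> y \<longrightarrow> \<bar>f y\<bar> \<le> B1) (at_right s)"
      "eventually (\<lambda>y. 0 \<le> y \<longrightarrow> \<bar>f y\<bar> \<le> B2) (at_left s)" using R L by blast
    then have "eventually (\<lambda>y. 0 \<le> y \<longrightarrow> \<bar>f y\<bar> \<le> max \<bar>f s\<bar> (max B1 B2)) (at s)"
      unfolding eventually_at_split by (auto elim: eventually_mono)
    then have "eventually (\<lambda>y. 0 \<le> y \<longrightarrow> \<bar>f y\<bar> \<le> max \<bar>f s\<bar> (max B1 B2)) (nhds s)"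
      unfolding eventually_at_filter by (auto elim: eventually_mono)
    then show ?thesis ..
  qed
  have "\<forall>s\<in>{0..t}. \<exists>B U. open U \<and> s \<in> U \<and> (\<forall>y\<in>U. 0 \<le> y \<longrightarrow> \<bar>f y\<bar> \<le> B)"
    using loc unfolding eventually_nhds by fastforce
  then obtain B U where BU: "\<And>s. s \<in> {0..t} \<Longrightarrow> open (U s) \<and> s \<in> U s \<and> (\<forall>y\<in>U s. 0 \<le> y \<longrightarrow> \<bar>f y\<bar> \<le> B s)"
    by metis
  obtain C where C: "C \<subseteq> {0..t}" "finite C" "{0..t} \<subseteq> (\<Union>c\<in>C. U c)"
    by (rule compactE_image[of "{0..t}" "{0..t}" U]) (use BU in auto)
  show ?thesis
  proof (intro exI ballI)
    fix s assume s: "s \<in> {0..t}"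
    then obtain c where c: "c \<in> C" "s \<in> U c" using C by blast
    then have "\<bar>f s\<bar> \<le> B c" using BU[of c] C(1) c(1) s by auto
    also have "\<dots> \<le> Max (insert 0 (B ` C))" using c C by auto
    finally show "\<bar>f s\<bar> \<le> Max (insert 0 (B ` C))" .
  qed
qed

text \<open>Right-continuity makes the path the limit of its values on the grids \<open>\<int> / (n + 1)\<close>,
  rounded upwards.\<close>

lemma cadlag_pair_measurable:
  assumes Y: "\<And>s. 0 \<le> s \<Longrightarrow> Y s \<in> borel_measurable N"
    and cadlag: "\<And>\<omega>. \<omega> \<in> space N \<Longrightarrow> cadlag (\<lambda>s. Y s \<omega>)"
  shows "(\<lambda>(\<omega>, s). indicator {0..} s * Y s \<omega>) \<in> borel_measurable (N \<Otimes>\<^sub>M lborel)"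
proof -
  define g where "g n s = (real_of_int \<lfloor>real (Suc n) * s\<rfloor> + 1) / real (Suc n)" for n s
  have g_gt: "s < g n s" for n s
    unfolding g_def by (simp add: field_simps) linarith
  have g_le: "g n s \<le> s + inverse (real (Suc n))" for n s
  proof -
    have "g n s \<le> (real (Suc n) * s + 1) / real (Suc n)"
      unfolding g_def by (intro divide_right_mono add_mono) auto
    also have "\<dots> = s + inverse (real (Suc n))"
      by (simp add: field_simps)
    finally show ?thesis .
  qed
  have g_lim: "filterlim (\<lambda>n. g n s) (at_right s) sequentially" for s
  proof -
    have "(\<lambda>n. g n s) \<longlonglongrightarrow> s"
    proof (rule tendsto_sandwich[OF _ _ tendsto_const])
      show "(\<lambda>n. s + inverse (real (Suc n))) \<longlonglongrightarrow> s"
        using tendsto_add[OF tendsto_const LIMSEQ_inverse_real_of_nat] by simp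
      show "eventually (\<lambda>n. s \<le> g n s) sequentially"
        by (intro always_eventually allI less_imp_le g_gt)
      show "eventually (\<lambda>n. g n s \<le> s + inverse (real (Suc n))) sequentially"
        by (intro always_eventually allI g_le)
    qed
    then show ?thesis
      unfolding filterlim_at using g_gt by (auto intro!: always_eventually simp: less_imp_neq[THEN not_sym])
  qed
  \<comment> \<open>The floor takes countably many values, so \<open>Y' n\<close> is measurable
    piece by piece. A piece belongs to an arbitrary integer, also a negative one;
    \<open>max 0\<close> keeps its time in the range where \<open>Y\<close> is known to be
    measurable.\<close>
  define Y' where "Y' n = (\<lambda>p. indicator {0..} (snd p) * Y (max 0 ((real_of_int \<lfloor>real (Suc n) * snd p\<rfloor> + 1) / real (Suc n))) (fst p))" for n
  have meas: "Y' n \<in> borel_measurable (N \<Otimes>\<^sub>M lborel)" for n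
  proof -
    have "(\<lambda>p. Y (max 0 ((real_of_int \<lfloor>real (Suc n) * snd p\<rfloor> + 1) / real (Suc n))) (fst p))
        \<in> borel_measurable (N \<Otimes>\<^sub>M lborel)"
    proof (rule measurable_compose_countable[where f = "\<lambda>i p. Y (max 0 ((real_of_int i + 1) / real (Suc n))) (fst p)"
          and g = "\<lambda>p. \<lfloor>real (Suc n) * snd p\<rfloor>"])
      show "(\<lambda>p. Y (max 0 ((real_of_int i + 1) / real (Suc n))) (fst p)) \<in> borel_measurable (N \<Otimes>\<^sub>M lborel)" for i
        by (rule measurable_compose[OF measurable_fst Y]) simp
      show "(\<lambda>p. \<lfloor>real (Suc n) * snd p\<rfloor>) \<in> N \<Otimes>\<^sub>M lborel \<rightarrow>\<^sub>M count_space UNIV"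
        by measurable
    qed
    then show ?thesis unfolding Y'_def by measurable
  qed
  show ?thesis
  proof (rule borel_measurable_LIMSEQ_real[OF _ meas])
    fix p :: "'a \<times> real" assume p: "p \<in> space (N \<Otimes>\<^sub>M lborel)"
    obtain \<omega> s where ps: "p = (\<omega>, s)" by force
    show "(\<lambda>n. Y' n p) \<longlonglongrightarrow> (case p of (\<omega>, s) \<Rightarrow> indicator {0..} s * Y s \<omega>)"
    proof (cases "0 \<le> s")
      case True
      have "((\<lambda>s. Y s \<omega>) \<longlongrightarrow> Y s \<omega>) (at_right s)"
        using cadlag[of \<omega>] p True ps by (auto simp: cadlag_def continuous_within space_pair_measure)
      from filterlim_compose[OF this g_lim]
      have "(\<lambda>n. Y (g n s) \<omega>) \<longlonglongrightarrow> Y s \<omega>" .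
      moreover have "Y' n p = Y (g n s) \<omega>" for n
        using True less_imp_le[OF le_less_trans[OF True g_gt]] unfolding ps Y'_def g_def by (simp add: max_absorb2)
      ultimately show ?thesis using True by (simp add: ps)
    qed (simp add: ps Y'_def)
  qed
qed

lemma borel_measurable_time_integral:
  assumes "\<And>s. 0 \<le> s \<Longrightarrow> Y s \<in> borel_measurable N"
    and "\<And>\<omega>. \<omega> \<in> space N \<Longrightarrow> cadlag (\<lambda>s. Y s \<omega>)"
  shows "time_integral Y t \<in> borel_measurable N"
proof -
  note [measurable] = cadlag_pair_measurable[OF assms]
  have "(\<lambda>\<omega>. LINT s|lborel. indicator {0..t} s * (case (\<omega>, s) of (\<omega>, s) \<Rightarrow> indicator {0..} s * Y s \<omega>))
      \<in> borel_measurable N"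
    by measurable
  also have "(\<lambda>\<omega>. LINT s|lborel. indicator {0..t} s * (case (\<omega>, s) of (\<omega>, s) \<Rightarrow> indicator {0..} s * Y s \<omega>))
      = time_integral Y t"
    unfolding time_integral_def set_lebesgue_integral_def
    by (intro ext Bochner_Integration.integral_cong) (auto split: split_indicator)
  finally show ?thesis .
qed

lemma cadlag_set_integrable:
  assumes "cadlag f"
  shows "set_integrable lborel {0..t} f"
proof -
  obtain B where B: "\<forall>s\<in>{0..t}. \<bar>f s\<bar> \<le> B" using cadlag_bounded[OF assms] by blast
  \<comment> \<open>A one-point sample space turns joint measurability into Borel measurability of a
    single path.\<close>
  have "(\<lambda>(\<omega>, s). indicator {0..} s * f s) \<in> borel_measurable (count_space UNIV \<Otimes>\<^sub>M lborel :: (unit \<times> real) measure)"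
    by (rule cadlag_pair_measurable) (use assms in auto)
  from measurable_compose[OF measurable_Pair1'[of "()"] this]
  have [measurable]: "(\<lambda>s. indicator {0..} s * f s) \<in> borel_measurable lborel" by simp
  have "set_integrable lborel {0..t} (\<lambda>s. indicator {0..} s * f s)"
    unfolding set_integrable_def
    by (rule integrableI_bounded_set_indicator[where B = B]) (use B in \<open>auto simp: emeasure_lborel_Icc_eq\<close>)
  then show ?thesis
    by (rule set_integrable_cong[THEN iffD1, rotated 3]) auto
qed

lemma time_integral_eq_integral:
  assumes "cadlag (\<lambda>s. Y s \<omega>)"
  shows "time_integral Y t \<omega> = integral {0..t} (\<lambda>s. Y s \<omega>)"
  unfolding time_integral_def by (rule set_borel_integral_eq_integral(2)[OF cadlag_set_integrable[OF assms]])

lemma cadlag_integrable_on: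
  assumes "cadlag f"
  shows "f integrable_on {0..t}"
  by (rule set_borel_integral_eq_integral(1)[OF cadlag_set_integrable[OF assms]])

lemma continuous_on_time_integral:
  assumes "cadlag (\<lambda>s. Y s \<omega>)"
  shows "continuous_on {0..} (\<lambda>t. time_integral Y t \<omega>)"
proof -
  have "continuous_on {0..} (\<lambda>t. integral {0..t} (\<lambda>s. Y s \<omega>))"
    unfolding continuous_on_eq_continuous_within
  proof
    fix t :: real assume t: "t \<in> {0..}"
    have "continuous_on {0..t+1} (\<lambda>t. integral {0..t} (\<lambda>s. Y s \<omega>))"
      by (rule indefinite_integral_continuous_1[OF cadlag_integrable_on[OF assms]])
    then have "continuous (at t within {0..t+1}) (\<lambda>t. integral {0..t} (\<lambda>s. Y s \<omega>))"
      using t by (auto simp: continuous_on_eq_continuous_within)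
    moreover have "at t within {0..t+1} = at t within {0..}"
      by (rule at_within_nhd[of _ "{..<t+1}"]) auto
    ultimately show "continuous (at t within {0..}) (\<lambda>t. integral {0..t} (\<lambda>s. Y s \<omega>))"
      by simp
  qed
  then show ?thesis by (simp add: time_integral_eq_integral[of Y, OF assms])
qed

lemma time_integral_nonneg:
  assumes "\<And>s. 0 \<le> s \<Longrightarrow> 0 \<le> Y s \<omega>"
  shows "0 \<le> time_integral Y t \<omega>"
  unfolding time_integral_def set_lebesgue_integral_def
  by (rule Bochner_Integration.integral_nonneg) (use assms in \<open>auto split: split_indicator\<close>)

lemma mono_on_time_integral:
  assumes "cadlag (\<lambda>s. Y s \<omega>)" "\<And>s. 0 \<le> s \<Longrightarrow> 0 \<le> Y s \<omega>"
  shows "mono_on {0..} (\<lambda>t. time_integral Y t \<omega>)"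
proof (rule mono_onI)
  fix s t :: real assume "s \<le> t"
  then show "time_integral Y s \<omega> \<le> time_integral Y t \<omega>"
    unfolding time_integral_eq_integral[of Y, OF assms(1)]
    by (intro integral_subset_le cadlag_integrable_on assms(1)) (use assms(2) in auto)
qed

text \<open>By continuity the set of times with \<open>X \<le> 0\<close> is closed, so the infimum
  is attained.\<close>

lemma first_passage_time_le_iff:
  assumes "continuous_on {0..} (\<lambda>t. X t \<omega>)"
  shows "first_passage_time X \<omega> \<le> ereal s \<longleftrightarrow> (\<exists>u\<in>{0..s}. X u \<omega> \<le> 0)"
proof
  assume *: "first_passage_time X \<omega> \<le> ereal s"
  show "\<exists>u\<in>{0..s}. X u \<omega> \<le> 0"
  proof (rule ccontr)
    assume neg: "\<not> (\<exists>u\<in>{0..s}. X u \<omega> \<le> 0)"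
    \<comment> \<open>An infimum at most s only guarantees a hit before s + 1. The extra unit makes
      this compact set nonempty, and its least element bounds all hitting times from below.\<close>
    define S where "S = {u \<in> {0..s+1}. X u \<omega> \<le> 0}"
    have "closed S"
      unfolding S_def
      by (intro continuous_on_closed_Collect_le continuous_on_subset[OF assms] continuous_intros) auto
    moreover have "bounded S"
      unfolding S_def by (rule bounded_subset[OF bounded_closed_interval[of 0 "s+1"]]) auto
    ultimately have "compact S" by (simp add: compact_eq_bounded_closed)
    have "first_passage_time X \<omega> < ereal (s + 1)"
      using * by (rule le_less_trans) simp
    then obtain u where "0 \<le> u" "X u \<omega> \<le> 0" "u < s + 1"
      unfolding first_passage_time_def Inf_less_iff by auto
    then have "u \<in> S" by (simp add: S_def)
    then have "S \<noteq> {}" by blast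
    with \<open>compact S\<close> obtain m where m: "m \<in> S" "\<forall>u\<in>S. m \<le> u"
      using compact_attains_inf by metis
    then have "s < m" using neg by (fastforce simp: S_def)
    have "ereal m \<le> first_passage_time X \<omega>"
      unfolding first_passage_time_def
    proof (rule Inf_greatest, clarify)
      fix u assume u: "0 \<le> u" "X u \<omega> \<le> 0"
      show "ereal m \<le> ereal u"
        using m u by (cases "u \<le> s + 1") (auto simp: S_def)
    qed
    then have "ereal m \<le> ereal s" using * by (rule order_trans)
    then show False using \<open>s < m\<close> by simp
  qed
next
  assume "\<exists>u\<in>{0..s}. X u \<omega> \<le> 0"
  then obtain u where "u \<in> {0..s}" "X u \<omega> \<le> 0" by blast
  then show "first_passage_time X \<omega> \<le> ereal s"
    unfolding first_passage_time_def by (intro Inf_lower2[of "ereal u"]) auto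
qed

text \<open>If \<open>G\<close> is strictly below the passage time at t, right-continuity keeps it
  below on some [t, u) and monotonicity before t, so default cannot happen before u. Comparing in
  \<open>ereal\<close> includes paths that never hit 0.\<close>

lemma default_time_le_iff:
  assumes G: "mono_on {0..} (\<lambda>t. G t \<omega>)" "continuous (at_right t) (\<lambda>t. G t \<omega>)" and t: "0 \<le> t"
  shows "default_time X G \<omega> \<le> ereal t \<longleftrightarrow> first_passage_time X \<omega> \<le> ereal (G t \<omega>)"
proof
  assume "first_passage_time X \<omega> \<le> ereal (G t \<omega>)"
  then show "default_time X G \<omega> \<le> ereal t"
    unfolding default_time_def using t by (intro Inf_lower) auto
next
  assume le: "default_time X G \<omega> \<le> ereal t"
  show "first_passage_time X \<omega> \<le> ereal (G t \<omega>)"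
  proof (rule ccontr)
    assume "\<not> first_passage_time X \<omega> \<le> ereal (G t \<omega>)"
    then have less: "ereal (G t \<omega>) < first_passage_time X \<omega>" by simp
    have "((\<lambda>s. ereal (G s \<omega>)) \<longlongrightarrow> ereal (G t \<omega>)) (at_right t)"
      using G(2) by (auto simp: continuous_within intro: tendsto_intros)
    then have "eventually (\<lambda>s. ereal (G s \<omega>) < first_passage_time X \<omega>) (at_right t)"
      using less by (rule order_tendstoD)
    then obtain u where u: "t < u" "\<And>s. t < s \<Longrightarrow> s < u \<Longrightarrow> ereal (G s \<omega>) < first_passage_time X \<omega>"
      by (auto simp: eventually_at_right_field)
    have "ereal u \<le> default_time X G \<omega>"
      unfolding default_time_def
    proof (rule Inf_greatest, clarify)
      fix s assume s: "0 \<le> s" "first_passage_time X \<omega> \<le> ereal (G s \<omega>)"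
      show "ereal u \<le> ereal s"
      proof (rule ccontr)
        assume "\<not> ereal u \<le> ereal s"
        then have "s < u" by simp
        have "ereal (G s \<omega>) < first_passage_time X \<omega>"
        proof (cases "s \<le> t")
          case True
          then have "ereal (G s \<omega>) \<le> ereal (G t \<omega>)"
            using mono_onD[OF G(1), of s t] s t by auto
          then show ?thesis using less by (rule le_less_trans)
        qed (use \<open>s < u\<close> u(2) in simp)
        then show False using s by simp
      qed
    qed
    then have "ereal u \<le> ereal t" using le by (rule order_trans)
    with u show False by simp
  qed
qed

subsection \<open>The sine transform of the reflected payoff\<close>

lemma integrable_gaussian:
  assumes "0 < v"
  shows "integrable lborel (\<lambda>z::real. exp (- v * z\<^sup>2 / 2))"
proof -
  have "exp (- v * z\<^sup>2 / 2) = sqrt (2 * pi / v) * normal_density 0 (1 / sqrt v) z" for z :: real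
    using assms by (simp add: normal_density_def real_sqrt_divide real_sqrt_mult power_divide field_simps)
  moreover have "integrable lborel (\<lambda>z. sqrt (2 * pi / v) * normal_density 0 (1 / sqrt v) z)"
    using assms by (intro integrable_mult_right integrable_normal_density) simp
  ultimately show ?thesis by simp
qed

text \<open>The Gaussian is its own Fourier transform up to scaling: this is the real part of the
  standard normal characteristic function at \<open>w / sqrt v\<close>, after the substitution of
  \<open>sqrt v * z\<close> for the integration variable.\<close>

lemma normal_density_eq_cosine_transform:
  assumes v: "0 < v"
  shows "normal_density 0 (sqrt v) w = 1 / (2 * pi) * (\<integral>z. cos (z * w) * exp (- v * z\<^sup>2 / 2) \<partial>lborel)"
proof -
  interpret real_distribution std_normal_distribution by (rule real_dist_normal_dist)
  define t where "t = w / sqrt v"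
  have "exp (- t\<^sup>2 / 2) = Re (char std_normal_distribution t)"
    by (simp add: char_std_normal_distribution)
  also have "\<dots> = (\<integral>x. Re (iexp (t * x)) \<partial>std_normal_distribution)"
    unfolding char_def by (rule integral_Re[symmetric]) (auto intro!: integrable_iexp)
  also have "\<dots> = (\<integral>x. std_normal_density x * cos (t * x) \<partial>lborel)"
    by (subst integral_density) (auto simp: cos_of_real[symmetric] Re_exp simp del: of_real_mult)
  also have "\<dots> = sqrt v * (\<integral>z. std_normal_density (sqrt v * z) * cos (t * (sqrt v * z)) \<partial>lborel)"
    using v by (subst lborel_integral_real_affine[where c = "sqrt v" and t = 0]) auto
  also have "(\<lambda>z. std_normal_density (sqrt v * z) * cos (t * (sqrt v * z)))
      = (\<lambda>z. 1 / sqrt (2 * pi) * (cos (z * w) * exp (- v * z\<^sup>2 / 2)))"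
    using v by (auto simp: t_def std_normal_density_def power_mult_distrib field_simps)
  finally have *: "exp (- t\<^sup>2 / 2) = sqrt v / sqrt (2 * pi) * (\<integral>z. cos (z * w) * exp (- v * z\<^sup>2 / 2) \<partial>lborel)"
    by simp
  have "normal_density 0 (sqrt v) w = 1 / sqrt (2 * pi * v) * exp (- t\<^sup>2 / 2)"
    using v by (simp add: normal_density_def t_def power_divide)
  also have "\<dots> = 1 / (2 * pi) * (\<integral>z. cos (z * w) * exp (- v * z\<^sup>2 / 2) \<partial>lborel)"
  proof -
    define S V where "S = sqrt (2 * pi)" and "V = sqrt v"
    have "S * S = 2 * pi" "0 < S" "0 < V" "sqrt (2 * pi * v) = S * V"
      using v by (simp_all add: S_def V_def flip: real_sqrt_mult)
    then show ?thesis
      unfolding * S_def[symmetric] V_def[symmetric] by (simp add: mult.assoc[symmetric] flip: \<open>S * S = 2 * pi\<close>)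
  qed
  finally show ?thesis .
qed

lemma integrable_exp_Ioi:
  assumes "\<beta> < (0::real)"
  shows "integrable lborel (\<lambda>w. indicator {0<..} w * exp (\<beta> * w))"
  using integrable_I0i_exp_mscale[of "-\<beta>"] assms by (simp add: set_integrable_def mult.commute)

text \<open>\<open>F\<close> is an explicit antiderivative that vanishes at infinity because \<beta>
  < 0; the integral is therefore \<open>- F 0\<close>.\<close>

lemma sine_transform_exp:
  fixes \<beta> z :: real
  assumes \<beta>: "\<beta> < 0"
  shows "(\<integral>w. indicator {0<..} w * (exp (\<beta> * w) * sin (z * w)) \<partial>lborel) = z / (z\<^sup>2 + \<beta>\<^sup>2)" (is "?I = _")
proof -
  define F where "F w = exp (\<beta> * w) * (\<beta> * sin (z * w) - z * cos (z * w)) / (z\<^sup>2 + \<beta>\<^sup>2)" for w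
  have pos: "0 < z\<^sup>2 + \<beta>\<^sup>2" using \<beta> by (simp add: add_nonneg_pos)
  have int: "integrable lborel (\<lambda>w. indicator {0<..} w * (exp (\<beta> * w) * sin (z * w)))"
    by (rule Bochner_Integration.integrable_bound[OF integrable_exp_Ioi[OF \<beta>]])
       (auto simp: abs_mult split: split_indicator)
  have F: "(F has_real_derivative exp (\<beta> * w) * sin (z * w)) (at w)" for w
  proof -
    have "((\<lambda>w. exp (\<beta> * w) * (\<beta> * sin (z * w) - z * cos (z * w)))
        has_real_derivative (z\<^sup>2 + \<beta>\<^sup>2) * (exp (\<beta> * w) * sin (z * w))) (at w)"
      by (auto intro!: derivative_eq_intros simp: algebra_simps power2_eq_square)
    from DERIV_cdivide[OF this, of "z\<^sup>2 + \<beta>\<^sup>2"] show ?thesis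
      unfolding F_def[abs_def] using pos \<beta> by simp
  qed
  have FTC: "(\<integral>w. indicator {..y} w *\<^sub>R (indicator {0<..} w * (exp (\<beta> * w) * sin (z * w))) \<partial>lborel) = F y - F 0"
    if "0 \<le> y" for y
  proof -
    have "(\<integral>w. indicator {..y} w *\<^sub>R (indicator {0<..} w * (exp (\<beta> * w) * sin (z * w))) \<partial>lborel)
        = (\<integral>w. indicator {0..y} w *\<^sub>R (exp (\<beta> * w) * sin (z * w)) \<partial>lborel)"
      by (intro Bochner_Integration.integral_cong) (auto split: split_indicator)
    also have "\<dots> = F y - F 0"
    proof (rule integral_FTC_atLeastAtMost[OF that])
      show "(F has_vector_derivative exp (\<beta> * w) * sin (z * w)) (at w within {0..y})" for w
        unfolding has_real_derivative_iff_has_vector_derivative[symmetric]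
        by (rule has_field_derivative_at_within[OF F])
      show "continuous_on {0..y} (\<lambda>w. exp (\<beta> * w) * sin (z * w))"
        by (intro continuous_intros)
    qed
    finally show ?thesis .
  qed
  have "(F \<longlongrightarrow> 0) at_top"
  proof (rule tendsto_0_le[where K = "(\<bar>\<beta>\<bar> + \<bar>z\<bar>) / (z\<^sup>2 + \<beta>\<^sup>2)"])
    show "((\<lambda>w. exp (\<beta> * w)) \<longlongrightarrow> 0) at_top"
      using \<beta> by (intro filterlim_compose[OF exp_at_bot] filterlim_tendsto_neg_mult_at_bot[OF tendsto_const] filterlim_ident)
    have "\<bar>F w\<bar> \<le> exp (\<beta> * w) * ((\<bar>\<beta>\<bar> + \<bar>z\<bar>) / (z\<^sup>2 + \<beta>\<^sup>2))" for w
    proof -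
      have "\<bar>\<beta> * sin (z * w) - z * cos (z * w)\<bar> \<le> \<bar>\<beta>\<bar> * 1 + \<bar>z\<bar> * 1"
        by (rule order_trans[OF abs_triangle_ineq4]) (auto simp: abs_mult intro!: add_mono mult_left_le)
      then show ?thesis using pos by (simp add: F_def abs_mult divide_right_mono)
    qed
    then show "\<forall>\<^sub>F w in at_top. norm (F w) \<le> norm (exp (\<beta> * w)) * ((\<bar>\<beta>\<bar> + \<bar>z\<bar>) / (z\<^sup>2 + \<beta>\<^sup>2))"
      by simp
  qed
  then have "((\<lambda>y. F y - F 0) \<longlongrightarrow> 0 - F 0) at_top"
    by (intro tendsto_intros)
  moreover have "((\<lambda>y. F y - F 0) \<longlongrightarrow> ?I) at_top"
    by (rule Lim_transform_eventually[OF tendsto_integral_at_top[OF _ int]])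
      (auto intro!: eventually_mono[OF eventually_ge_at_top[of 0]] FTC simp del: real_scaleR_def)
  ultimately have "?I = 0 - F 0"
    by (intro tendsto_unique[OF trivial_limit_at_top_linorder])
  then show ?thesis by (simp add: F_def)
qed

text \<open>This is \<open>\<phi>\<close> above: killing a Brownian motion with drift at 0 amounts to running it freely with
  this payoff.\<close>

definition reflected_payoff :: "real \<Rightarrow> real \<Rightarrow> real" where
  "reflected_payoff \<beta> y = (if 0 < y then 1 else if y < 0 then - exp (- 2 * \<beta> * y) else 0)"

definition sine_kernel :: "real \<Rightarrow> real \<Rightarrow> real \<Rightarrow> real" where
  "sine_kernel \<beta> y z = z * sin (z * y) / (z\<^sup>2 + \<beta>\<^sup>2)"

lemma borel_measurable_reflected_payoff[measurable]: "reflected_payoff \<beta> \<in> borel_measurable borel"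
  unfolding reflected_payoff_def[abs_def] by measurable

lemma abs_reflected_payoff_le_1:
  assumes "\<beta> < 0"
  shows "\<bar>reflected_payoff \<beta> y\<bar> \<le> 1"
  using assms by (auto simp: reflected_payoff_def mult_nonpos_nonpos mult_neg_neg less_imp_le)

lemma borel_measurable_sine_kernel[measurable]: "sine_kernel \<beta> y \<in> borel_measurable borel"
  unfolding sine_kernel_def[abs_def] by measurable

text \<open>The sine difference contributes a second factor z, and
  \<open>z\<^sup>2 \<le> z\<^sup>2 + \<beta>\<^sup>2\<close> cancels the denominator. The constant 1
  depends neither on z nor on \<beta>; z = 0 is separate because the denominator may then
  vanish.\<close>

lemma sine_kernel_lipschitz: "\<bar>sine_kernel \<beta> y z - sine_kernel \<beta> y' z\<bar> \<le> \<bar>y - y'\<bar>"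
proof (cases "z = 0")
  case False
  have "\<bar>sin (z * y) - sin (z * y')\<bar> \<le> \<bar>z * y - z * y'\<bar>"
  proof -
    have "\<bar>sin (z * y) - sin (z * y')\<bar>
        = 2 * (\<bar>sin ((z * y - z * y') / 2)\<bar> * \<bar>cos ((z * y + z * y') / 2)\<bar>)"
      by (simp add: sin_diff_sin abs_mult)
    also have "\<dots> \<le> 2 * (\<bar>(z * y - z * y') / 2\<bar> * 1)"
      by (intro mult_left_mono mult_mono abs_sin_x_le_abs_x) auto
    finally show ?thesis by simp
  qed
  then have "\<bar>z\<bar> * \<bar>sin (z * y) - sin (z * y')\<bar> \<le> \<bar>z\<bar> * (\<bar>z\<bar> * \<bar>y - y'\<bar>)"
    by (intro mult_left_mono) (auto simp: abs_mult simp flip: right_diff_distrib)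
  also have "\<dots> \<le> (z\<^sup>2 + \<beta>\<^sup>2) * \<bar>y - y'\<bar>"
    unfolding mult.assoc[symmetric] by (intro mult_right_mono) (auto simp: power2_eq_square)
  finally show ?thesis
    using False unfolding sine_kernel_def diff_divide_distrib[symmetric] right_diff_distrib[symmetric]
    by (simp add: abs_mult divide_le_eq add_pos_nonneg mult.commute)
qed (simp add: sine_kernel_def)

lemma sine_kernel_bound: "\<bar>sine_kernel \<beta> y z\<bar> \<le> \<bar>y\<bar>"
  using sine_kernel_lipschitz[of \<beta> y z 0] by (simp add: sine_kernel_def)

lemma integrable_sine_kernel_gaussian:
  assumes "0 < v"
  shows "integrable lborel (\<lambda>z. sine_kernel \<beta> y z * exp (- v * z\<^sup>2 / 2))"
proof (rule Bochner_Integration.integrable_bound)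
  show "integrable lborel (\<lambda>z. \<bar>y\<bar> * exp (- v * z\<^sup>2 / 2))"
    by (intro integrable_mult_right integrable_gaussian assms)
qed (auto simp: abs_mult intro!: mult_right_mono sine_kernel_bound)

definition gaussian_sine_integral :: "real \<Rightarrow> real \<Rightarrow> real \<Rightarrow> real" where
  "gaussian_sine_integral \<beta> v y = (\<integral>z. sine_kernel \<beta> y z * exp (- v * z\<^sup>2 / 2) \<partial>lborel)"

lemma gaussian_sine_integral_0[simp]: "gaussian_sine_integral \<beta> v 0 = 0"
  by (simp add: gaussian_sine_integral_def sine_kernel_def)

text \<open>The constant depends on v only through the lower bound \<open>d\<close>, so one constant
  serves all hitting times that leave at least the variance \<open>d\<close> until the
  horizon.\<close>

lemma gaussian_sine_integral_lipschitz:
  assumes "0 < d" "d \<le> v"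
  shows "\<bar>gaussian_sine_integral \<beta> v y - gaussian_sine_integral \<beta> v y'\<bar>
    \<le> \<bar>y - y'\<bar> * (\<integral>z. exp (- d * z\<^sup>2 / 2) \<partial>lborel)"
proof -
  have v: "0 < v" using assms by simp
  have "gaussian_sine_integral \<beta> v y - gaussian_sine_integral \<beta> v y'
      = (\<integral>z. (sine_kernel \<beta> y z - sine_kernel \<beta> y' z) * exp (- v * z\<^sup>2 / 2) \<partial>lborel)"
    unfolding gaussian_sine_integral_def left_diff_distrib
    by (intro Bochner_Integration.integral_diff[symmetric] integrable_sine_kernel_gaussian v)
  also have "\<bar>\<dots>\<bar> \<le> (\<integral>z. \<bar>y - y'\<bar> * exp (- d * z\<^sup>2 / 2) \<partial>lborel)"
  proof (rule integral_abs_bound_integral[rotated 2])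
    fix z :: real
    have "exp (- v * z\<^sup>2 / 2) \<le> exp (- d * z\<^sup>2 / 2)"
      using assms by (auto intro!: mult_right_mono)
    then show "\<bar>(sine_kernel \<beta> y z - sine_kernel \<beta> y' z) * exp (- v * z\<^sup>2 / 2)\<bar>
        \<le> \<bar>y - y'\<bar> * exp (- d * z\<^sup>2 / 2)"
      unfolding abs_mult by (intro mult_mono sine_kernel_lipschitz) auto
  next
    show "integrable lborel (\<lambda>z. (sine_kernel \<beta> y z - sine_kernel \<beta> y' z) * exp (- v * z\<^sup>2 / 2))"
      unfolding left_diff_distrib
      by (intro Bochner_Integration.integrable_diff integrable_sine_kernel_gaussian v)
    show "integrable lborel (\<lambda>z. \<bar>y - y'\<bar> * exp (- d * z\<^sup>2 / 2))"
      by (intro integrable_mult_right integrable_gaussian assms)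
  qed
  finally show ?thesis by simp
qed

text \<open>Write the Gaussian density as a cosine transform and exchange the integrals. The inner
  integral of an odd function against cos (z (w - y)) leaves 2 sin (z y) times its sine transform on
  the half-line; this 2 turns 1 / (2 pi) into 1 / pi.\<close>

lemma gaussian_sine_integral_eq:
  assumes \<beta>: "\<beta> < 0" and v: "0 < v"
  shows "(\<integral>w. exp (\<beta> * (y + w)) * reflected_payoff \<beta> (y + w) * normal_density 0 (sqrt v) w \<partial>lborel)
    = gaussian_sine_integral \<beta> v y / pi"
proof -
  \<comment> \<open>The odd extension of exp (\<beta> w) from the positive half-line.\<close>
  define k where "k w = indicator {0<..} w * exp (\<beta> * w) - indicator {0<..} (- w) * exp (\<beta> * (- w))" for w :: real
  have k: "exp (\<beta> * w) * reflected_payoff \<beta> w = k w" for w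
    by (auto simp: k_def reflected_payoff_def indicator_def simp flip: exp_add)
  have int_neg: "integrable lborel (\<lambda>w. indicator {0<..} (- w) * exp (\<beta> * (- w)))"
    using lborel_integrable_real_affine[OF integrable_exp_Ioi[OF \<beta>], of "-1" 0] by simp
  have [measurable]: "k \<in> borel_measurable borel"
    unfolding k_def[abs_def] by measurable
  have int_k: "integrable lborel k"
    unfolding k_def[abs_def] by (intro Bochner_Integration.integrable_diff int_neg integrable_exp_Ioi \<beta>)
  have cos_k: "(\<integral>w. k w * cos (z * (w - y)) \<partial>lborel) = 2 * sine_kernel \<beta> y z" for z
  proof -
    \<comment> \<open>\<open>g\<close> is the part from positive w, and \<open>h\<close> the part
      from negative w reflected to the positive side; their difference uses cos (A - B) - cos (A +
      B) = 2 sin A sin B.\<close>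
    define g where "g w = indicator {0<..} w * exp (\<beta> * w) * cos (z * (w - y))" for w
    define h where "h w = indicator {0<..} w * exp (\<beta> * w) * cos (z * (- w - y))" for w
    have int_g: "integrable lborel g"
      unfolding g_def[abs_def] by (rule Bochner_Integration.integrable_bound[OF integrable_exp_Ioi[OF \<beta>]])
       (auto simp: abs_mult split: split_indicator)
    have int_h: "integrable lborel h"
      unfolding h_def[abs_def] by (rule Bochner_Integration.integrable_bound[OF integrable_exp_Ioi[OF \<beta>]])
       (auto simp: abs_mult split: split_indicator)
    have int_h': "integrable lborel (\<lambda>w. h (- w))"
      using lborel_integrable_real_affine[OF int_h, of "-1" 0] by simp
    have "(\<integral>w. k w * cos (z * (w - y)) \<partial>lborel) = (\<integral>w. g w - h (- w) \<partial>lborel)"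
      by (intro Bochner_Integration.integral_cong) (auto simp: k_def g_def h_def algebra_simps)
    also have "\<dots> = (\<integral>w. g w \<partial>lborel) - (\<integral>w. h (- w) \<partial>lborel)"
      by (intro Bochner_Integration.integral_diff int_g int_h')
    also have "(\<integral>w. h (- w) \<partial>lborel) = (\<integral>w. h w \<partial>lborel)"
      by (subst (2) lborel_integral_real_affine[where c = "-1" and t = 0]) auto
    also have "(\<integral>w. g w \<partial>lborel) - (\<integral>w. h w \<partial>lborel) = (\<integral>w. g w - h w \<partial>lborel)"
      by (intro Bochner_Integration.integral_diff[symmetric] int_g int_h)
    also have "\<dots> = (\<integral>w. 2 * sin (z * y) * (indicator {0<..} w * (exp (\<beta> * w) * sin (z * w))) \<partial>lborel)"
    proof (intro Bochner_Integration.integral_cong refl)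
      fix w
      have "z * (- w - y) = - (z * w + z * y)" by (simp add: algebra_simps)
      then have "cos (z * (- w - y)) = cos (z * w + z * y)" by (simp only: cos_minus)
      then show "g w - h w = 2 * sin (z * y) * (indicator {0<..} w * (exp (\<beta> * w) * sin (z * w)))"
        by (simp add: g_def h_def right_diff_distrib cos_diff cos_add algebra_simps split: split_indicator)
    qed
    also have "\<dots> = 2 * sin (z * y) * (z / (z\<^sup>2 + \<beta>\<^sup>2))"
      by (subst integral_mult_right_zero) (simp only: sine_transform_exp[OF \<beta>])
    finally show ?thesis by (simp add: sine_kernel_def)
  qed
  define E where "E z = exp (- v * z\<^sup>2 / 2)" for z :: real
  have [measurable]: "E \<in> borel_measurable borel" unfolding E_def[abs_def] by measurable
  have int_E: "integrable lborel E" unfolding E_def[abs_def] by (rule integrable_gaussian[OF v])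
  have "(\<integral>w. exp (\<beta> * (y + w)) * reflected_payoff \<beta> (y + w) * normal_density 0 (sqrt v) w \<partial>lborel)
      = (\<integral>w. k (y + w) * normal_density 0 (sqrt v) w \<partial>lborel)"
    by (simp add: k)
  also have "\<dots> = (\<integral>w. k w * normal_density 0 (sqrt v) (w - y) \<partial>lborel)"
    by (subst (2) lborel_integral_real_affine[where c = 1 and t = y]) auto
  also have "\<dots> = (\<integral>w. 1 / (2 * pi) * (\<integral>z. k w * (cos (z * (w - y)) * E z) \<partial>lborel) \<partial>lborel)"
    by (simp add: normal_density_eq_cosine_transform[OF v] E_def)
  also have "\<dots> = 1 / (2 * pi) * (\<integral>w. (\<integral>z. k w * (cos (z * (w - y)) * E z) \<partial>lborel) \<partial>lborel)"
    by simp
  also have "(\<integral>w. (\<integral>z. k w * (cos (z * (w - y)) * E z) \<partial>lborel) \<partial>lborel)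
      = (\<integral>z. (\<integral>w. k w * (cos (z * (w - y)) * E z) \<partial>lborel) \<partial>lborel)"
  proof (rule lborel_pair.Fubini_integral[symmetric])
    have prod: "integrable (lborel \<Otimes>\<^sub>M lborel) (\<lambda>(w, z). k w * E z)"
      using int_k int_E by (intro lborel_pair.Fubini_integrable) (auto simp: abs_mult)
    show "integrable (lborel \<Otimes>\<^sub>M lborel) (\<lambda>(w, z). k w * (cos (z * (w - y)) * E z))"
      by (rule Bochner_Integration.integrable_bound[OF prod])
         (auto simp: abs_mult split_beta intro!: mult_left_mono mult_left_le_one_le)
  qed
  also have "\<dots> = (\<integral>z. 2 * (sine_kernel \<beta> y z * E z) \<partial>lborel)"
  proof (intro Bochner_Integration.integral_cong refl)
    fix z
    have "(\<integral>w. k w * (cos (z * (w - y)) * E z) \<partial>lborel) = (\<integral>w. k w * cos (z * (w - y)) * E z \<partial>lborel)"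
      by (simp add: mult.assoc)
    also have "\<dots> = 2 * sine_kernel \<beta> y z * E z" by (simp add: cos_k)
    finally show "(\<integral>w. k w * (cos (z * (w - y)) * E z) \<partial>lborel) = 2 * (sine_kernel \<beta> y z * E z)" by simp
  qed
  finally show ?thesis by (simp add: gaussian_sine_integral_def E_def)
qed

text \<open>Completing the square: since the mean is \<beta> times the variance, the density is the
  centred one tilted by exp (\<beta> w). Splitting this as exp (- \<beta> y) exp (\<beta> (y + w))
  supplies the factor that makes the payoff odd.\<close>

lemma integral_reflected_payoff_normal:
  assumes \<beta>: "\<beta> < 0" and v: "0 < v"
  shows "(\<integral>w. reflected_payoff \<beta> (y + w) * normal_density (\<beta> * v) (sqrt v) w \<partial>lborel)
    = exp (- \<beta> * y - \<beta>\<^sup>2 * v / 2) / pi * gaussian_sine_integral \<beta> v y"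
proof -
  have "normal_density (\<beta> * v) (sqrt v) w
      = exp (- \<beta> * y - \<beta>\<^sup>2 * v / 2) * (exp (\<beta> * (y + w)) * normal_density 0 (sqrt v) w)" for w
  proof -
    have "- (w - \<beta> * v)\<^sup>2 / (2 * v) = (- \<beta> * y - \<beta>\<^sup>2 * v / 2) + (\<beta> * (y + w) + - w\<^sup>2 / (2 * v))"
      using v by (simp add: field_simps power2_eq_square)
    then show ?thesis
      using v by (simp add: normal_density_def exp_add[symmetric] algebra_simps)
  qed
  then have "(\<integral>w. reflected_payoff \<beta> (y + w) * normal_density (\<beta> * v) (sqrt v) w \<partial>lborel)
      = (\<integral>w. exp (- \<beta> * y - \<beta>\<^sup>2 * v / 2) *
          (exp (\<beta> * (y + w)) * reflected_payoff \<beta> (y + w) * normal_density 0 (sqrt v) w) \<partial>lborel)"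
    by (simp add: mult_ac)
  also have "\<dots> = exp (- \<beta> * y - \<beta>\<^sup>2 * v / 2) * (gaussian_sine_integral \<beta> v y / pi)"
    by (subst integral_mult_right_zero) (simp only: gaussian_sine_integral_eq[OF assms])
  finally show ?thesis by simp
qed

section \<open>Truncated sine integrals and tail bounds uniform in the variance\<close>

definition partial_sine_integral :: "real \<Rightarrow> real \<Rightarrow> real \<Rightarrow> real \<Rightarrow> real" where
  "partial_sine_integral \<beta> v y N = integral {- N..N} (\<lambda>z. sine_kernel \<beta> y z * exp (- v * z\<^sup>2 / 2))"

lemma continuous_on_sine_kernel_gaussian:
  assumes "\<beta> \<noteq> 0"
  shows "continuous_on A (\<lambda>z. sine_kernel \<beta> y z * exp (- v * z\<^sup>2 / 2))"
proof -
  have "z\<^sup>2 + \<beta>\<^sup>2 \<noteq> 0" for z using assms by (simp add: sum_power2_eq_zero_iff)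
  then show ?thesis unfolding sine_kernel_def by (intro continuous_intros) auto
qed

text \<open>Beyond - \<beta> the amplitude z / (\<open>z\<^sup>2 + \<beta>\<^sup>2\<close>)
  decreases, as does the exponential, also for v = 0. The second mean value theorem bounds the
  integral by two terms, each an amplitude of at most 1 / N times a sine integral of at most 2 /
  y.\<close>

lemma integral_sine_kernel_tail:
  assumes \<beta>: "\<beta> < 0" and y: "0 < y" and v: "0 \<le> v" and N: "- \<beta> \<le> N" "N \<le> M"
  shows "\<bar>integral {N..M} (\<lambda>z. sine_kernel \<beta> y z * exp (- v * z\<^sup>2 / 2))\<bar> \<le> 4 / (y * N)"
proof -
  \<comment> \<open>The sign makes \<open>g\<close> increasing, as the second mean value theorem
    requires.\<close>
  define g where "g z = - (z / (z\<^sup>2 + \<beta>\<^sup>2) * exp (- v * z\<^sup>2 / 2))" for z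
  have N0: "0 < N" using \<beta> N by simp
  have pos: "0 < z\<^sup>2 + \<beta>\<^sup>2" for z using \<beta> by (simp add: add_nonneg_pos)
  have mono: "g a \<le> g b" if ab: "N \<le> a" "a \<le> b" "b \<le> M" for a b
  proof -
    \<comment> \<open>Monotonicity of the amplitude reduces to (b - a) (a b -
      \<open>\<beta>\<^sup>2\<close>) \<ge> 0, which is where the start of the interval at or beyond
      - \<beta> enters.\<close>
    have "\<beta>\<^sup>2 = (- \<beta>) * (- \<beta>)" by (simp add: power2_eq_square)
    also have "\<dots> \<le> a * b" using \<beta> N ab by (intro mult_mono) auto
    finally have "(b - a) * \<beta>\<^sup>2 \<le> (b - a) * (a * b)" using ab by (intro mult_left_mono) auto
    then have "b * (a\<^sup>2 + \<beta>\<^sup>2) \<le> a * (b\<^sup>2 + \<beta>\<^sup>2)" by (simp add: algebra_simps power2_eq_square)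
    then have 1: "b / (b\<^sup>2 + \<beta>\<^sup>2) \<le> a / (a\<^sup>2 + \<beta>\<^sup>2)"
      by (intro mult_imp_div_pos_le pos, unfold times_divide_eq_left) (intro mult_imp_le_div_pos pos)
    have "v * a\<^sup>2 \<le> v * b\<^sup>2" using v ab N0 by (intro mult_left_mono power_mono) auto
    then have 2: "exp (- v * b\<^sup>2 / 2) \<le> exp (- v * a\<^sup>2 / 2)" by simp
    show ?thesis
      unfolding g_def using 1 2 pos[of a] ab N0 by (intro le_imp_neg_le mult_mono) auto
  qed
  have bound_g: "\<bar>g z\<bar> \<le> 1 / N" if "N \<le> z" for z
  proof -
    have "0 < z" using N0 that by simp
    have "\<bar>g z\<bar> = z / (z\<^sup>2 + \<beta>\<^sup>2) * exp (- v * z\<^sup>2 / 2)"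
      unfolding g_def using \<open>0 < z\<close> pos[of z] by (simp add: abs_mult)
    also have "\<dots> \<le> 1 / z * 1"
    proof (intro mult_mono)
      show "z / (z\<^sup>2 + \<beta>\<^sup>2) \<le> 1 / z"
        using \<open>0 < z\<close> pos[of z] by (simp add: field_simps power2_eq_square)
    qed (use v \<open>0 < z\<close> in auto)
    also have "\<dots> \<le> 1 / N" using that N0 by (simp add: frac_le)
    finally show ?thesis .
  qed
  have sin_int: "((\<lambda>z. sin (z * y)) has_integral (cos (a * y) / y - cos (b * y) / y)) {a..b}" if "a \<le> b" for a b
  proof -
    have "((\<lambda>z. sin (z * y)) has_integral (- cos (b * y) / y - - cos (a * y) / y)) {a..b}"
      using that y
      by (intro fundamental_theorem_of_calculus)
        (auto intro!: derivative_eq_intros simp: has_real_derivative_iff_has_vector_derivative[symmetric])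
    then show ?thesis by simp
  qed
  have sin_bound: "\<bar>integral {a..b} (\<lambda>z. sin (z * y))\<bar> \<le> 2 / y" if "a \<le> b" for a b
  proof -
    have "\<bar>cos (a * y) - cos (b * y)\<bar> \<le> 1 + 1"
      by (rule order_trans[OF abs_triangle_ineq4]) (intro add_mono abs_cos_le_one)
    then have "\<bar>cos (a * y) - cos (b * y)\<bar> / y \<le> 2 / y" using y by (intro divide_right_mono) auto
    then show ?thesis
      using y integral_unique[OF sin_int[OF that]] by (simp add: diff_divide_distrib[symmetric])
  qed
  obtain c where c: "c \<in> {N..M}"
    and eq: "integral {N..M} (\<lambda>z. g z * sin (z * y)) = g N * integral {N..c} (\<lambda>z. sin (z * y)) + g M * integral {c..M} (\<lambda>z. sin (z * y))"
    by (rule second_mean_value_theorem[of "\<lambda>z. sin (z * y)" N M g])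
       (use sin_int[of N M] N mono in \<open>auto simp: has_integral_integrable\<close>)
  have "(\<lambda>z. sine_kernel \<beta> y z * exp (- v * z\<^sup>2 / 2)) = (\<lambda>z. - (g z * sin (z * y)))"
    by (auto simp: sine_kernel_def g_def)
  then have "\<bar>integral {N..M} (\<lambda>z. sine_kernel \<beta> y z * exp (- v * z\<^sup>2 / 2))\<bar> = \<bar>integral {N..M} (\<lambda>z. g z * sin (z * y))\<bar>"
    by simp
  also have "\<dots> \<le> \<bar>g N\<bar> * \<bar>integral {N..c} (\<lambda>z. sin (z * y))\<bar> + \<bar>g M\<bar> * \<bar>integral {c..M} (\<lambda>z. sin (z * y))\<bar>"
    unfolding eq abs_mult[symmetric] by (rule abs_triangle_ineq)
  also have "\<dots> \<le> 1 / N * (2 / y) + 1 / N * (2 / y)"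
    using c N N0 y by (intro add_mono mult_mono bound_g sin_bound) auto
  also have "\<dots> = 4 / (y * N)" using N0 y by (simp add: field_simps)
  finally show ?thesis .
qed

text \<open>The integrand is even, so the two tails are equal and the constant 4 doubles.\<close>

lemma partial_sine_integral_diff:
  assumes "\<beta> < 0" "0 < y" "0 \<le> v" "- \<beta> \<le> N" "N \<le> M"
  shows "\<bar>partial_sine_integral \<beta> v y M - partial_sine_integral \<beta> v y N\<bar> \<le> 8 / (y * N)"
proof -
  define h where "h = (\<lambda>z. sine_kernel \<beta> y z * exp (- v * z\<^sup>2 / 2))"
  have int: "h integrable_on {a..b}" for a b
    unfolding h_def by (intro integrable_continuous_real continuous_on_sine_kernel_gaussian) (use assms in simp)
  have N: "0 < N" using assms by simp
  have "integral {- M..M} h = integral {- M..N} h + integral {N..M} h"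
    using assms N by (intro Henstock_Kurzweil_Integration.integral_combine[symmetric] int) auto
  also have "integral {- M..N} h = integral {- M..- N} h + integral {- N..N} h"
    using assms N by (intro Henstock_Kurzweil_Integration.integral_combine[symmetric] int) auto
  also have "integral {- M..- N} h = integral {- M..- N} (\<lambda>z. h (- z))"
    by (simp add: h_def sine_kernel_def)
  also have "\<dots> = integral {N..M} h"
    by (rule Henstock_Kurzweil_Integration.integral_reflect_real)
  finally have "partial_sine_integral \<beta> v y M - partial_sine_integral \<beta> v y N = 2 * integral {N..M} h"
    by (simp add: partial_sine_integral_def h_def)
  then show ?thesis
    using integral_sine_kernel_tail[OF assms] by (simp add: h_def abs_mult)
qed

lemma partial_sine_integral_LIMSEQ:
  assumes "\<beta> \<noteq> 0" "0 < v"
  shows "(\<lambda>n. partial_sine_integral \<beta> v y (real n)) \<longlonglongrightarrow> gaussian_sine_integral \<beta> v y"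
proof -
  define h where "h = (\<lambda>z. sine_kernel \<beta> y z * exp (- v * z\<^sup>2 / 2))"
  have int: "integrable lborel h" unfolding h_def by (rule integrable_sine_kernel_gaussian[OF assms(2)])
  have "(\<lambda>n. \<integral>z. indicator {- real n..real n} z * h z \<partial>lborel) \<longlonglongrightarrow> (\<integral>z. h z \<partial>lborel)"
  proof (rule integral_dominated_convergence[where w = "\<lambda>z. \<bar>h z\<bar>" and f = h
        and s = "\<lambda>n z. indicator {- real n..real n} z * h z"])
    show "AE z in lborel. (\<lambda>n. indicator {- real n..real n} z * h z) \<longlonglongrightarrow> h z"
    proof (rule AE_I2, rule tendsto_eventually)
      fix z :: real
      obtain n0 where "\<bar>z\<bar> \<le> real n0" using real_arch_simple by blast
      then show "\<forall>\<^sub>F n in sequentially. indicator {- real n..real n} z * h z = h z"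
        by (intro eventually_mono[OF eventually_ge_at_top[of n0]]) (auto simp: indicator_def abs_le_iff)
    qed
  next
    show "h \<in> borel_measurable lborel" using int by (rule borel_measurable_integrable)
    then show "(\<lambda>z. indicator {- real n..real n} z * h z) \<in> borel_measurable lborel" for n
      by measurable
    show "integrable lborel (\<lambda>z. \<bar>h z\<bar>)" using int by (rule integrable_abs)
    show "AE z in lborel. norm (indicator {- real n..real n} z * h z) \<le> \<bar>h z\<bar>" for n
      by (intro AE_I2) (simp split: split_indicator)
  qed
  moreover have "(\<integral>z. indicator {- real n..real n} z * h z \<partial>lborel) = partial_sine_integral \<beta> v y (real n)" for n
  proof -
    have "set_integrable lborel {- real n..real n} h"
      unfolding set_integrable_def by (rule integrable_mult_indicator[OF _ int]) simp
    from set_borel_integral_eq_integral(2)[OF this] show ?thesis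
      unfolding partial_sine_integral_def h_def[symmetric] set_lebesgue_integral_def by simp
  qed
  ultimately show ?thesis by (simp add: gaussian_sine_integral_def h_def)
qed

lemma partial_sine_integral_gaussian_bound:
  assumes "\<beta> < 0" "0 < y" "0 < v" "- \<beta> \<le> N"
  shows "\<bar>gaussian_sine_integral \<beta> v y - partial_sine_integral \<beta> v y N\<bar> \<le> 8 / (y * N)"
proof (rule tendsto_upperbound)
  show "(\<lambda>n. \<bar>partial_sine_integral \<beta> v y (real n) - partial_sine_integral \<beta> v y N\<bar>)
      \<longlonglongrightarrow> \<bar>gaussian_sine_integral \<beta> v y - partial_sine_integral \<beta> v y N\<bar>"
    using assms by (intro tendsto_intros partial_sine_integral_LIMSEQ) auto
  obtain n0 where "N \<le> real n0" using real_arch_simple by blast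
  then show "\<forall>\<^sub>F n in sequentially. \<bar>partial_sine_integral \<beta> v y (real n) - partial_sine_integral \<beta> v y N\<bar> \<le> 8 / (y * N)"
    using assms by (intro eventually_mono[OF eventually_ge_at_top[of n0]] partial_sine_integral_diff) auto
qed simp

lemma partial_sine_integral_tendsto_0:
  assumes "\<beta> \<noteq> 0" "v \<longlonglongrightarrow> 0"
  shows "(\<lambda>n. partial_sine_integral \<beta> (v n) y N) \<longlonglongrightarrow> partial_sine_integral \<beta> 0 y N"
proof -
  have "z\<^sup>2 + \<beta>\<^sup>2 \<noteq> 0" for z using assms(1) by (simp add: sum_power2_eq_zero_iff)
  then have "continuous_on (UNIV \<times> cbox (- N) N) (\<lambda>(v, z). sine_kernel \<beta> y z * exp (- v * z\<^sup>2 / 2))"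
    unfolding sine_kernel_def split_beta by (intro continuous_intros) auto
  then have "continuous_on UNIV (\<lambda>v. integral (cbox (- N) N) (\<lambda>z. sine_kernel \<beta> y z * exp (- v * z\<^sup>2 / 2)))"
    by (rule integral_continuous_on_param)
  then have "isCont (\<lambda>v. partial_sine_integral \<beta> v y N) 0"
    by (simp add: partial_sine_integral_def continuous_on_eq_continuous_at)
  from isCont_tendsto_compose[OF this assms(2)] show ?thesis .
qed

subsection \<open>Survival probability of a drifted Brownian motion\<close>

context prob_space
begin

text \<open>Independence enters as a bare product rule so that \<open>A\<close> may be the identity
  map into a sub-sigma-algebra, as well as a tuple of random variables.\<close>

lemma distr_pair_indep:
  assumes A[measurable]: "A \<in> M \<rightarrow>\<^sub>M N1" and B[measurable]: "B \<in> M \<rightarrow>\<^sub>M N2"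
    and indep: "\<And>a b. a \<in> sets N1 \<Longrightarrow> b \<in> sets N2 \<Longrightarrow>
      prob ((A -` a \<inter> space M) \<inter> (B -` b \<inter> space M)) = prob (A -` a \<inter> space M) * prob (B -` b \<inter> space M)"
  shows "distr M (N1 \<Otimes>\<^sub>M N2) (\<lambda>\<omega>. (A \<omega>, B \<omega>)) = distr M N1 A \<Otimes>\<^sub>M distr M N2 B"
proof -
  interpret A: prob_space "distr M N1 A" by (rule prob_space_distr[OF A])
  interpret B: prob_space "distr M N2 B" by (rule prob_space_distr[OF B])
  show ?thesis
  proof (rule pair_measure_eqI[symmetric])
    fix a b assume "a \<in> sets (distr M N1 A)" "b \<in> sets (distr M N2 B)"
    then have [measurable]: "a \<in> sets N1" "b \<in> sets N2" by auto
    have "(\<lambda>\<omega>. (A \<omega>, B \<omega>)) -` (a \<times> b) \<inter> space M = (A -` a \<inter> space M) \<inter> (B -` b \<inter> space M)"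
      by auto
    then show "emeasure (distr M N1 A) a * emeasure (distr M N2 B) b
        = emeasure (distr M (N1 \<Otimes>\<^sub>M N2) (\<lambda>\<omega>. (A \<omega>, B \<omega>))) (a \<times> b)"
      using indep[of a b] by (simp add: emeasure_distr emeasure_eq_measure ennreal_mult)
  qed (simp_all add: A.sigma_finite_measure_axioms B.sigma_finite_measure_axioms)
qed

text \<open>Fubini on the product law: \<open>A\<close> is frozen while \<open>B\<close> is
  averaged. The bound is asked of every point of the product, not only of attained values.\<close>

lemma expectation_pair_indep:
  fixes f :: "'b \<times> 'c \<Rightarrow> real"
  assumes A[measurable]: "A \<in> M \<rightarrow>\<^sub>M N1" and B[measurable]: "B \<in> M \<rightarrow>\<^sub>M N2"
    and indep: "\<And>a b. a \<in> sets N1 \<Longrightarrow> b \<in> sets N2 \<Longrightarrow>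
      prob ((A -` a \<inter> space M) \<inter> (B -` b \<inter> space M)) = prob (A -` a \<inter> space M) * prob (B -` b \<inter> space M)"
    and f[measurable]: "f \<in> borel_measurable (N1 \<Otimes>\<^sub>M N2)" and bound: "\<And>p. \<bar>f p\<bar> \<le> C"
  shows "expectation (\<lambda>\<omega>. f (A \<omega>, B \<omega>)) = expectation (\<lambda>\<omega>. expectation (\<lambda>\<omega>'. f (A \<omega>, B \<omega>')))"
proof -
  interpret A: prob_space "distr M N1 A" by (rule prob_space_distr[OF A])
  interpret B: prob_space "distr M N2 B" by (rule prob_space_distr[OF B])
  interpret AB: pair_prob_space "distr M N1 A" "distr M N2 B" ..
  have "expectation (\<lambda>\<omega>. f (A \<omega>, B \<omega>)) = integral\<^sup>L (distr M N1 A \<Otimes>\<^sub>M distr M N2 B) f"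
    by (simp add: integral_distr distr_pair_indep[OF A B indep, symmetric])
  also have "\<dots> = (\<integral>a. (\<integral>b. f (a, b) \<partial>distr M N2 B) \<partial>distr M N1 A)"
  proof (rule AB.integral_fst'[symmetric])
    show "integrable (distr M N1 A \<Otimes>\<^sub>M distr M N2 B) f"
      by (rule AB.P.integrable_const_bound[where B = C]) (use bound in auto)
  qed
  also have "\<dots> = expectation (\<lambda>\<omega>. \<integral>b. f (A \<omega>, b) \<partial>distr M N2 B)"
    by (subst integral_distr[OF A]) (auto intro!: B.borel_measurable_lebesgue_integral)
  also have "\<dots> = expectation (\<lambda>\<omega>. expectation (\<lambda>\<omega>'. f (A \<omega>, B \<omega>')))"
  proof (intro Bochner_Integration.integral_cong refl)
    fix \<omega> assume "\<omega> \<in> space M"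
    then have [measurable]: "A \<omega> \<in> space N1" by (rule measurable_space[OF A])
    show "(\<integral>b. f (A \<omega>, b) \<partial>distr M N2 B) = expectation (\<lambda>\<omega>'. f (A \<omega>, B \<omega>'))"
      by (subst integral_distr[OF B]) auto
  qed
  finally show ?thesis .
qed

end

text \<open>This is \<open>E (\<phi> (y + w))\<close> for \<open>w\<close> normal with mean \<open>\<beta> v\<close> and variance \<open>v\<close>.\<close>

definition survival_function :: "real \<Rightarrow> real \<Rightarrow> real \<Rightarrow> real" where
  "survival_function \<beta> v y = exp (- \<beta> * y - \<beta>\<^sup>2 * v / 2) / pi * gaussian_sine_integral \<beta> v y"

lemma continuous_on_survival_function:
  assumes "0 < v"
  shows "continuous_on A (survival_function \<beta> v)"
proof -
  define C where "C = (\<integral>z. exp (- v * z\<^sup>2 / 2) \<partial>lborel)"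
  have "(gaussian_sine_integral \<beta> v \<longlongrightarrow> gaussian_sine_integral \<beta> v y) (at y within A)" for y
  proof -
    have "((\<lambda>y'. \<bar>y' - y\<bar> * C) \<longlongrightarrow> \<bar>y - y\<bar> * C) (at y within A)" by (intro tendsto_intros)
    then have lim: "((\<lambda>y'. \<bar>y' - y\<bar> * C) \<longlongrightarrow> 0) (at y within A)" by simp
    have "norm (gaussian_sine_integral \<beta> v y' - gaussian_sine_integral \<beta> v y) \<le> \<bar>y' - y\<bar> * C" for y'
      unfolding C_def real_norm_def by (rule gaussian_sine_integral_lipschitz[OF assms order_refl])
    then have "((\<lambda>y'. gaussian_sine_integral \<beta> v y' - gaussian_sine_integral \<beta> v y) \<longlongrightarrow> 0) (at y within A)"
      by (intro Lim_null_comparison[OF always_eventually lim] allI)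
    then show ?thesis by (simp add: Lim_null[symmetric])
  qed
  then have "continuous_on A (gaussian_sine_integral \<beta> v)" by (simp add: continuous_on_def)
  then show ?thesis unfolding survival_function_def[abs_def] by (intro continuous_intros) auto
qed

lemma borel_measurable_survival_function[measurable (raw)]:
  assumes "0 < v" "f \<in> borel_measurable N"
  shows "(\<lambda>x. survival_function \<beta> v (f x)) \<in> borel_measurable N"
  using measurable_compose[OF assms(2) borel_measurable_continuous_onI[OF continuous_on_survival_function[OF assms(1)]]]
  by simp

text \<open>The function vanishes at y = 0 and is Lipschitz there, uniformly over variances above
  \<open>d\<close>; for \<open>\<bar>y\<bar> \<le> 1\<close> its exponent is at most
  \<open>\<bar>\<beta>\<bar>\<close>. This controls the overshoot below 0 at a grid hit.\<close>

lemma survival_function_small: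
  assumes "0 < d" "d \<le> v" "\<bar>y\<bar> \<le> 1"
  shows "\<bar>survival_function \<beta> v y\<bar> \<le> exp \<bar>\<beta>\<bar> / pi * (\<integral>z. exp (- d * z\<^sup>2 / 2) \<partial>lborel) * \<bar>y\<bar>"
proof -
  have "- \<beta> * y \<le> \<bar>\<beta>\<bar> * \<bar>y\<bar>" by (simp add: abs_mult[symmetric] abs_le_iff)
  also have "\<dots> \<le> \<bar>\<beta>\<bar>" using assms by (intro mult_left_le) auto
  finally have "- \<beta> * y - \<beta>\<^sup>2 * v / 2 \<le> \<bar>\<beta>\<bar>" using assms
    by (smt (verit) divide_nonneg_nonneg mult_nonneg_nonneg zero_le_power2)
  moreover have "\<bar>gaussian_sine_integral \<beta> v y\<bar> \<le> \<bar>y\<bar> * (\<integral>z. exp (- d * z\<^sup>2 / 2) \<partial>lborel)"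
    using gaussian_sine_integral_lipschitz[OF assms(1,2), of \<beta> y 0] by simp
  ultimately have "exp (- \<beta> * y - \<beta>\<^sup>2 * v / 2) / pi * \<bar>gaussian_sine_integral \<beta> v y\<bar>
      \<le> exp \<bar>\<beta>\<bar> / pi * (\<bar>y\<bar> * (\<integral>z. exp (- d * z\<^sup>2 / 2) \<partial>lborel))"
    by (intro mult_mono divide_right_mono) auto
  then show ?thesis by (simp add: survival_function_def abs_mult mult_ac)
qed

text \<open>The bound is not visible in the sine integral; it comes from the reading as a mean of a
  payoff bounded by 1.\<close>

lemma abs_survival_function_le_1:
  assumes \<beta>: "\<beta> < 0" and v: "0 < v"
  shows "\<bar>survival_function \<beta> v y\<bar> \<le> 1"
proof -
  have "survival_function \<beta> v y = (\<integral>w. reflected_payoff \<beta> (y + w) * normal_density (\<beta> * v) (sqrt v) w \<partial>lborel)"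
    unfolding survival_function_def by (rule integral_reflected_payoff_normal[OF assms, symmetric])
  also have "\<bar>\<dots>\<bar> \<le> (\<integral>w. normal_density (\<beta> * v) (sqrt v) w \<partial>lborel)"
  proof (rule integral_abs_bound_integral)
    show int: "integrable lborel (normal_density (\<beta> * v) (sqrt v))" using v by simp
    show bd: "\<bar>reflected_payoff \<beta> (y + w) * normal_density (\<beta> * v) (sqrt v) w\<bar> \<le> normal_density (\<beta> * v) (sqrt v) w" for w
      using abs_reflected_payoff_le_1[OF \<beta>, of "y + w"]
      by (simp add: abs_mult mult_left_le_one_le)
    show "integrable lborel (\<lambda>w. reflected_payoff \<beta> (y + w) * normal_density (\<beta> * v) (sqrt v) w)"
      by (rule Bochner_Integration.integrable_bound[OF int]) (use bd in auto)
  qed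
  also have "\<dots> = 1" using v by simp
  finally show ?thesis .
qed

section \<open>Continuous paths on grids and measurability of passage times\<close>

lemma grid_approx:
  fixes u s :: real
  assumes "u \<in> {0..s}"
  shows "\<exists>k. (\<forall>n. k n \<le> Suc n) \<and> (\<lambda>n. s * real (k n) / real (Suc n)) \<longlonglongrightarrow> u"
proof (cases "s = 0")
  case True
  with assms show ?thesis by (intro exI[of _ "\<lambda>_. 0"]) auto
next
  case False
  with assms have s: "0 < s" by auto
  define k where "k n = nat \<lfloor>u / s * real (Suc n)\<rfloor>" for n
  have r: "0 \<le> u / s" "u / s \<le> 1" using assms s by auto
  have k_le: "real (k n) \<le> u / s * real (Suc n)" for n
    unfolding k_def using r by (intro of_nat_floor mult_nonneg_nonneg) auto
  have k_gt: "u / s * real (Suc n) - 1 \<le> real (k n)" for n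
    unfolding k_def by linarith
  have "k n \<le> Suc n" for n
  proof -
    have "u / s * real (Suc n) \<le> 1 * real (Suc n)" using r by (intro mult_right_mono) auto
    then have "real (k n) \<le> 1 * real (Suc n)" by (rule order_trans[OF k_le])
    then show ?thesis by simp
  qed
  moreover have "(\<lambda>n. s * real (k n) / real (Suc n)) \<longlonglongrightarrow> u"
  proof (rule tendsto_sandwich)
    have "s * real (k n) \<le> u * real (Suc n)" for n
      using mult_left_mono[OF k_le[of n], of s] s by simp
    then show "\<forall>\<^sub>F n in sequentially. s * real (k n) / real (Suc n) \<le> u"
      by (intro always_eventually allI) (simp only: pos_divide_le_eq of_nat_0_less_iff zero_less_Suc)
    have k_lower: "u * real (Suc n) - s \<le> s * real (k n)" for n
      using mult_left_mono[OF k_gt[of n], of s] s by (simp add: algebra_simps)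
    have "u - s * inverse (real (Suc n)) \<le> s * real (k n) / real (Suc n)" for n
    proof (rule mult_imp_le_div_pos)
      have "(u - s * inverse (real (Suc n))) * real (Suc n) = u * real (Suc n) - s"
        by (simp add: left_diff_distrib del: of_nat_Suc)
      then show "(u - s * inverse (real (Suc n))) * real (Suc n) \<le> s * real (k n)"
        using k_lower[of n] by (simp only:)
    qed simp
    then show "\<forall>\<^sub>F n in sequentially. u - s * inverse (real (Suc n)) \<le> s * real (k n) / real (Suc n)"
      by (intro always_eventually allI)
    have "(\<lambda>n. u - s * inverse (real (Suc n))) \<longlonglongrightarrow> u - s * 0"
      by (intro tendsto_intros LIMSEQ_inverse_real_of_nat)
    then show "(\<lambda>n. u - s * inverse (real (Suc n))) \<longlonglongrightarrow> u" by simp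
  qed simp
  ultimately show ?thesis by blast
qed

text \<open>Weak inequality and a common lower bound on the grid points make the right-hand side a countable
  combination of events.\<close>

lemma positive_on_Icc_iff_grid:
  fixes f :: "real \<Rightarrow> real"
  assumes f: "continuous_on {0..} f" and s: "0 \<le> s"
  shows "(\<forall>u\<in>{0..s}. 0 < f u) \<longleftrightarrow> (\<exists>N::nat. \<forall>n k::nat. k \<le> Suc n \<longrightarrow> 1 / real (Suc N) \<le> f (s * real k / real (Suc n)))"
proof
  assume *: "\<forall>u\<in>{0..s}. 0 < f u"
  obtain m where m: "m \<in> {0..s}" "\<forall>u\<in>{0..s}. f m \<le> f u"
    using continuous_attains_inf[of "{0..s}" f] continuous_on_subset[OF f, of "{0..s}"] s by auto
  with * have "0 < f m" by blast
  then obtain N where N: "1 / real (Suc N) < f m" using nat_approx_posE by blast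
  have "1 / real (Suc N) \<le> f (s * real k / real (Suc n))" if "k \<le> Suc n" for n k
  proof -
    have "s * real k \<le> s * real (Suc n)" using s that by (intro mult_left_mono) auto
    then have "s * real k / real (Suc n) \<in> {0..s}" using s by (simp add: divide_le_eq)
    then show ?thesis using m N by fastforce
  qed
  then show "\<exists>N::nat. \<forall>n k::nat. k \<le> Suc n \<longrightarrow> 1 / real (Suc N) \<le> f (s * real k / real (Suc n))" by blast
next
  assume "\<exists>N::nat. \<forall>n k::nat. k \<le> Suc n \<longrightarrow> 1 / real (Suc N) \<le> f (s * real k / real (Suc n))"
  then obtain N where N: "\<And>n k::nat. k \<le> Suc n \<Longrightarrow> 1 / real (Suc N) \<le> f (s * real k / real (Suc n))" by blast
  show "\<forall>u\<in>{0..s}. 0 < f u"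
  proof
    fix u assume u: "u \<in> {0..s}"
    obtain k where k: "\<And>n. k n \<le> Suc n" "(\<lambda>n. s * real (k n) / real (Suc n)) \<longlonglongrightarrow> u"
      using grid_approx[OF u] by blast
    have "(\<lambda>n. f (s * real (k n) / real (Suc n))) \<longlonglongrightarrow> f u"
      by (rule continuous_on_tendsto_compose[OF f k(2)]) (use u s in auto)
    then have "1 / real (Suc N) \<le> f u"
      by (rule LIMSEQ_le_const) (use N k in auto)
    moreover have "0 < 1 / real (Suc N)" by simp
    ultimately show "0 < f u" by linarith
  qed
qed

lemma positive_on_Icc_sets:
  fixes Y :: "real \<Rightarrow> 'a \<Rightarrow> real"
  assumes Y: "\<And>t. 0 \<le> t \<Longrightarrow> Y t \<in> borel_measurable N"
    and cont: "\<And>\<omega>. \<omega> \<in> space N \<Longrightarrow> continuous_on {0..} (\<lambda>t. Y t \<omega>)" and s: "0 \<le> s"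
  shows "{\<omega> \<in> space N. \<forall>u\<in>{0..s}. 0 < Y u \<omega>} \<in> sets N"
proof -
  have [measurable]: "Y (s * real k / real (Suc n)) \<in> borel_measurable N" for n k
    using s by (intro Y) auto
  have "{\<omega> \<in> space N. \<forall>u\<in>{0..s}. 0 < Y u \<omega>}
      = {\<omega> \<in> space N. \<exists>n0::nat. \<forall>n k::nat. k \<le> Suc n \<longrightarrow> 1 / real (Suc n0) \<le> Y (s * real k / real (Suc n)) \<omega>}"
    using positive_on_Icc_iff_grid[OF cont s] by blast
  also have "\<dots> \<in> sets N" by measurable
  finally show ?thesis .
qed

text \<open>The measurable space \<open>N\<close> is arbitrary because the result is later applied
  to the sigma-algebra generated by the path of \<open>W\<close> alone.\<close>

lemma borel_measurable_first_passage_time: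
  fixes Y :: "real \<Rightarrow> 'a \<Rightarrow> real"
  assumes Y: "\<And>t. 0 \<le> t \<Longrightarrow> Y t \<in> borel_measurable N"
    and cont: "\<And>\<omega>. \<omega> \<in> space N \<Longrightarrow> continuous_on {0..} (\<lambda>t. Y t \<omega>)"
  shows "first_passage_time Y \<in> borel_measurable N"
proof (rule borel_measurableI_le)
  fix c :: ereal
  show "{\<omega> \<in> space N. first_passage_time Y \<omega> \<le> c} \<in> sets N"
  proof (cases c)
    case (real s)
    have eq: "{\<omega> \<in> space N. first_passage_time Y \<omega> \<le> c} = {\<omega> \<in> space N. \<exists>u\<in>{0..s}. Y u \<omega> \<le> 0}"
      unfolding real using first_passage_time_le_iff[of Y, OF cont] by blast
    show ?thesis
    proof (cases "0 \<le> s")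
      case True
      have "{\<omega> \<in> space N. \<exists>u\<in>{0..s}. Y u \<omega> \<le> 0} = space N - {\<omega> \<in> space N. \<forall>u\<in>{0..s}. 0 < Y u \<omega>}"
        by (auto simp: not_less)
      then show ?thesis unfolding eq using positive_on_Icc_sets[OF Y cont True] by auto
    qed (simp add: eq)
  next
    case MInf
    have "0 \<le> first_passage_time Y \<omega>" for \<omega>
      unfolding first_passage_time_def by (rule Inf_greatest) auto
    then have "first_passage_time Y \<omega> \<noteq> - \<infinity>" for \<omega>
      by (metis ereal_infty_less_eq(2) MInfty_neq_ereal(2) zero_ereal_def)
    then have "{\<omega> \<in> space N. first_passage_time Y \<omega> \<le> c} = {}"
      by (simp add: MInf)
    then show ?thesis by (simp only: sets.empty_sets)
  qed simp
qed

definition first_hit :: "(nat \<Rightarrow> real) \<Rightarrow> nat \<Rightarrow> bool" where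
  "first_hit x k \<longleftrightarrow> x k \<le> 0 \<and> (\<forall>j<k. 0 < x j)"

text \<open>At most one index is a first hit, so the sum has at most one nonzero term. With constant
  \<open>c\<close> this splits an expectation by the time of the first hit; with varying
  \<open>c\<close> it bounds the stopped value.\<close>

lemma sum_first_hit:
  fixes c :: "nat \<Rightarrow> real"
  shows "(\<exists>k\<le>m. first_hit x k \<and> (\<Sum>k\<le>m. of_bool (first_hit x k) * c k) = c k \<and> \<not> (\<forall>k\<le>m. 0 < x k))
    \<or> (\<forall>k\<le>m. 0 < x k) \<and> (\<Sum>k\<le>m. of_bool (first_hit x k) * c k) = 0"
proof (cases "\<forall>k\<le>m. 0 < x k")
  case True
  then have "(\<Sum>k\<le>m. of_bool (first_hit x k) * c k) = 0"
    by (intro sum.neutral) (auto simp: first_hit_def)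
  with True show ?thesis by blast
next
  case False
  then have ex: "\<exists>k. k \<le> m \<and> x k \<le> 0" by (auto simp: not_less)
  define k where "k = (LEAST k. k \<le> m \<and> x k \<le> 0)"
  have k: "k \<le> m" "x k \<le> 0" using LeastI_ex[OF ex] by (simp_all add: k_def)
  have "0 < x j" if "j < k" for j
    using not_less_Least[of j "\<lambda>k. k \<le> m \<and> x k \<le> 0"] that k by (auto simp: k_def[symmetric])
  with k have hit: "first_hit x k" by (simp add: first_hit_def)
  have "j = k" if "first_hit x j" for j
    using hit that unfolding first_hit_def by (meson not_le linorder_neqE_nat)
  with hit have hit_iff: "first_hit x j \<longleftrightarrow> j = k" for j by blast
  have "(\<Sum>j\<le>m. of_bool (first_hit x j) * c j) = (\<Sum>j\<le>m. if j = k then c k else 0)"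
    unfolding hit_iff by (intro sum.cong refl) simp
  also have "\<dots> = c k" using k by simp
  finally show ?thesis using False hit k by blast
qed

section \<open>Optional stopping of the survival martingale along grids\<close>

locale drifted_brownian_motion = prob_space M for M :: "'a measure" +
  fixes F :: "real \<Rightarrow> 'a measure" and W :: "real \<Rightarrow> 'a \<Rightarrow> real" and \<sigma> \<beta> :: real
  assumes W: "brownian_motion M F W" and \<sigma>: "0 < \<sigma>" and \<beta>: "\<beta> < 0"
begin

text \<open>The starting point is a parameter since survival from different starting points is
  compared along the same path of \<open>W\<close>. As \<open>W 0 = 0\<close> holds only almost
  surely, so does \<open>X y 0 = y\<close>.\<close>

definition X :: "real \<Rightarrow> real \<Rightarrow> 'a \<Rightarrow> real" where
  "X y t \<omega> = y + \<sigma> * W t \<omega> + \<beta> * \<sigma>\<^sup>2 * t"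

lemma filtration_F: "filtration (space M) F" and sets_F: "A \<in> sets (F t) \<Longrightarrow> A \<in> sets M"
  using W by (auto simp: brownian_motion_def is_filtration_def)

lemma space_F [simp]: "space (F t) = space M"
  using filtration_F by (rule filtration.space_F)

lemma W_measurable_F: "0 \<le> s \<Longrightarrow> s \<le> t \<Longrightarrow> W s \<in> borel_measurable (F t)"
  using W filtration.sets_F_mono[OF filtration_F, of s t]
  by (intro measurable_from_subalg[of "F t" "F s"]) (auto simp: brownian_motion_def adapted_def subalgebra_def)

lemma W_measurable[measurable]: "0 \<le> s \<Longrightarrow> W s \<in> borel_measurable M"
  by (rule measurable_from_subalg[OF _ W_measurable_F[of s s]]) (auto simp: subalgebra_def sets_F)

lemma X_measurable_F: "0 \<le> s \<Longrightarrow> s \<le> t \<Longrightarrow> X y s \<in> borel_measurable (F t)"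
  using W_measurable_F[of s t] unfolding X_def[abs_def] by simp

lemma X_measurable[measurable]: "0 \<le> s \<Longrightarrow> X y s \<in> borel_measurable M"
  unfolding X_def[abs_def] by simp

lemma continuous_on_X: "\<omega> \<in> space M \<Longrightarrow> continuous_on {0..} (\<lambda>t. X y t \<omega>)"
  using W unfolding X_def brownian_motion_def by (intro continuous_intros) auto

lemma AE_X_0: "AE \<omega> in M. X y 0 \<omega> = y"
  using W unfolding brownian_motion_def X_def by auto

text \<open>The mean is displayed as \<beta> times the variance, the form in which the exponential
  tilt applies.\<close>

lemma distributed_increment:
  assumes "0 \<le> s" "s < t"
  shows "distributed M lborel (\<lambda>\<omega>. \<beta> * \<sigma>\<^sup>2 * (t - s) + \<sigma> * (W t \<omega> - W s \<omega>))
    (normal_density (\<beta> * (\<sigma>\<^sup>2 * (t - s))) (sqrt (\<sigma>\<^sup>2 * (t - s))))"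
proof -
  have "distributed M lborel (\<lambda>\<omega>. W t \<omega> - W s \<omega>) (normal_density 0 (sqrt (t - s)))"
    using W assms by (simp add: brownian_motion_def)
  from normal_density_affine[OF this, of \<sigma> "\<beta> * \<sigma>\<^sup>2 * (t - s)"] show ?thesis
    using assms \<sigma> by (simp add: real_sqrt_mult mult.assoc)
qed

text \<open>The Markov property in weak form: instead of a conditional expectation given
  \<open>F s\<close>, both sides are tested against an event of \<open>F s\<close>. The increment
  after s is averaged with the past frozen.\<close>

lemma expectation_reflected_payoff:
  assumes s: "0 \<le> s" "s < t" and A: "A \<in> sets (F s)"
  shows "expectation (\<lambda>\<omega>. indicator A \<omega> * reflected_payoff \<beta> (X y t \<omega>))
    = expectation (\<lambda>\<omega>. indicator A \<omega> * survival_function \<beta> (\<sigma>\<^sup>2 * (t - s)) (X y s \<omega>))"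
proof -
  define v where "v = \<sigma>\<^sup>2 * (t - s)"
  have v: "0 < v" using s \<sigma> by (simp add: v_def)
  define D where "D \<omega> = W t \<omega> - W s \<omega>" for \<omega>
  have D[measurable]: "D \<in> borel_measurable M" unfolding D_def[abs_def] using s by simp
  define f where "f = (\<lambda>(\<omega>, w). indicator A \<omega> * reflected_payoff \<beta> (X y s \<omega> + (\<beta> * \<sigma>\<^sup>2 * (t - s) + \<sigma> * w)))"
  have [measurable]: "A \<in> sets (F s)" "X y s \<in> borel_measurable (F s)"
    using A X_measurable_F s by auto
  \<comment> \<open>The identity into the coarser \<open>F s\<close> records the whole past as one
    random element, freezing the event and the position together.\<close>
  have id: "(\<lambda>\<omega>. \<omega>) \<in> M \<rightarrow>\<^sub>M F s"
    by (rule measurableI) (auto dest: sets_F sets.sets_into_space simp: Int_absorb2)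
  have "indep_set (sets (F s)) (sets (vimage_algebra (space M) D borel))"
    using W s by (auto simp: brownian_motion_def indep_increments_def D_def[abs_def])
  then have indep: "prob (a \<inter> b) = prob a * prob b"
    if "a \<in> sets (F s)" "b \<in> sets (vimage_algebra (space M) D borel)" for a b
    using that by (auto simp: indep_sets2_eq)
  have "expectation (\<lambda>\<omega>. indicator A \<omega> * reflected_payoff \<beta> (X y t \<omega>)) = expectation (\<lambda>\<omega>. f (\<omega>, D \<omega>))"
    by (simp add: f_def D_def X_def algebra_simps)
  also have "\<dots> = expectation (\<lambda>\<omega>. expectation (\<lambda>\<omega>'. f (\<omega>, D \<omega>')))"
  proof (rule expectation_pair_indep[where C = 1, OF id D])
    fix a and b :: "real set" assume "a \<in> sets (F s)" and b: "b \<in> sets borel"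
    then have "(\<lambda>\<omega>. \<omega>) -` a \<inter> space M \<in> sets (F s)"
      using sets.sets_into_space[of a "F s"] by (simp add: Int_absorb2)
    moreover have "D -` b \<inter> space M \<in> sets (vimage_algebra (space M) D borel)"
      using b by (rule in_vimage_algebra)
    ultimately show "prob (((\<lambda>\<omega>. \<omega>) -` a \<inter> space M) \<inter> (D -` b \<inter> space M))
        = prob ((\<lambda>\<omega>. \<omega>) -` a \<inter> space M) * prob (D -` b \<inter> space M)"
      by (rule indep)
  next
    show "f \<in> borel_measurable (F s \<Otimes>\<^sub>M borel)" unfolding f_def by measurable
    show "\<bar>f p\<bar> \<le> 1" for p
      using abs_reflected_payoff_le_1[OF \<beta>] by (auto simp: f_def split_beta indicator_def)
  qed
  also have "\<dots> = expectation (\<lambda>\<omega>. indicator A \<omega> * survival_function \<beta> v (X y s \<omega>))"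
  proof (intro Bochner_Integration.integral_cong refl)
    fix \<omega>
    have "expectation (\<lambda>\<omega>'. reflected_payoff \<beta> (X y s \<omega> + (\<beta> * \<sigma>\<^sup>2 * (t - s) + \<sigma> * D \<omega>')))
        = (\<integral>w. normal_density (\<beta> * v) (sqrt v) w * reflected_payoff \<beta> (X y s \<omega> + w) \<partial>lborel)"
      unfolding v_def D_def by (rule distributed_integral[OF distributed_increment[OF s], symmetric]) auto
    also have "\<dots> = survival_function \<beta> v (X y s \<omega>)"
      using integral_reflected_payoff_normal[OF \<beta> v, of "X y s \<omega>"]
      by (simp add: survival_function_def mult.commute)
    finally show "expectation (\<lambda>\<omega>'. f (\<omega>, D \<omega>')) = indicator A \<omega> * survival_function \<beta> v (X y s \<omega>)"
      by (simp add: f_def)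
  qed
  finally show ?thesis by (simp add: v_def)
qed

definition grid_positive :: "real \<Rightarrow> real \<Rightarrow> nat \<Rightarrow> 'a set" where
  "grid_positive y s n = {\<omega> \<in> space M. \<forall>k\<le>Suc n. 0 < X y (s * real k / real (Suc n)) \<omega>}"

text \<open>The conditional mean of the terminal payoff given the past at grid index
  \<open>k\<close>. The last index is separate: with no variance left the sine integral need not
  converge absolutely, so the payoff itself is taken.\<close>

definition hit_value :: "real \<Rightarrow> real \<Rightarrow> nat \<Rightarrow> nat \<Rightarrow> 'a \<Rightarrow> real" where
  "hit_value y s n k \<omega> =
    (if k < Suc n
     then survival_function \<beta> (\<sigma>\<^sup>2 * (s - s * real k / real (Suc n))) (X y (s * real k / real (Suc n)) \<omega>)
     else reflected_payoff \<beta> (X y s \<omega>))"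

definition stopped_value :: "real \<Rightarrow> real \<Rightarrow> nat \<Rightarrow> 'a \<Rightarrow> real" where
  "stopped_value y s n \<omega> =
    (\<Sum>k\<le>Suc n. of_bool (first_hit (\<lambda>k. X y (s * real k / real (Suc n)) \<omega>) k) * hit_value y s n k \<omega>)"

lemma grid_less:
  assumes "0 < s" "k < Suc n"
  shows "s * real k / real (Suc n) < s"
  using assms by (simp add: pos_divide_less_eq del: of_nat_Suc)

lemma hit_value_measurable[measurable]:
  assumes "0 < s"
  shows "hit_value y s n k \<in> borel_measurable M"
proof (cases "k < Suc n")
  case True
  then have "0 < \<sigma>\<^sup>2 * (s - s * real k / real (Suc n))"
    using grid_less[OF assms True] \<sigma> by simp
  then show ?thesis
    using assms True unfolding hit_value_def[abs_def] by (simp del: of_nat_Suc)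
next
  case False
  then show ?thesis using assms unfolding hit_value_def[abs_def] by simp
qed

lemma abs_hit_value_le_1:
  assumes "0 < s"
  shows "\<bar>hit_value y s n k \<omega>\<bar> \<le> 1"
proof (cases "k < Suc n")
  case True
  then have "0 < \<sigma>\<^sup>2 * (s - s * real k / real (Suc n))"
    using grid_less[OF assms True] \<sigma> by simp
  then show ?thesis
    using True abs_survival_function_le_1[OF \<beta>] by (simp add: hit_value_def del: of_nat_Suc)
next
  case False
  then show ?thesis using abs_reflected_payoff_le_1[OF \<beta>] by (simp add: hit_value_def)
qed

lemma first_hit_sets_F:
  assumes "0 \<le> s"
  shows "{\<omega> \<in> space M. first_hit (\<lambda>k. X y (s * real k / real (Suc n)) \<omega>) k} \<in> sets (F (s * real k / real (Suc n)))"
proof -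
  have X_F: "X y (s * real j / real (Suc n)) \<in> borel_measurable (F (s * real k / real (Suc n)))" if "j \<le> k" for j
    using assms that by (intro X_measurable_F divide_right_mono mult_left_mono) auto
  have "Measurable.pred (F (s * real k / real (Suc n)))
      (\<lambda>\<omega>. X y (s * real k / real (Suc n)) \<omega> \<le> 0 \<and> (\<forall>j\<in>{..<k}. 0 < X y (s * real j / real (Suc n)) \<omega>))"
  proof (intro pred_intros_logic pred_intros_finite)
    show "Measurable.pred (F (s * real k / real (Suc n))) (\<lambda>\<omega>. X y (s * real k / real (Suc n)) \<omega> \<le> 0)"
      using X_F[OF order_refl] by measurable
    show "Measurable.pred (F (s * real k / real (Suc n))) (\<lambda>\<omega>. 0 < X y (s * real j / real (Suc n)) \<omega>)"
      if "j \<in> {..<k}" for j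
    proof -
      have [measurable]: "X y (s * real j / real (Suc n)) \<in> borel_measurable (F (s * real k / real (Suc n)))"
        using that by (intro X_F) auto
      show ?thesis by measurable
    qed
  qed auto
  then have "{\<omega> \<in> space (F (s * real k / real (Suc n))). first_hit (\<lambda>k. X y (s * real k / real (Suc n)) \<omega>) k}
      \<in> sets (F (s * real k / real (Suc n)))"
    unfolding first_hit_def pred_def by (simp only: Ball_def lessThan_iff)
  then show ?thesis by (simp only: space_F)
qed

lemma grid_positive_sets[measurable]:
  assumes "0 \<le> s"
  shows "grid_positive y s n \<in> sets M"
proof -
  have X_M: "X y (s * real k / real (Suc n)) \<in> borel_measurable M" for k
    using assms by (intro X_measurable) auto
  have "Measurable.pred M (\<lambda>\<omega>. \<forall>k\<in>{..Suc n}. 0 < X y (s * real k / real (Suc n)) \<omega>)"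
    using X_M by (intro pred_intros_finite) (auto intro!: pred_intros_logic simp del: of_nat_Suc)
  then show ?thesis unfolding grid_positive_def pred_def by (simp only: Ball_def atMost_iff)
qed

lemma stopped_value_measurable[measurable]:
  assumes "0 < s"
  shows "stopped_value y s n \<in> borel_measurable M"
proof -
  have [measurable]: "{\<omega> \<in> space M. first_hit (\<lambda>k. X y (s * real k / real (Suc n)) \<omega>) k} \<in> sets M" for k
    by (rule sets_F[OF first_hit_sets_F]) (use assms in simp)
  show ?thesis
    unfolding stopped_value_def[abs_def] using assms by measurable
qed

lemma abs_stopped_value_le:
  assumes "\<And>k. k \<le> Suc n \<Longrightarrow> first_hit (\<lambda>k. X y (s * real k / real (Suc n)) \<omega>) k \<Longrightarrow> \<bar>hit_value y s n k \<omega>\<bar> \<le> b"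
    and "0 \<le> b"
  shows "\<bar>stopped_value y s n \<omega>\<bar> \<le> b"
  using sum_first_hit[of "Suc n" "\<lambda>k. X y (s * real k / real (Suc n)) \<omega>" "\<lambda>k. hit_value y s n k \<omega>"] assms
  unfolding stopped_value_def by auto

text \<open>Optional stopping of the martingale \<open>survival_function \<beta> (\<sigma>\<^sup>2 (s - t)) (X t)\<close> at the first grid
  time where \<open>X \<le> 0\<close>.\<close>

lemma survival_function_eq_stopped:
  assumes s: "0 < s"
  shows "survival_function \<beta> (\<sigma>\<^sup>2 * s) y = prob (grid_positive y s n) + expectation (stopped_value y s n)"
proof -
  define t where "t k = s * real k / real (Suc n)" for k
  define A where "A k = {\<omega> \<in> space M. first_hit (\<lambda>k. X y (t k) \<omega>) k}" for k
  define \<phi> where "\<phi> \<omega> = reflected_payoff \<beta> (X y s \<omega>)" for \<omega>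
  have t_last: "t (Suc n) = s" by (simp add: t_def)
  have A_F: "A k \<in> sets (F (t k))" for k
    unfolding A_def t_def using s by (intro first_hit_sets_F) auto
  have [measurable]: "A k \<in> sets M" for k by (rule sets_F[OF A_F])
  have [measurable]: "\<phi> \<in> borel_measurable M"
    unfolding \<phi>_def[abs_def] using s
    by (intro measurable_compose[OF X_measurable borel_measurable_reflected_payoff]) simp
  have [measurable]: "grid_positive y s n \<in> sets M" using s by simp
  have [measurable]: "hit_value y s n k \<in> borel_measurable M" for k using s by simp
  have \<phi>_bound: "\<bar>\<phi> \<omega>\<bar> \<le> 1" for \<omega> unfolding \<phi>_def by (rule abs_reflected_payoff_le_1[OF \<beta>])
  have int_\<phi>: "integrable M (\<lambda>\<omega>. indicator (A k) \<omega> * \<phi> \<omega>)" for k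
    by (rule integrable_const_bound[where B = 1]) (auto simp: \<phi>_bound indicator_def)
  have int_h: "integrable M (\<lambda>\<omega>. indicator (A k) \<omega> * hit_value y s n k \<omega>)" for k
    by (rule integrable_const_bound[where B = 1]) (auto simp: abs_hit_value_le_1[OF s] indicator_def)
  \<comment> \<open>The mean of the terminal payoff is computed twice: from time 0 here, then split
    according to the first grid hit.\<close>
  have "expectation \<phi> = expectation (\<lambda>\<omega>. indicator (space M) \<omega> * reflected_payoff \<beta> (X y s \<omega>))"
    by (intro Bochner_Integration.integral_cong) (auto simp: \<phi>_def)
  also have "\<dots> = expectation (\<lambda>\<omega>. indicator (space M) \<omega> * survival_function \<beta> (\<sigma>\<^sup>2 * (s - 0)) (X y 0 \<omega>))"
    using s sets.top[of "F 0"] by (intro expectation_reflected_payoff) auto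
  also have "\<dots> = expectation (\<lambda>\<omega>. survival_function \<beta> (\<sigma>\<^sup>2 * s) y)"
  proof (rule integral_cong_AE)
    show "AE \<omega> in M. indicator (space M) \<omega> * survival_function \<beta> (\<sigma>\<^sup>2 * (s - 0)) (X y 0 \<omega>) = survival_function \<beta> (\<sigma>\<^sup>2 * s) y"
      using AE_X_0[of y] AE_space by eventually_elim simp
    show "(\<lambda>\<omega>. indicator (space M) \<omega> * survival_function \<beta> (\<sigma>\<^sup>2 * (s - 0)) (X y 0 \<omega>)) \<in> borel_measurable M"
      using s \<sigma> by (intro borel_measurable_times borel_measurable_survival_function borel_measurable_indicator) auto
  qed simp
  also have "\<dots> = survival_function \<beta> (\<sigma>\<^sup>2 * s) y"
    by (simp add: prob_space)
  finally have 1: "expectation \<phi> = survival_function \<beta> (\<sigma>\<^sup>2 * s) y" .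
  have "expectation \<phi> = expectation (\<lambda>\<omega>. indicator (grid_positive y s n) \<omega> + (\<Sum>k\<le>Suc n. indicator (A k) \<omega> * \<phi> \<omega>))"
  proof (intro Bochner_Integration.integral_cong refl)
    fix \<omega> assume \<omega>: "\<omega> \<in> space M"
    then have "(\<Sum>k\<le>Suc n. indicator (A k) \<omega> * \<phi> \<omega>) = (\<Sum>k\<le>Suc n. of_bool (first_hit (\<lambda>k. X y (t k) \<omega>) k) * \<phi> \<omega>)"
      by (intro sum.cong refl) (auto simp: A_def indicator_def)
    moreover have "(indicator (grid_positive y s n) \<omega> :: real) = of_bool (\<forall>k\<le>Suc n. 0 < X y (t k) \<omega>)"
      using \<omega> by (auto simp: grid_positive_def t_def)
    \<comment> \<open>The last grid point is s itself, so positivity on the grid makes the payoff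
      1.\<close>
    moreover have "\<phi> \<omega> = 1" if "\<forall>k\<le>Suc n. 0 < X y (t k) \<omega>"
      using that t_last by (metis \<phi>_def order_refl reflected_payoff_def)
    ultimately show "\<phi> \<omega> = indicator (grid_positive y s n) \<omega> + (\<Sum>k\<le>Suc n. indicator (A k) \<omega> * \<phi> \<omega>)"
      using sum_first_hit[of "Suc n" "\<lambda>k. X y (t k) \<omega>" "\<lambda>_. \<phi> \<omega>"] by auto
  qed
  also have "\<dots> = prob (grid_positive y s n) + (\<Sum>k\<le>Suc n. expectation (\<lambda>\<omega>. indicator (A k) \<omega> * \<phi> \<omega>))"
  proof -
    have "expectation (\<lambda>\<omega>. indicator (grid_positive y s n) \<omega> + (\<Sum>k\<le>Suc n. indicator (A k) \<omega> * \<phi> \<omega>))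
        = expectation (indicator (grid_positive y s n)) + expectation (\<lambda>\<omega>. \<Sum>k\<le>Suc n. indicator (A k) \<omega> * \<phi> \<omega>)"
      by (intro Bochner_Integration.integral_add Bochner_Integration.integrable_sum int_\<phi>)
        (simp add: emeasure_eq_measure)
    also have "expectation (\<lambda>\<omega>. \<Sum>k\<le>Suc n. indicator (A k) \<omega> * \<phi> \<omega>)
        = (\<Sum>k\<le>Suc n. expectation (\<lambda>\<omega>. indicator (A k) \<omega> * \<phi> \<omega>))"
      by (intro Bochner_Integration.integral_sum int_\<phi>)
    finally show ?thesis by simp
  qed
  \<comment> \<open>Since \<open>A k\<close> is decided by time \<open>t k\<close>, the terminal
    payoff may be exchanged on it for its conditional mean at that time; at the last index the two
    coincide.\<close>
  also have "(\<Sum>k\<le>Suc n. expectation (\<lambda>\<omega>. indicator (A k) \<omega> * \<phi> \<omega>))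
      = (\<Sum>k\<le>Suc n. expectation (\<lambda>\<omega>. indicator (A k) \<omega> * hit_value y s n k \<omega>))"
  proof (intro sum.cong refl)
    fix k
    show "expectation (\<lambda>\<omega>. indicator (A k) \<omega> * \<phi> \<omega>) = expectation (\<lambda>\<omega>. indicator (A k) \<omega> * hit_value y s n k \<omega>)"
    proof (cases "k < Suc n")
      case True
      have "0 \<le> t k" "t k < s"
        using s grid_less[OF s True] by (auto simp: t_def)
      from expectation_reflected_payoff[OF this A_F] True show ?thesis
        unfolding \<phi>_def hit_value_def t_def by (simp del: of_nat_Suc)
    qed (simp add: \<phi>_def hit_value_def)
  qed
  also have "\<dots> = expectation (\<lambda>\<omega>. \<Sum>k\<le>Suc n. indicator (A k) \<omega> * hit_value y s n k \<omega>)"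
    by (intro Bochner_Integration.integral_sum[symmetric] int_h)
  also have "\<dots> = expectation (stopped_value y s n)"
    by (intro Bochner_Integration.integral_cong refl sum.cong)
      (auto simp: stopped_value_def A_def t_def indicator_def intro!: sum.cong)
  finally show ?thesis using 1 by simp
qed

text \<open>A first hit overshoots 0 by no more than the oscillation over one mesh, so
  \<open>X\<close> is small there. As \<open>X\<close> is nonzero at s, such a hit lies at distance
  at least \<open>d\<close> before s, and the Lipschitz bound with remaining variance at least
  \<open>\<sigma>\<^sup>2 * d\<close> applies.\<close>

lemma stopped_value_tendsto_0:
  assumes s: "0 < s" and y: "0 < y" and \<omega>: "\<omega> \<in> space M" "X y 0 \<omega> = y" "X y s \<omega> \<noteq> 0"
  shows "(\<lambda>n. stopped_value y s n \<omega>) \<longlonglongrightarrow> 0"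
proof (rule LIMSEQ_I)
  fix e :: real assume e: "0 < e"
  have cont: "continuous_on {0..s} (\<lambda>t. X y t \<omega>)"
    by (rule continuous_on_subset[OF continuous_on_X[OF \<omega>(1)]]) auto
  define \<eta> where "\<eta> = \<bar>X y s \<omega>\<bar> / 2"
  have \<eta>: "0 < \<eta>" using \<omega> by (simp add: \<eta>_def)
  obtain d where d: "0 < d" "\<And>u. u \<in> {0..s} \<Longrightarrow> \<bar>u - s\<bar> < d \<Longrightarrow> \<bar>X y u \<omega> - X y s \<omega>\<bar> < \<eta>"
    using cont[unfolded continuous_on_iff dist_real_def, rule_format, of s \<eta>] s \<eta> by auto
  define C where "C = exp \<bar>\<beta>\<bar> / pi * (\<integral>z. exp (- (\<sigma>\<^sup>2 * d) * z\<^sup>2 / 2) \<partial>lborel)"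
  have C: "0 \<le> C" unfolding C_def by (intro mult_nonneg_nonneg Bochner_Integration.integral_nonneg) auto
  \<comment> \<open>Only \<open>0 \<le> C\<close> is at hand; adding 1 makes division
    possible.\<close>
  define C' where "C' = C + 1"
  have C': "0 < C'" "C \<le> C'" using C by (simp_all add: C'_def)
  define \<delta> where "\<delta> = min \<eta> (min 1 (e / 2 / C'))"
  have \<delta>: "0 < \<delta>" "\<delta> \<le> \<eta>" "\<delta> \<le> 1" "\<delta> \<le> e / 2 / C'" using \<eta> e C' by (auto simp: \<delta>_def)
  have C\<delta>: "C * \<delta> \<le> e / 2"
  proof -
    have "C * \<delta> \<le> C' * (e / 2 / C')" using C' \<delta> by (intro mult_mono) auto
    also have "\<dots> = e / 2" using C' by simp
    finally show ?thesis .
  qed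
  have "uniformly_continuous_on {0..s} (\<lambda>t. X y t \<omega>)"
    by (rule compact_uniformly_continuous[OF cont compact_Icc])
  then obtain h where h: "0 < h" "\<And>u v. u \<in> {0..s} \<Longrightarrow> v \<in> {0..s} \<Longrightarrow> \<bar>v - u\<bar> < h \<Longrightarrow> \<bar>X y v \<omega> - X y u \<omega>\<bar> < \<delta>"
    unfolding uniformly_continuous_on_def dist_real_def using \<delta>(1) by meson
  obtain n0 where n0: "s / h < real n0" using reals_Archimedean2 by blast
  show "\<exists>n0. \<forall>n\<ge>n0. norm (stopped_value y s n \<omega> - 0) < e"
  proof (intro exI allI impI)
    fix n assume "n0 \<le> n"
    define t where "t k = s * real k / real (Suc n)" for k
    have "s / h < real (Suc n)" using n0 \<open>n0 \<le> n\<close> by linarith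
    then have mesh: "s / real (Suc n) < h" using h by (simp add: field_simps)
    have t_diff: "t (Suc j) - t j = s / real (Suc n)" for j
      by (simp add: t_def diff_divide_distrib[symmetric] right_diff_distrib[symmetric])
    have "\<bar>stopped_value y s n \<omega>\<bar> \<le> e / 2"
    proof (rule abs_stopped_value_le)
      fix k assume k: "k \<le> Suc n" and "first_hit (\<lambda>k. X y (s * real k / real (Suc n)) \<omega>) k"
      then have hit: "X y (t k) \<omega> \<le> 0" "\<And>j. j < k \<Longrightarrow> 0 < X y (t j) \<omega>"
        by (auto simp: first_hit_def t_def)
      \<comment> \<open>The path starts at y > 0, so the hit has a preceding grid point, and there
        \<open>X\<close> is positive.\<close>
      have "k \<noteq> 0"
        using hit(1) \<omega>(2) y by (auto simp: t_def intro: ccontr)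
      then obtain j where j: "k = Suc j" by (cases k) auto
      have t_in: "t i \<in> {0..s}" if "i \<le> Suc n" for i
      proof -
        have "s * real i \<le> s * real (Suc n)" using s that by (intro mult_left_mono) auto
        then show ?thesis using s by (simp add: t_def pos_divide_le_eq del: of_nat_Suc)
      qed
      have "\<bar>t k - t j\<bar> < h" using mesh s unfolding j t_diff by simp
      then have "\<bar>X y (t k) \<omega> - X y (t j) \<omega>\<bar> < \<delta>"
        using k j by (intro h(2) t_in) auto
      moreover have "0 < X y (t j) \<omega>" using hit j by simp
      ultimately have small: "\<bar>X y (t k) \<omega>\<bar> < \<delta>" using hit(1) by linarith
      \<comment> \<open>Near s the path is within \<eta> of \<open>X y s\<close>, whose modulus is 2
        \<eta>; a value of modulus below \<delta> \<le> \<eta> cannot occur there.\<close>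
      have "\<not> \<bar>t k - s\<bar> < d"
      proof
        assume "\<bar>t k - s\<bar> < d"
        then have "\<bar>X y (t k) \<omega> - X y s \<omega>\<bar> < \<eta>" using d(2) t_in k by blast
        then show False using small \<delta>(2) unfolding \<eta>_def by (auto simp: abs_real_def split: if_splits)
      qed
      then have far: "d \<le> s - t k" using t_in[OF k] by auto
      then have "t k \<noteq> s" using d(1) by auto
      then have "k < Suc n" using k by (cases "k = Suc n") (auto simp: t_def)
      then have "hit_value y s n k \<omega> = survival_function \<beta> (\<sigma>\<^sup>2 * (s - t k)) (X y (t k) \<omega>)"
        by (simp add: hit_value_def t_def)
      also have "\<bar>\<dots>\<bar> \<le> C * \<bar>X y (t k) \<omega>\<bar>"
        unfolding C_def
        using d(1) far \<sigma> small \<delta>(3) by (intro survival_function_small mult_left_mono) auto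
      also have "\<dots> \<le> C * \<delta>" using small C by (intro mult_left_mono) auto
      also have "\<dots> \<le> e / 2" by (rule C\<delta>)
      finally show "\<bar>hit_value y s n k \<omega>\<bar> \<le> e / 2" .
    qed (use e in simp)
    then show "norm (stopped_value y s n \<omega> - 0) < e" using e by simp
  qed
qed

lemma AE_X_neq_0:
  assumes "0 < s"
  shows "AE \<omega> in M. X y s \<omega> \<noteq> 0"
proof -
  define Z where "Z \<omega> = \<beta> * \<sigma>\<^sup>2 * (s - 0) + \<sigma> * (W s \<omega> - W 0 \<omega>)" for \<omega>
  note D = distributed_increment[OF order_refl assms, folded Z_def]
  have "AE z in distr M lborel Z. z \<noteq> - y"
    unfolding distributed_distr_eq_density[OF D]
    by (subst AE_density) (use AE_lborel_singleton[of "- y"] in \<open>auto elim: eventually_mono\<close>)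
  then have "AE \<omega> in M. Z \<omega> \<noteq> - y"
    by (rule AE_distrD[OF distributed_measurable[OF D]])
  moreover have "AE \<omega> in M. W 0 \<omega> = 0" using W by (simp add: brownian_motion_def)
  ultimately show ?thesis by eventually_elim (auto simp: Z_def X_def)
qed

text \<open>The grid probability and the stopped value add up to a constant independent of
  \<open>n\<close>, and the stopped value vanishes by dominated convergence.\<close>

lemma prob_grid_positive_LIMSEQ:
  assumes s: "0 < s" and y: "0 < y"
  shows "(\<lambda>n. prob (grid_positive y s n)) \<longlonglongrightarrow> survival_function \<beta> (\<sigma>\<^sup>2 * s) y"
proof -
  have "(\<lambda>n. expectation (stopped_value y s n)) \<longlonglongrightarrow> expectation (\<lambda>_. 0)"
  proof (rule integral_dominated_convergence[where w = "\<lambda>_. 1"])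
    show "AE \<omega> in M. (\<lambda>n. stopped_value y s n \<omega>) \<longlonglongrightarrow> 0"
      using AE_X_0[of y] AE_X_neq_0[OF s, of y] AE_space
      by eventually_elim (rule stopped_value_tendsto_0[OF s y])
    show "AE \<omega> in M. norm (stopped_value y s n \<omega>) \<le> 1" for n
      by (intro AE_I2) (auto intro: abs_stopped_value_le abs_hit_value_le_1[OF s])
  qed (use s in auto)
  then have "(\<lambda>n. survival_function \<beta> (\<sigma>\<^sup>2 * s) y - expectation (stopped_value y s n))
      \<longlonglongrightarrow> survival_function \<beta> (\<sigma>\<^sup>2 * s) y - expectation (\<lambda>_. 0)"
    by (intro tendsto_intros)
  moreover have "survival_function \<beta> (\<sigma>\<^sup>2 * s) y - expectation (stopped_value y s n) = prob (grid_positive y s n)" for n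
    using survival_function_eq_stopped[OF s, of y n] by simp
  ultimately show ?thesis by simp
qed

section \<open>Passage from grids to continuous time\<close>

definition survives :: "real \<Rightarrow> real \<Rightarrow> 'a set" where
  "survives y s = {\<omega> \<in> space M. \<forall>u\<in>{0..s}. 0 < X y u \<omega>}"

lemma survives_sets[measurable]:
  assumes "0 \<le> s"
  shows "survives y s \<in> sets M"
  unfolding survives_def by (rule positive_on_Icc_sets[OF X_measurable continuous_on_X assms])

text \<open>Starting a little lower absorbs the paths that touch 0 without crossing it.\<close>

theorem prob_survives:
  assumes s: "0 < s" and y: "0 < y"
  shows "prob (survives y s) = survival_function \<beta> (\<sigma>\<^sup>2 * s) y"
proof (rule antisym)
  have S[measurable]: "survives y s \<in> sets M" using s by simp
  have B[measurable]: "grid_positive z s n \<in> sets M" for z n using s by simp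
  have grid_in: "s * real k / real (Suc n) \<in> {0..s}" if "k \<le> Suc n" for n k
  proof -
    have "s * real k \<le> s * real (Suc n)" using s that by (intro mult_left_mono) auto
    then show ?thesis using s by (simp add: pos_divide_le_eq del: of_nat_Suc)
  qed
  have "prob (survives y s) \<le> prob (grid_positive y s n)" for n
    using grid_in by (intro finite_measure_mono) (auto simp: survives_def grid_positive_def simp del: of_nat_Suc)
  then show "prob (survives y s) \<le> survival_function \<beta> (\<sigma>\<^sup>2 * s) y"
    by (intro LIMSEQ_le_const[OF prob_grid_positive_LIMSEQ[OF s y]]) auto
  have lower: "survival_function \<beta> (\<sigma>\<^sup>2 * s) z \<le> prob (survives y s)" if z: "0 < z" "z < y" for z
  proof -
    \<comment> \<open>If \<open>X y\<close> is nonpositive at u, then \<open>X z\<close> is strictly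
      negative at u and hence at nearby grid points. So each path eventually leaves this difference
      of events.\<close>
    have "(\<lambda>n. expectation (indicator (grid_positive z s n - survives y s))) \<longlonglongrightarrow> (expectation (\<lambda>_. 0) :: real)"
    proof (rule integral_dominated_convergence[where w = "\<lambda>_. 1"])
      show "AE \<omega> in M. (\<lambda>n. indicator (grid_positive z s n - survives y s) \<omega>) \<longlonglongrightarrow> (0 :: real)"
      proof (rule AE_I2)
        fix \<omega> assume \<omega>: "\<omega> \<in> space M"
        show "(\<lambda>n. indicator (grid_positive z s n - survives y s) \<omega>) \<longlonglongrightarrow> (0 :: real)"
        proof (cases "\<omega> \<in> survives y s")
          case False
          then obtain u where u: "u \<in> {0..s}" "X y u \<omega> \<le> 0"
            using \<omega> by (auto simp: survives_def not_less)
          then have neg: "X z u \<omega> < 0" using z by (simp add: X_def)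
          obtain k where k: "\<And>n. k n \<le> Suc n" "(\<lambda>n. s * real (k n) / real (Suc n)) \<longlonglongrightarrow> u"
            using grid_approx[OF u(1)] by blast
          have "(\<lambda>n. X z (s * real (k n) / real (Suc n)) \<omega>) \<longlonglongrightarrow> X z u \<omega>"
            using u(1) s by (intro continuous_on_tendsto_compose[OF continuous_on_X[OF \<omega>] k(2)]) auto
          then have "\<forall>\<^sub>F n in sequentially. X z (s * real (k n) / real (Suc n)) \<omega> < 0"
            using neg by (rule order_tendstoD)
          then have "\<forall>\<^sub>F n in sequentially. indicator (grid_positive z s n - survives y s) \<omega> = (0 :: real)"
          proof eventually_elim
            case (elim n)
            then have "\<not> 0 < X z (s * real (k n) / real (Suc n)) \<omega>" by linarith
            then have "\<omega> \<notin> grid_positive z s n" using k(1)[of n] unfolding grid_positive_def by blast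
            then show ?case by simp
          qed
          then show ?thesis by (rule tendsto_eventually)
        qed simp
      qed
    qed auto
    then have "(\<lambda>n. prob (survives y s) + prob (grid_positive z s n - survives y s)) \<longlonglongrightarrow> prob (survives y s) + 0"
      by (intro tendsto_intros) simp
    moreover have "prob (grid_positive z s n) \<le> prob (survives y s) + prob (grid_positive z s n - survives y s)" for n
    proof -
      have "prob (grid_positive z s n) \<le> prob (survives y s \<union> (grid_positive z s n - survives y s))"
        by (intro finite_measure_mono) auto
      also have "\<dots> \<le> prob (survives y s) + prob (grid_positive z s n - survives y s)"
        by (intro measure_Un_le) auto
      finally show ?thesis .
    qed
    ultimately have "survival_function \<beta> (\<sigma>\<^sup>2 * s) z \<le> prob (survives y s) + 0"
      by (intro LIMSEQ_le[OF prob_grid_positive_LIMSEQ[OF s z(1)]]) auto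
    then show ?thesis by simp
  qed
  have "0 < \<sigma>\<^sup>2 * s" using s \<sigma> by simp
  from continuous_on_survival_function[OF this, of UNIV \<beta>]
  have "isCont (survival_function \<beta> (\<sigma>\<^sup>2 * s)) y"
    by (simp add: continuous_on_eq_continuous_at)
  then have "(survival_function \<beta> (\<sigma>\<^sup>2 * s) \<longlongrightarrow> survival_function \<beta> (\<sigma>\<^sup>2 * s) y) (at_left y)"
    unfolding isCont_def by (rule filterlim_mono[OF _ order_refl at_le]) simp
  then show "survival_function \<beta> (\<sigma>\<^sup>2 * s) y \<le> prob (survives y s)"
  proof (rule tendsto_upperbound)
    show "\<forall>\<^sub>F z in at_left y. survival_function \<beta> (\<sigma>\<^sup>2 * s) z \<le> prob (survives y s)"
      using y by (intro eventually_at_leftI[of 0] lower) auto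
  qed simp
qed

text \<open>Uniformity in \<open>s\<close> lets the truncated Fourier integral be averaged over an independent time;
  the case \<open>s = 0\<close>, where the full integral converges only conditionally, is a limit of the others.\<close>

lemma partial_sine_integral_prob_survives:
  assumes s: "0 \<le> s" and y: "0 < y" and N: "- \<beta> \<le> N"
  shows "\<bar>pi * exp (\<beta> * y) * prob (survives y s)
      - exp (- \<beta>\<^sup>2 * \<sigma>\<^sup>2 * s / 2) * partial_sine_integral \<beta> (\<sigma>\<^sup>2 * s) y N\<bar> \<le> 8 / (y * N)"
proof -
  have N0: "0 < N" using N \<beta> by simp
  have pos: "\<bar>pi * exp (\<beta> * y) * prob (survives y s)
      - exp (- \<beta>\<^sup>2 * \<sigma>\<^sup>2 * s / 2) * partial_sine_integral \<beta> (\<sigma>\<^sup>2 * s) y N\<bar> \<le> 8 / (y * N)" if s: "0 < s" for s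
  proof -
    have v: "0 < \<sigma>\<^sup>2 * s" using s \<sigma> by simp
    have "pi * exp (\<beta> * y) * prob (survives y s) = exp (- \<beta>\<^sup>2 * \<sigma>\<^sup>2 * s / 2) * gaussian_sine_integral \<beta> (\<sigma>\<^sup>2 * s) y"
    proof -
      have "exp (\<beta> * y) * exp (- \<beta> * y - \<beta>\<^sup>2 * (\<sigma>\<^sup>2 * s) / 2) = exp (- \<beta>\<^sup>2 * \<sigma>\<^sup>2 * s / 2)"
        by (simp add: exp_add[symmetric] mult.assoc)
      then show ?thesis
        unfolding prob_survives[OF s y] survival_function_def by (simp flip: mult.assoc)
    qed
    then have "\<bar>pi * exp (\<beta> * y) * prob (survives y s)
        - exp (- \<beta>\<^sup>2 * \<sigma>\<^sup>2 * s / 2) * partial_sine_integral \<beta> (\<sigma>\<^sup>2 * s) y N\<bar>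
      = exp (- \<beta>\<^sup>2 * \<sigma>\<^sup>2 * s / 2) * \<bar>gaussian_sine_integral \<beta> (\<sigma>\<^sup>2 * s) y - partial_sine_integral \<beta> (\<sigma>\<^sup>2 * s) y N\<bar>"
      by (simp add: right_diff_distrib[symmetric] abs_mult)
    also have "\<dots> \<le> 1 * (8 / (y * N))"
      using s by (intro mult_mono partial_sine_integral_gaussian_bound \<beta> y v N) auto
    finally show ?thesis by simp
  qed
  show ?thesis
  proof (cases "s = 0")
    case False
    then show ?thesis using s by (intro pos) simp
  next
    case True
    define r where "r n = inverse (real (Suc n))" for n
    have r: "r \<longlonglongrightarrow> 0" unfolding r_def by (rule LIMSEQ_inverse_real_of_nat)
    have r_pos: "0 < r n" for n by (simp add: r_def)
    \<comment> \<open>A path that is positive at 0 stays positive for a short while, so these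
      increasing events exhaust \<open>survives y 0\<close>.\<close>
    have "(\<lambda>n. prob (survives y (r n))) \<longlonglongrightarrow> prob (\<Union>n. survives y (r n))"
    proof (rule finite_Lim_measure_incseq)
      have "survives y (r n) \<in> events" for n
        by (rule survives_sets[OF less_imp_le[OF r_pos]])
      then show "range (\<lambda>n. survives y (r n)) \<subseteq> events" by blast
      show "incseq (\<lambda>n. survives y (r n))"
      proof (rule monoI)
        fix m n :: nat assume "m \<le> n"
        then have "r n \<le> r m" unfolding r_def by (intro le_imp_inverse_le) auto
        then have "{0..r n} \<subseteq> {0..r m}" by simp
        then show "survives y (r m) \<subseteq> survives y (r n)" unfolding survives_def by blast
      qed
    qed
    moreover have "(\<Union>n. survives y (r n)) = survives y 0"
    proof (intro equalityI subsetI)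
      fix \<omega> assume "\<omega> \<in> (\<Union>n. survives y (r n))"
      then show "\<omega> \<in> survives y 0" using r_pos by (auto simp: survives_def less_imp_le)
    next
      fix \<omega> assume *: "\<omega> \<in> survives y 0"
      then have \<omega>: "\<omega> \<in> space M" "0 < X y 0 \<omega>" by (auto simp: survives_def)
      then have "((\<lambda>t. X y t \<omega>) \<longlongrightarrow> X y 0 \<omega>) (at 0 within {0..})"
        using continuous_on_X[of \<omega> y] by (auto simp: continuous_on_def)
      then have "\<forall>\<^sub>F t in at 0 within {0..}. 0 < X y t \<omega>"
        using \<omega>(2) by (rule order_tendstoD)
      then obtain d where d: "0 < d" "\<And>t. 0 < t \<Longrightarrow> t < d \<Longrightarrow> 0 < X y t \<omega>"
        by (auto simp: eventually_at dist_real_def)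
      obtain n where "r n < d"
        using order_tendstoD(2)[OF r d(1)] by (auto simp: eventually_sequentially)
      then have "0 < X y u \<omega>" if "u \<in> {0..r n}" for u
        using that \<omega>(2) d(2)[of u] by (cases "u = 0") auto
      then have "\<omega> \<in> survives y (r n)" using \<omega>(1) by (simp add: survives_def)
      then show "\<omega> \<in> (\<Union>n. survives y (r n))" by blast
    qed
    ultimately have lim_p: "(\<lambda>n. prob (survives y (r n))) \<longlonglongrightarrow> prob (survives y 0)" by simp
    have "(\<lambda>n. \<sigma>\<^sup>2 * r n) \<longlonglongrightarrow> \<sigma>\<^sup>2 * 0" by (intro tendsto_intros r)
    then have lim_psi: "(\<lambda>n. partial_sine_integral \<beta> (\<sigma>\<^sup>2 * r n) y N) \<longlonglongrightarrow> partial_sine_integral \<beta> 0 y N"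
      using \<beta> by (intro partial_sine_integral_tendsto_0) auto
    have "(\<lambda>n. \<bar>pi * exp (\<beta> * y) * prob (survives y (r n))
        - exp (- \<beta>\<^sup>2 * \<sigma>\<^sup>2 * r n / 2) * partial_sine_integral \<beta> (\<sigma>\<^sup>2 * r n) y N\<bar>)
      \<longlonglongrightarrow> \<bar>pi * exp (\<beta> * y) * prob (survives y 0)
        - exp (- \<beta>\<^sup>2 * \<sigma>\<^sup>2 * 0 / 2) * partial_sine_integral \<beta> 0 y N\<bar>"
      by (intro tendsto_intros lim_p lim_psi r) simp
    then have "\<bar>pi * exp (\<beta> * y) * prob (survives y 0)
        - exp (- \<beta>\<^sup>2 * \<sigma>\<^sup>2 * 0 / 2) * partial_sine_integral \<beta> 0 y N\<bar> \<le> 8 / (y * N)"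
      by (rule LIMSEQ_le_const2) (use pos r_pos in auto)
    then show ?thesis by (simp add: True)
  qed
qed

end

subsection \<open>Averaging over an independent time change\<close>

text \<open>The gauge integral over the line must be approached along all large intervals, not only
  symmetric ones. Evenness makes the integral over [a, b] the mean of the symmetric integrals of
  radii - a and b.\<close>

lemma has_integral_even_UNIV:
  fixes f :: "real \<Rightarrow> real"
  assumes even: "\<And>z. f (- z) = f z" and int: "\<And>N. f integrable_on {- N..N}"
    and bound: "\<And>N. L \<le> N \<Longrightarrow> \<bar>integral {- N..N} f - i\<bar> \<le> C / N" and L: "0 < L" and C: "0 < C"
  shows "(f has_integral i) UNIV"
proof -
  have int_Icc: "f integrable_on {a..b}" for a b
    by (rule integrable_on_subinterval[OF int[of "max \<bar>a\<bar> \<bar>b\<bar>"]]) auto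
  have half: "integral {- N..0} f = integral {- N..N} f / 2" "integral {0..N} f = integral {- N..N} f / 2" if "0 \<le> N" for N
  proof -
    have "integral {- N..0} f = integral {- N..- 0} (\<lambda>z. f (- z))" by (simp add: even)
    also have "\<dots> = integral {0..N} f" by (rule Henstock_Kurzweil_Integration.integral_reflect_real)
    finally have "integral {- N..0} f = integral {0..N} f" .
    moreover have "integral {- N..0} f + integral {0..N} f = integral {- N..N} f"
      using that by (intro Henstock_Kurzweil_Integration.integral_combine int) auto
    ultimately show "integral {- N..0} f = integral {- N..N} f / 2" "integral {0..N} f = integral {- N..N} f / 2"
      by simp_all
  qed
  have "\<exists>B>0. \<forall>a b. ball 0 B \<subseteq> cbox a b \<longrightarrow> norm (integral (cbox a b) f - i) < e" if e: "0 < e" for e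
  proof (intro exI conjI allI impI)
    \<comment> \<open>Adding 1 gives the strict inequality C / N < e for all N \<ge> B.\<close>
    define B where "B = max L (C / e + 1)"
    show B: "0 < B" using L by (simp add: B_def)
    fix a b :: real assume sub: "ball 0 B \<subseteq> cbox a b"
    have "closure (ball (0::real) B) \<subseteq> cbox a b"
      using sub by (intro closure_minimal) auto
    then have "- B \<in> cbox a b" "B \<in> cbox a b"
      using B by (auto simp: closure_ball dist_real_def subset_iff)
    then have ab: "B \<le> - a" "B \<le> b" by auto
    have close: "\<bar>integral {- N..N} f - i\<bar> < e" if "B \<le> N" for N
    proof -
      have N: "0 < N" "L \<le> N" "C / e + 1 \<le> N" using that B by (auto simp: B_def)
      have "C / N < e" using N e C by (simp add: field_simps)
      with bound[OF N(2)] show ?thesis by linarith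
    qed
    have "integral {a..b} f = integral {a..0} f + integral {0..b} f"
      using ab B by (intro Henstock_Kurzweil_Integration.integral_combine[symmetric] int_Icc) auto
    also have "\<dots> = integral {- (- a)..- a} f / 2 + integral {- b..b} f / 2"
      using half(1)[of "- a"] half(2)[of b] ab B by simp
    finally show "norm (integral (cbox a b) f - i) < e"
      using close[OF ab(1)] close[OF ab(2)] by (simp add: abs_less_iff)
  qed
  then show ?thesis
    unfolding has_integral_alt'[of f i UNIV] using int_Icc by simp
qed

context drifted_brownian_motion
begin

text \<open>Survival is less likely over longer windows, and monotone functions are Borel. For
  negative s the window is empty and the probability is 1, so monotonicity holds on the whole
  line.\<close>

lemma borel_measurable_prob_survives[measurable]: "(\<lambda>s. prob (survives y s)) \<in> borel_measurable borel"
proof -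
  have "prob (survives y t) \<le> prob (survives y s)" if "s \<le> t" for s t
  proof (cases "0 \<le> s")
    case True
    then show ?thesis
      using that by (intro finite_measure_mono survives_sets) (auto simp: survives_def)
  next
    case False
    then have "survives y s = space M" by (auto simp: survives_def)
    then show ?thesis by (simp add: prob_space)
  qed
  then have "mono (\<lambda>s. - prob (survives y s))" by (intro monoI) simp
  from borel_measurable_uminus[OF borel_measurable_mono[OF this]] show ?thesis by simp
qed

text \<open>\<open>D\<close> is a discount factor and \<open>S\<close> a random clock, possibly
  dependent on each other. Averaging the truncated formula over both produces their joint transform;
  since \<open>0 \<le> D \<le> 1\<close>, the error bound uniform in time survives the
  averaging.\<close>

lemma sine_kernel_has_integral_survival:
  fixes D S :: "'a \<Rightarrow> real"
  assumes D[measurable]: "D \<in> borel_measurable M" and S[measurable]: "S \<in> borel_measurable M"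
    and D_bounds: "\<And>\<omega>. \<omega> \<in> space M \<Longrightarrow> 0 \<le> D \<omega> \<and> D \<omega> \<le> 1"
    and S_nonneg: "\<And>\<omega>. \<omega> \<in> space M \<Longrightarrow> 0 \<le> S \<omega>" and y: "0 < y"
  shows "((\<lambda>z. sine_kernel \<beta> y z * expectation (\<lambda>\<omega>. D \<omega> * exp (- (\<sigma>\<^sup>2 * (z\<^sup>2 + \<beta>\<^sup>2) / 2) * S \<omega>)))
    has_integral pi * exp (\<beta> * y) * expectation (\<lambda>\<omega>. D \<omega> * prob (survives y (S \<omega>)))) UNIV"
proof -
  define q where "q z = \<sigma>\<^sup>2 * (z\<^sup>2 + \<beta>\<^sup>2) / 2" for z
  have q: "0 \<le> q z" for z by (simp add: q_def)
  have [measurable]: "q \<in> borel_measurable borel" unfolding q_def[abs_def] by measurable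
  define \<Phi> where "\<Phi> z = expectation (\<lambda>\<omega>. D \<omega> * exp (- q z * S \<omega>))" for z
  define P where "P N s = exp (- \<beta>\<^sup>2 * \<sigma>\<^sup>2 * s / 2) * partial_sine_integral \<beta> (\<sigma>\<^sup>2 * s) y N" for N s
  interpret pair_sigma_finite M lborel ..
  have bound1: "\<bar>D \<omega> * exp (- q z * S \<omega>)\<bar> \<le> 1" if "\<omega> \<in> space M" for \<omega> z
    using D_bounds[OF that] S_nonneg[OF that] q[of z] by (auto simp: abs_mult intro!: mult_le_one)
  \<comment> \<open>Fubini on the product with [- N, N], where the integrand is dominated by the
    constant \<open>\<bar>y\<bar>\<close>.\<close>
  have main: "set_integrable lborel {- N..N} (\<lambda>z. sine_kernel \<beta> y z * \<Phi> z)"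
    "(LBINT z:{- N..N}. sine_kernel \<beta> y z * \<Phi> z) = expectation (\<lambda>\<omega>. D \<omega> * P N (S \<omega>))"
    "integrable M (\<lambda>\<omega>. D \<omega> * P N (S \<omega>))" for N
  proof -
    define h where "h \<omega> z = indicator {- N..N} z * sine_kernel \<beta> y z * (D \<omega> * exp (- q z * S \<omega>))" for \<omega> z
    have [measurable]: "(\<lambda>(\<omega>, z). h \<omega> z) \<in> borel_measurable (M \<Otimes>\<^sub>M lborel)"
      unfolding h_def by measurable
    have h_bound: "\<bar>h \<omega> z\<bar> \<le> indicator {- N..N} z * \<bar>y\<bar>" if "\<omega> \<in> space M" for \<omega> z
    proof -
      have "\<bar>sine_kernel \<beta> y z\<bar> * \<bar>D \<omega> * exp (- q z * S \<omega>)\<bar> \<le> \<bar>y\<bar> * 1"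
        using bound1[OF that] by (intro mult_mono sine_kernel_bound) auto
      then show ?thesis by (simp add: h_def abs_mult split: split_indicator)
    qed
    have int_bd: "integrable lborel (\<lambda>z. indicator {- N..N} z * \<bar>y\<bar>)"
      by (intro integrable_mult_left integrable_real_indicator) (auto simp: emeasure_lborel_Icc_eq)
    have int_h: "integrable lborel (h \<omega>)" if "\<omega> \<in> space M" for \<omega>
    proof (rule Bochner_Integration.integrable_bound[OF int_bd])
      show "h \<omega> \<in> borel_measurable lborel" unfolding h_def by measurable
    qed (use h_bound[OF that] in auto)
    have int: "integrable (M \<Otimes>\<^sub>M lborel) (\<lambda>(\<omega>, z). h \<omega> z)"
    proof (rule Fubini_integrable)
      show "integrable M (\<lambda>\<omega>. \<integral>z. norm (case (\<omega>, z) of (\<omega>, z) \<Rightarrow> h \<omega> z) \<partial>lborel)"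
      proof (rule integrable_const_bound[where B = "\<integral>z. indicator {- N..N} z * \<bar>y\<bar> \<partial>lborel"])
        show "AE \<omega> in M. norm (\<integral>z. norm (case (\<omega>, z) of (\<omega>, z) \<Rightarrow> h \<omega> z) \<partial>lborel) \<le> (\<integral>z. indicator {- N..N} z * \<bar>y\<bar> \<partial>lborel)"
        proof (rule AE_I2)
          fix \<omega> assume \<omega>: "\<omega> \<in> space M"
          show "norm (\<integral>z. norm (case (\<omega>, z) of (\<omega>, z) \<Rightarrow> h \<omega> z) \<partial>lborel) \<le> (\<integral>z. indicator {- N..N} z * \<bar>y\<bar> \<partial>lborel)"
            unfolding real_norm_def prod.case
            using int_h[OF \<omega>] h_bound[OF \<omega>] int_bd by (intro integral_abs_bound_integral) auto
        qed
      qed measurable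
      show "AE \<omega> in M. integrable lborel (\<lambda>z. case (\<omega>, z) of (\<omega>, z) \<Rightarrow> h \<omega> z)"
        unfolding prod.case by (intro AE_I2 int_h)
    qed measurable
    have z_int: "(\<integral>\<omega>. h \<omega> z \<partial>M) = indicator {- N..N} z *\<^sub>R (sine_kernel \<beta> y z * \<Phi> z)" for z
      by (simp add: h_def \<Phi>_def)
    have \<omega>_int: "(\<integral>z. h \<omega> z \<partial>lborel) = D \<omega> * P N (S \<omega>)" for \<omega>
    proof -
      define k where "k z = sine_kernel \<beta> y z * exp (- (\<sigma>\<^sup>2 * S \<omega>) * z\<^sup>2 / 2)" for z
      have k: "continuous_on {- N..N} k"
        unfolding k_def[abs_def] by (rule continuous_on_sine_kernel_gaussian) (use \<beta> in simp)
      \<comment> \<open>The exponent splits into the tilt and a Gaussian factor of variance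
        \<open>\<sigma>\<^sup>2 * S \<omega>\<close>.\<close>
      have "exp (- q z * S \<omega>) = exp (- \<beta>\<^sup>2 * \<sigma>\<^sup>2 * S \<omega> / 2) * exp (- (\<sigma>\<^sup>2 * S \<omega>) * z\<^sup>2 / 2)" for z
        unfolding exp_add[symmetric] by (simp add: q_def field_simps)
      then have "(\<integral>z. h \<omega> z \<partial>lborel)
          = (\<integral>z. (D \<omega> * exp (- \<beta>\<^sup>2 * \<sigma>\<^sup>2 * S \<omega> / 2)) * (indicator {- N..N} z *\<^sub>R k z) \<partial>lborel)"
        by (simp add: h_def k_def mult_ac)
      also have "\<dots> = (D \<omega> * exp (- \<beta>\<^sup>2 * \<sigma>\<^sup>2 * S \<omega> / 2)) * (LBINT z:{- N..N}. k z)"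
        unfolding set_lebesgue_integral_def by (rule integral_mult_right_zero)
      also have "(LBINT z:{- N..N}. k z) = partial_sine_integral \<beta> (\<sigma>\<^sup>2 * S \<omega>) y N"
        unfolding partial_sine_integral_def k_def[symmetric]
        by (rule set_borel_integral_eq_integral(2)[OF borel_integrable_atLeastAtMost'[OF k]])
      finally show ?thesis by (simp add: P_def)
    qed
    show "set_integrable lborel {- N..N} (\<lambda>z. sine_kernel \<beta> y z * \<Phi> z)"
      using integrable_snd[OF int] unfolding set_integrable_def z_int .
    show "integrable M (\<lambda>\<omega>. D \<omega> * P N (S \<omega>))"
      using integrable_fst[OF int] unfolding \<omega>_int .
    show "(LBINT z:{- N..N}. sine_kernel \<beta> y z * \<Phi> z) = expectation (\<lambda>\<omega>. D \<omega> * P N (S \<omega>))"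
      using Fubini_integral[OF int] unfolding set_lebesgue_integral_def z_int \<omega>_int .
  qed
  have int_survives: "integrable M (\<lambda>\<omega>. D \<omega> * prob (survives y (S \<omega>)))"
  proof (rule integrable_const_bound[where B = 1])
    show "AE \<omega> in M. norm (D \<omega> * prob (survives y (S \<omega>))) \<le> 1"
      using D_bounds by (intro AE_I2) (auto simp: abs_mult intro!: mult_le_one)
  qed measurable
  have "((\<lambda>z. sine_kernel \<beta> y z * \<Phi> z) has_integral pi * exp (\<beta> * y) * expectation (\<lambda>\<omega>. D \<omega> * prob (survives y (S \<omega>)))) UNIV"
  proof (rule has_integral_even_UNIV[where L = "- \<beta>" and C = "8 / y"])
    show "sine_kernel \<beta> y (- z) * \<Phi> (- z) = sine_kernel \<beta> y z * \<Phi> z" for z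
      by (simp add: sine_kernel_def \<Phi>_def q_def)
    show "(\<lambda>z. sine_kernel \<beta> y z * \<Phi> z) integrable_on {- N..N}" for N
      by (rule set_borel_integral_eq_integral(1)[OF main(1)])
    fix N assume N: "- \<beta> \<le> N"
    have "integral {- N..N} (\<lambda>z. sine_kernel \<beta> y z * \<Phi> z) = expectation (\<lambda>\<omega>. D \<omega> * P N (S \<omega>))"
      using set_borel_integral_eq_integral(2)[OF main(1)] main(2) by simp
    then have diff: "integral {- N..N} (\<lambda>z. sine_kernel \<beta> y z * \<Phi> z) - pi * exp (\<beta> * y) * expectation (\<lambda>\<omega>. D \<omega> * prob (survives y (S \<omega>)))
        = expectation (\<lambda>\<omega>. D \<omega> * P N (S \<omega>) - pi * exp (\<beta> * y) * (D \<omega> * prob (survives y (S \<omega>))))"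
      by (subst Bochner_Integration.integral_diff[OF main(3) integrable_mult_right[OF int_survives]]) simp
    have "\<bar>expectation (\<lambda>\<omega>. D \<omega> * P N (S \<omega>) - pi * exp (\<beta> * y) * (D \<omega> * prob (survives y (S \<omega>))))\<bar>
        \<le> expectation (\<lambda>\<omega>. \<bar>D \<omega> * P N (S \<omega>) - pi * exp (\<beta> * y) * (D \<omega> * prob (survives y (S \<omega>)))\<bar>)"
      by (rule integral_abs_bound)
    also have "\<dots> \<le> expectation (\<lambda>_. 8 / (y * N))"
    proof (rule integral_mono)
      show "integrable M (\<lambda>\<omega>. \<bar>D \<omega> * P N (S \<omega>) - pi * exp (\<beta> * y) * (D \<omega> * prob (survives y (S \<omega>)))\<bar>)"
        by (rule integrable_abs, rule Bochner_Integration.integrable_diff[OF main(3)], rule integrable_mult_right[OF int_survives])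
      fix \<omega> assume \<omega>: "\<omega> \<in> space M"
      have "D \<omega> * P N (S \<omega>) - pi * exp (\<beta> * y) * (D \<omega> * prob (survives y (S \<omega>)))
          = D \<omega> * (P N (S \<omega>) - pi * exp (\<beta> * y) * prob (survives y (S \<omega>)))"
        by (simp add: algebra_simps)
      also have "\<bar>\<dots>\<bar> \<le> 1 * (8 / (y * N))"
        unfolding abs_mult P_def
        using D_bounds[OF \<omega>] partial_sine_integral_prob_survives[OF S_nonneg[OF \<omega>] y N]
        by (intro mult_mono) (auto simp: abs_minus_commute)
      finally show "\<bar>D \<omega> * P N (S \<omega>) - pi * exp (\<beta> * y) * (D \<omega> * prob (survives y (S \<omega>)))\<bar> \<le> 8 / (y * N)"
        by simp
    qed simp
    also have "\<dots> = 8 / y / N" by (simp add: prob_space)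
    finally show "\<bar>integral {- N..N} (\<lambda>z. sine_kernel \<beta> y z * \<Phi> z)
        - pi * exp (\<beta> * y) * expectation (\<lambda>\<omega>. D \<omega> * prob (survives y (S \<omega>)))\<bar> \<le> 8 / y / N"
      unfolding diff .
  qed (use \<beta> y in auto)
  then show ?thesis by (simp add: \<Phi>_def q_def)
qed

end

section \<open>Independence of path functionals\<close>

definition path_algebra :: "'a measure \<Rightarrow> (real \<Rightarrow> 'a \<Rightarrow> real) \<Rightarrow> 'a measure" where
  "path_algebra M Y = vimage_algebra (space M) (\<lambda>\<omega>. \<lambda>t\<in>{0..}. Y t \<omega>) (\<Pi>\<^sub>M t\<in>{0..}. borel)"

lemma space_path_algebra [simp]: "space (path_algebra M Y) = space M"
  by (simp add: path_algebra_def)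

lemma measurable_path_algebra:
  assumes "0 \<le> t"
  shows "Y t \<in> borel_measurable (path_algebra M Y)"
proof -
  have "(\<lambda>\<omega>. \<lambda>t\<in>{0..}. Y t \<omega>) \<in> path_algebra M Y \<rightarrow>\<^sub>M (\<Pi>\<^sub>M t\<in>{0..}. borel)"
    unfolding path_algebra_def by (rule measurable_vimage_algebra1) (auto simp: space_PiM)
  from measurable_compose[OF this measurable_component_singleton[of t]] show ?thesis
    using assms by simp
qed

text \<open>Measurability is asked relative to the sigma-algebra generated by the path in
  \<open>M\<close>, not on the product space. There the path regularity is available, without which
  passage times and time integrals need not be measurable; every event of that sigma-algebra is
  still a preimage from path space, so independence carries over.\<close>

lemma (in prob_space) indep_processes_indep_vars:
  fixes Z :: "nat \<Rightarrow> 'a \<Rightarrow> 'b::topological_space"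
  assumes indep: "indep_processes M Ys"
    and Z: "\<And>i. i < length Ys \<Longrightarrow> Z i \<in> borel_measurable (path_algebra M (Ys ! i))"
  shows "indep_vars (\<lambda>_. borel) Z {..<length Ys}"
proof -
  define p where "p i \<omega> = (\<lambda>t\<in>{0..}. (Ys ! i) t \<omega>)" for i \<omega>
  have p_space: "p i \<in> space M \<rightarrow> space (\<Pi>\<^sub>M t\<in>{0..}. borel)" for i by (auto simp: p_def space_PiM)
  have ind: "indep_vars (\<lambda>_. \<Pi>\<^sub>M t\<in>{0..}. borel) p {..<length Ys}"
    using indep by (simp add: indep_processes_def p_def[abs_def])
  have sub: "{Z i -` A \<inter> space M | A. A \<in> sets borel} \<subseteq> {p i -` A \<inter> space M | A. A \<in> sets (\<Pi>\<^sub>M t\<in>{0..}. borel)}"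
    if "i < length Ys" for i
  proof -
    have "{p i -` A \<inter> space M | A. A \<in> sets (\<Pi>\<^sub>M t\<in>{0..}. borel)} = sets (path_algebra M (Ys ! i))"
      unfolding path_algebra_def p_def[symmetric] by (rule sets_vimage_algebra2[OF p_space, symmetric])
    moreover have "Z i -` A \<inter> space M \<in> sets (path_algebra M (Ys ! i))" if "A \<in> sets borel" for A
      using measurable_sets[OF Z[OF \<open>i < length Ys\<close>] that] by simp
    ultimately show ?thesis by auto
  qed
  show ?thesis
    unfolding indep_vars_def2
  proof (intro conjI ballI)
    show "indep_sets (\<lambda>i. {Z i -` A \<inter> space M | A. A \<in> sets borel}) {..<length Ys}"
    proof (rule indep_sets_mono_sets)
      show "indep_sets (\<lambda>i. {p i -` A \<inter> space M | A. A \<in> sets (\<Pi>\<^sub>M t\<in>{0..}. borel)}) {..<length Ys}"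
        using ind by (simp add: indep_vars_def2)
    qed (rule sub, simp)
    fix i assume i: "i \<in> {..<length Ys}"
    have "p i \<in> M \<rightarrow>\<^sub>M (\<Pi>\<^sub>M t\<in>{0..}. borel)" using ind i by (simp add: indep_vars_def2)
    show "random_variable borel (Z i)"
    proof (rule measurableI)
      fix A :: "'b set" assume "A \<in> sets borel"
      then have "Z i -` A \<inter> space M \<in> {Z i -` A \<inter> space M | A. A \<in> sets borel}" by blast
      with sub[of i] i have "Z i -` A \<inter> space M \<in> {p i -` A \<inter> space M | A. A \<in> sets (\<Pi>\<^sub>M t\<in>{0..}. borel)}"
        by (simp only: lessThan_iff subset_iff)
      then obtain B where "B \<in> sets (\<Pi>\<^sub>M t\<in>{0..}. borel)" "Z i -` A \<inter> space M = p i -` B \<inter> space M"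
        by blast
      then show "Z i -` A \<inter> space M \<in> events"
        using \<open>p i \<in> M \<rightarrow>\<^sub>M (\<Pi>\<^sub>M t\<in>{0..}. borel)\<close> by (simp add: measurable_sets)
    qed simp
  qed
qed

section \<open>Laplace exponents as expectations\<close>

lemma (in prob_space) exp_laplace_exponent:
  assumes "Y t \<in> borel_measurable M" "AE \<omega> in M. 0 \<le> Y t \<omega>" "0 \<le> u"
  shows "exp (- laplace_exponent M Y u t) = expectation (\<lambda>\<omega>. exp (- u * Y t \<omega>))"
proof -
  have "integrable M (\<lambda>\<omega>. exp (- u * Y t \<omega>))"
  proof (rule integrable_const_bound[where B = 1])
    show "AE \<omega> in M. norm (exp (- u * Y t \<omega>)) \<le> 1"
      using assms(2) by eventually_elim (use assms(3) in simp)
  qed (use assms(1) in simp)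
  then have "0 < expectation (\<lambda>\<omega>. exp (- u * Y t \<omega>))"
    by (rule expectation_greater) simp
  then show ?thesis by (simp add: laplace_exponent_def)
qed

text \<open>The initial value is almost surely \<open>y\<close>, so the conditioning event has
  probability 1 and conditioning does not change the expectation.\<close>

lemma (in prob_space) exp_laplace_exponent_given:
  assumes Y: "time_integral Y t \<in> borel_measurable M" "Y 0 \<in> borel_measurable M"
    and init: "AE \<omega> in M. Y 0 \<omega> = y" and nonneg: "\<And>\<omega>. \<omega> \<in> space M \<Longrightarrow> 0 \<le> time_integral Y t \<omega>" and u: "0 \<le> u"
  shows "exp (- laplace_exponent_given M Y u t y) = expectation (\<lambda>\<omega>. exp (- u * time_integral Y t \<omega>))"
proof -
  define A where "A = {\<omega> \<in> space M. Y 0 \<omega> = y}"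
  have [measurable]: "A \<in> sets M" unfolding A_def using Y(2) by measurable
  have A: "AE \<omega> in M. \<omega> \<in> A"
    using init AE_space by eventually_elim (simp add: A_def)
  then have "prob A = 1" by (simp add: prob_eq_1)
  then have "emeasure M A = 1" by (simp add: emeasure_eq_measure)
  then have "uniform_measure M A = density M (\<lambda>\<omega>. ennreal (indicator A \<omega>))"
    by (simp add: uniform_measure_def divide_ennreal_def ennreal_indicator)
  moreover have "(\<integral>\<omega>. exp (- u * time_integral Y t \<omega>) \<partial>density M (\<lambda>\<omega>. ennreal (indicator A \<omega>)))
      = expectation (\<lambda>\<omega>. indicator A \<omega> *\<^sub>R exp (- u * time_integral Y t \<omega>))"
    using Y(1) by (intro integral_density) auto
  moreover have "\<dots> = expectation (\<lambda>\<omega>. exp (- u * time_integral Y t \<omega>))"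
    using A Y(1) by (intro integral_cong_AE) (auto elim: eventually_mono)
  ultimately have "laplace_exponent_given M Y u t y = laplace_exponent M (time_integral Y) u t"
    by (simp add: laplace_exponent_given_def laplace_exponent_def A_def)
  then show ?thesis
    using exp_laplace_exponent[of "time_integral Y" t u] Y(1) nonneg u by simp
qed

section \<open>Joint transforms and prices in the credit model\<close>

locale credit_model = drifted_brownian_motion M "natural_filtration M W" W \<sigma> \<beta>
  for M :: "'a measure" and W \<sigma> \<beta> +
  fixes rt lam1 lam2 H :: "real \<Rightarrow> 'a \<Rightarrow> real"
  assumes indep: "indep_processes M [W, rt, lam1, lam2, H]"
    and rt: "\<And>\<omega>. \<omega> \<in> space M \<Longrightarrow> cadlag (\<lambda>t. rt t \<omega>)" "\<And>\<omega> t. \<omega> \<in> space M \<Longrightarrow> 0 \<le> t \<Longrightarrow> 0 \<le> rt t \<omega>"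
    and lam1: "\<And>\<omega>. \<omega> \<in> space M \<Longrightarrow> cadlag (\<lambda>t. lam1 t \<omega>)" "\<And>\<omega> t. \<omega> \<in> space M \<Longrightarrow> 0 \<le> t \<Longrightarrow> 0 \<le> lam1 t \<omega>"
    and lam2: "\<And>\<omega>. \<omega> \<in> space M \<Longrightarrow> cadlag (\<lambda>t. lam2 t \<omega>)" "\<And>\<omega> t. \<omega> \<in> space M \<Longrightarrow> 0 \<le> t \<Longrightarrow> 0 \<le> lam2 t \<omega>"
    and H: "AE \<omega> in M. H 0 \<omega> = 0" "\<And>\<omega>. \<omega> \<in> space M \<Longrightarrow> mono_on {0..} (\<lambda>t. H t \<omega>)"
begin

lemma indep_vars_functionals:
  fixes Z :: "nat \<Rightarrow> 'a \<Rightarrow> 'b::topological_space"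
  assumes "Z 0 \<in> borel_measurable (path_algebra M W)" "Z 1 \<in> borel_measurable (path_algebra M rt)"
    "Z 2 \<in> borel_measurable (path_algebra M lam1)" "Z 3 \<in> borel_measurable (path_algebra M lam2)"
    "Z 4 \<in> borel_measurable (path_algebra M H)"
  shows "indep_vars (\<lambda>_. borel) Z {..<5}"
proof -
  have "indep_vars (\<lambda>_. borel) Z {..<length [W, rt, lam1, lam2, H]}"
  proof (rule indep_processes_indep_vars[OF indep])
    fix i assume "i < length [W, rt, lam1, lam2, H]"
    then consider "i = 0" | "i = 1" | "i = 2" | "i = 3" | "i = 4" by fastforce
    then show "Z i \<in> borel_measurable (path_algebra M ([W, rt, lam1, lam2, H] ! i))"
      by cases (use assms in \<open>simp_all add: eval_nat_numeral\<close>)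
  qed
  then show ?thesis by (simp add: eval_nat_numeral)
qed

lemma time_integrals_nonneg:
  assumes "\<omega> \<in> space M"
  shows "0 \<le> time_integral rt t \<omega>" "0 \<le> time_integral lam1 t \<omega>" "0 \<le> time_integral lam2 t \<omega>"
  by (rule time_integral_nonneg, simp add: rt lam1 lam2 assms)+

lemma time_integral_path_measurable:
  "time_integral rt t \<in> borel_measurable (path_algebra M rt)"
  "time_integral lam1 t \<in> borel_measurable (path_algebra M lam1)"
  "time_integral lam2 t \<in> borel_measurable (path_algebra M lam2)"
  by (rule borel_measurable_time_integral[OF measurable_path_algebra], assumption, simp add: rt lam1 lam2)+

lemma first_passage_time_path_measurable:
  "first_passage_time (X y) \<in> borel_measurable (path_algebra M W)"
proof (rule borel_measurable_first_passage_time)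
  show "X y t \<in> borel_measurable (path_algebra M W)" if "0 \<le> t" for t
    using measurable_path_algebra[OF that, of W M] unfolding X_def[abs_def] by simp
qed (simp add: continuous_on_X)

text \<open>Values are in \<open>ereal\<close> because the passage time may be infinite and an
  independent family is given one common codomain here.\<close>

definition functionals :: "real \<Rightarrow> real \<Rightarrow> nat \<Rightarrow> 'a \<Rightarrow> ereal" where
  "functionals y t i \<omega> = [first_passage_time (X y) \<omega>, ereal (time_integral rt t \<omega>), ereal (time_integral lam1 t \<omega>),
    ereal (time_integral lam2 t \<omega>), ereal (H t \<omega>)] ! i"

lemma functionals_simps [simp]:
  "functionals y t 0 \<omega> = first_passage_time (X y) \<omega>"
  "functionals y t (Suc 0) \<omega> = ereal (time_integral rt t \<omega>)"
  "functionals y t 2 \<omega> = ereal (time_integral lam1 t \<omega>)"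
  "functionals y t 3 \<omega> = ereal (time_integral lam2 t \<omega>)"
  "functionals y t 4 \<omega> = ereal (H t \<omega>)"
  by (simp_all add: functionals_def eval_nat_numeral)

lemma indep_vars_functionals_ereal:
  assumes "0 \<le> t"
  shows "indep_vars (\<lambda>_. borel) (functionals y t) {..<5}"
proof (rule indep_vars_functionals)
  show "functionals y t 0 \<in> borel_measurable (path_algebra M W)"
    using first_passage_time_path_measurable[of y] by (simp add: fun_eq_iff cong: measurable_cong)
  show "functionals y t 1 \<in> borel_measurable (path_algebra M rt)"
    using time_integral_path_measurable(1)[of t] by (simp cong: measurable_cong)
  show "functionals y t 2 \<in> borel_measurable (path_algebra M lam1)"
    using time_integral_path_measurable(2)[of t] by (simp cong: measurable_cong)
  show "functionals y t 3 \<in> borel_measurable (path_algebra M lam2)"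
    using time_integral_path_measurable(3)[of t] by (simp cong: measurable_cong)
  show "functionals y t 4 \<in> borel_measurable (path_algebra M H)"
    using measurable_path_algebra[OF assms, of H M] by (simp cong: measurable_cong)
qed

text \<open>Read off from independence, since \<open>indep_vars\<close> includes that each member is
  a random variable.\<close>

lemma functionals_measurable:
  assumes "0 \<le> t"
  shows "first_passage_time (X y) \<in> borel_measurable M" "time_integral rt t \<in> borel_measurable M"
    "time_integral lam1 t \<in> borel_measurable M" "time_integral lam2 t \<in> borel_measurable M"
    "H t \<in> borel_measurable M"
proof -
  have rv: "functionals y t i \<in> borel_measurable M" if "i < 5" for i
    using indep_vars_functionals_ereal[OF assms, of y] that by (simp add: indep_vars_def2)
  show "first_passage_time (X y) \<in> borel_measurable M"
    using rv[of 0] by (simp cong: measurable_cong)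
  show "time_integral rt t \<in> borel_measurable M"
    using borel_measurable_real_of_ereal[OF rv[of 1]] by (simp cong: measurable_cong)
  show "time_integral lam1 t \<in> borel_measurable M"
    using borel_measurable_real_of_ereal[OF rv[of 2]] by (simp cong: measurable_cong)
  show "time_integral lam2 t \<in> borel_measurable M"
    using borel_measurable_real_of_ereal[OF rv[of 3]] by (simp cong: measurable_cong)
  show "H t \<in> borel_measurable M"
    using borel_measurable_real_of_ereal[OF rv[of 4]] by (simp cong: measurable_cong)
qed

lemma AE_H_nonneg:
  assumes "0 \<le> t"
  shows "AE \<omega> in M. 0 \<le> H t \<omega>"
  using H(1) AE_space
proof eventually_elim
  case (elim \<omega>)
  then show ?case using mono_onD[OF H(2), of \<omega> 0 t] assms by simp
qed

lemma expectation_exp_functionals: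
  assumes t: "0 \<le> t" and u: "0 \<le> u0" "0 \<le> u1" "0 \<le> u2" "0 \<le> u3"
  shows "expectation (\<lambda>\<omega>. exp (- (u0 * time_integral rt t \<omega> + u1 * time_integral lam1 t \<omega> + u2 * time_integral lam2 t \<omega> + u3 * H t \<omega>)))
    = expectation (\<lambda>\<omega>. exp (- u0 * time_integral rt t \<omega>)) * expectation (\<lambda>\<omega>. exp (- u1 * time_integral lam1 t \<omega>))
      * expectation (\<lambda>\<omega>. exp (- u2 * time_integral lam2 t \<omega>)) * expectation (\<lambda>\<omega>. exp (- u3 * H t \<omega>))"
proof -
  \<comment> \<open>The constant 1 fills the slot of \<open>W\<close>.\<close>
  define Z where "Z i = [\<lambda>_. 1, \<lambda>\<omega>. exp (- u0 * time_integral rt t \<omega>), \<lambda>\<omega>. exp (- u1 * time_integral lam1 t \<omega>),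
    \<lambda>\<omega>. exp (- u2 * time_integral lam2 t \<omega>), \<lambda>\<omega>. exp (- u3 * H t \<omega>)] ! i" for i
  have Z: "Z 0 = (\<lambda>_. 1)" "Z (Suc 0) = (\<lambda>\<omega>. exp (- u0 * time_integral rt t \<omega>))" "Z 2 = (\<lambda>\<omega>. exp (- u1 * time_integral lam1 t \<omega>))"
    "Z 3 = (\<lambda>\<omega>. exp (- u2 * time_integral lam2 t \<omega>))" "Z 4 = (\<lambda>\<omega>. exp (- u3 * H t \<omega>))"
    by (simp_all add: Z_def eval_nat_numeral)
  note [measurable] = functionals_measurable[OF t] time_integral_path_measurable measurable_path_algebra[OF t, of H M]
  have "indep_vars (\<lambda>_. borel) Z {..<5}"
    by (rule indep_vars_functionals) (simp_all add: Z)
  moreover have "integrable M (Z i)" if "i \<in> {..<5}" for i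
  proof -
    have "AE \<omega> in M. norm (exp (- u3 * H t \<omega>)) \<le> 1"
      using AE_H_nonneg[OF t] by eventually_elim (use u in simp)
    then have int_H: "integrable M (\<lambda>\<omega>. exp (- u3 * H t \<omega>))"
      by (intro integrable_const_bound[where B = 1]) auto
    have int_TI: "integrable M (\<lambda>\<omega>. exp (- u0 * time_integral rt t \<omega>))"
      "integrable M (\<lambda>\<omega>. exp (- u1 * time_integral lam1 t \<omega>))"
      "integrable M (\<lambda>\<omega>. exp (- u2 * time_integral lam2 t \<omega>))"
      by (rule integrable_const_bound[where B = 1]; use u time_integrals_nonneg in \<open>auto intro!: AE_I2\<close>)+
    consider "i = 0" | "i = Suc 0" | "i = 2" | "i = 3" | "i = 4" using \<open>i \<in> {..<5}\<close> by fastforce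
    then show ?thesis by cases (use int_H int_TI in \<open>simp_all add: Z\<close>)
  qed
  ultimately have "expectation (\<lambda>\<omega>. \<Prod>i\<in>{..<5}. Z i \<omega>) = (\<Prod>i\<in>{..<5}. expectation (Z i))"
    by (intro indep_vars_lebesgue_integral) auto
  moreover have "{..<5} = {0, Suc 0, 2, 3, 4 :: nat}" by auto
  ultimately show ?thesis
    by (simp add: Z prob_space exp_add[symmetric] exp_minus_inverse algebra_simps)
qed

lemma first_passage_time_greater_eq:
  "{\<omega> \<in> space M. ereal s < first_passage_time (X y) \<omega>} = survives y s"
  using first_passage_time_le_iff[of "X y", OF continuous_on_X]
  by (auto simp: survives_def not_le[symmetric])

text \<open>The rates and the clock depend on other processes than the passage time, so they are
  frozen while the passage time is averaged. \<open>max 0\<close> bounds the discount factor at all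
  points of the product space, not only at attained values.\<close>

lemma expectation_discounted_survival:
  fixes c0 c1 c2 a1 a2 a3 :: real
  assumes t: "0 \<le> t"
  defines "D \<equiv> \<lambda>\<omega>. exp (- max 0 (c0 * time_integral rt t \<omega> + c1 * time_integral lam1 t \<omega> + c2 * time_integral lam2 t \<omega>))"
    and "S \<equiv> \<lambda>\<omega>. a1 * time_integral lam1 t \<omega> + a2 * time_integral lam2 t \<omega> + a3 * H t \<omega>"
  shows "expectation (\<lambda>\<omega>. D \<omega> * of_bool (ereal (S \<omega>) < first_passage_time (X y) \<omega>))
    = expectation (\<lambda>\<omega>. D \<omega> * prob (survives y (S \<omega>)))"
proof -
  define A where "A \<omega> = restrict (\<lambda>i. functionals y t i \<omega>) {1, 2, 3, 4}" for \<omega>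
  define B where "B \<omega> = restrict (\<lambda>i. functionals y t i \<omega>) {0}" for \<omega>
  define d where "d p = exp (- max 0 (c0 * real_of_ereal (p 1) + c1 * real_of_ereal (p 2) + c2 * real_of_ereal (p 3)))"
    for p :: "nat \<Rightarrow> ereal"
  define s where "s p = a1 * real_of_ereal (p 2) + a2 * real_of_ereal (p 3) + a3 * real_of_ereal (p 4)" for p :: "nat \<Rightarrow> ereal"
  define f where "f = (\<lambda>(p, q). d p * of_bool (ereal (s p) < q (0::nat)))"
  have "indep_var (\<Pi>\<^sub>M i\<in>{1, 2, 3, 4}. borel) A (\<Pi>\<^sub>M i\<in>{0}. borel) B"
    unfolding A_def[abs_def] B_def[abs_def]
    by (rule indep_var_restrict[OF indep_vars_functionals_ereal[OF t]]) auto
  note AB = indep_var_rv1[OF this] indep_var_rv2[OF this] indep_varD[OF this]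
  have [measurable]: "(\<lambda>p. p i) \<in> borel_measurable (\<Pi>\<^sub>M i\<in>{1, 2, 3, 4}. borel :: ereal measure)" if "i \<in> {1, 2, 3, 4}" for i :: nat
    using that by (rule measurable_component_singleton)
  have [measurable]: "(\<lambda>p. p 0) \<in> borel_measurable (\<Pi>\<^sub>M i\<in>{0::nat}. borel :: ereal measure)"
    by (rule measurable_component_singleton) simp
  have "expectation (\<lambda>\<omega>. D \<omega> * of_bool (ereal (S \<omega>) < first_passage_time (X y) \<omega>)) = expectation (\<lambda>\<omega>. f (A \<omega>, B \<omega>))"
    by (simp add: f_def d_def s_def A_def B_def D_def S_def)
  also have "\<dots> = expectation (\<lambda>\<omega>. expectation (\<lambda>\<omega>'. f (A \<omega>, B \<omega>')))"
  proof (rule expectation_pair_indep[where C = 1, OF AB(1,2)])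
    fix a b assume "a \<in> sets (\<Pi>\<^sub>M i\<in>{1, 2, 3, 4 :: nat}. borel :: ereal measure)" "b \<in> sets (\<Pi>\<^sub>M i\<in>{0 :: nat}. borel :: ereal measure)"
    from AB(3)[OF this] show "prob ((A -` a \<inter> space M) \<inter> (B -` b \<inter> space M)) = prob (A -` a \<inter> space M) * prob (B -` b \<inter> space M)"
      by (simp add: vimage_def Int_def conj_ac Collect_conj_eq[symmetric])
  next
    show "f \<in> borel_measurable ((\<Pi>\<^sub>M i\<in>{1, 2, 3, 4}. borel) \<Otimes>\<^sub>M (\<Pi>\<^sub>M i\<in>{0}. borel))"
      unfolding f_def d_def s_def by measurable
    show "\<bar>f p\<bar> \<le> 1" for p by (auto simp: f_def d_def split_beta)
  qed
  also have "\<dots> = expectation (\<lambda>\<omega>. D \<omega> * prob (survives y (S \<omega>)))"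
  proof (intro Bochner_Integration.integral_cong refl)
    fix \<omega>
    have "expectation (\<lambda>\<omega>'. of_bool (ereal (S \<omega>) < first_passage_time (X y) \<omega>')) = expectation (indicator (survives y (S \<omega>)))"
      by (intro Bochner_Integration.integral_cong refl)
        (auto simp: indicator_def first_passage_time_greater_eq[symmetric])
    also have "\<dots> = prob (survives y (S \<omega>))"
      by (simp add: survives_def Int_def conj_ac)
    finally show "expectation (\<lambda>\<omega>'. f (A \<omega>, B \<omega>')) = D \<omega> * prob (survives y (S \<omega>))"
      by (simp add: f_def d_def s_def A_def B_def D_def S_def)
  qed
  finally show ?thesis .
qed

text \<open>Each intensity acts through both the discount and the clock, which is why its transform
  is taken at \<open>c1 + a1 * q z\<close> or \<open>c2 + a2 * q z\<close>; independence factorises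
  the joint transform.\<close>

lemma price_has_integral:
  assumes t: "0 \<le> t" and y: "0 < y" and c: "0 \<le> c0" "0 \<le> c1" "0 \<le> c2" and a: "0 \<le> a1" "0 \<le> a2" "0 \<le> a3"
  defines "q \<equiv> \<lambda>z. \<sigma>\<^sup>2 * (z\<^sup>2 + \<beta>\<^sup>2) / 2"
  shows "((\<lambda>z. sine_kernel \<beta> y z *
      (expectation (\<lambda>\<omega>. exp (- c0 * time_integral rt t \<omega>))
        * expectation (\<lambda>\<omega>. exp (- (c1 + a1 * q z) * time_integral lam1 t \<omega>))
        * expectation (\<lambda>\<omega>. exp (- (c2 + a2 * q z) * time_integral lam2 t \<omega>))
        * expectation (\<lambda>\<omega>. exp (- (a3 * q z) * H t \<omega>))))
    has_integral pi * exp (\<beta> * y) *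
      expectation (\<lambda>\<omega>. exp (- (c0 * time_integral rt t \<omega> + c1 * time_integral lam1 t \<omega> + c2 * time_integral lam2 t \<omega>))
        * of_bool (ereal (a1 * time_integral lam1 t \<omega> + a2 * time_integral lam2 t \<omega> + a3 * H t \<omega>) < first_passage_time (X y) \<omega>))) UNIV"
proof -
  define E where "E \<omega> = c0 * time_integral rt t \<omega> + c1 * time_integral lam1 t \<omega> + c2 * time_integral lam2 t \<omega>" for \<omega>
  define S where "S \<omega> = a1 * time_integral lam1 t \<omega> + a2 * time_integral lam2 t \<omega> + a3 * H t \<omega>" for \<omega>
  define D where "D \<omega> = exp (- max 0 (E \<omega>))" for \<omega>
  note [measurable] = functionals_measurable[OF t]
  have [measurable]: "E \<in> borel_measurable M" "S \<in> borel_measurable M"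
    unfolding E_def[abs_def] S_def[abs_def] by measurable
  have [measurable]: "D \<in> borel_measurable M" unfolding D_def[abs_def] by measurable
  have q: "0 \<le> q z" for z by (simp add: q_def)
  have [measurable]: "(\<lambda>\<omega>. prob (survives y (S \<omega>))) \<in> borel_measurable M"
    "(\<lambda>\<omega>. prob (survives y (max 0 (S \<omega>)))) \<in> borel_measurable M" by measurable
  have "0 \<le> E \<omega>" if "\<omega> \<in> space M" for \<omega>
    unfolding E_def using time_integrals_nonneg[OF that] c by simp
  then have D: "D \<omega> = exp (- E \<omega>)" if "\<omega> \<in> space M" for \<omega>
    using that by (simp add: D_def max_absorb2)
  have S_nonneg: "AE \<omega> in M. 0 \<le> S \<omega>"
    using AE_H_nonneg[OF t] AE_space
  proof eventually_elim
    case (elim \<omega>)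
    then show ?case unfolding S_def using time_integrals_nonneg[of \<omega> t] a by simp
  qed
  \<comment> \<open>The clock is nonnegative only almost surely because \<open>H 0 = 0\<close> is;
    truncation by \<open>max 0\<close> makes it so everywhere without changing expectations.\<close>
  have transform: "expectation (\<lambda>\<omega>. D \<omega> * exp (- q z * max 0 (S \<omega>)))
      = expectation (\<lambda>\<omega>. exp (- c0 * time_integral rt t \<omega>))
        * expectation (\<lambda>\<omega>. exp (- (c1 + a1 * q z) * time_integral lam1 t \<omega>))
        * expectation (\<lambda>\<omega>. exp (- (c2 + a2 * q z) * time_integral lam2 t \<omega>))
        * expectation (\<lambda>\<omega>. exp (- (a3 * q z) * H t \<omega>))" for z
  proof -
    have "AE \<omega> in M. D \<omega> * exp (- q z * max 0 (S \<omega>)) = exp (- (c0 * time_integral rt t \<omega>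
        + (c1 + a1 * q z) * time_integral lam1 t \<omega> + (c2 + a2 * q z) * time_integral lam2 t \<omega> + a3 * q z * H t \<omega>))"
      using S_nonneg AE_space
    proof eventually_elim
      case (elim \<omega>)
      have "- E \<omega> + - q z * S \<omega> = - (c0 * time_integral rt t \<omega>
        + (c1 + a1 * q z) * time_integral lam1 t \<omega> + (c2 + a2 * q z) * time_integral lam2 t \<omega> + a3 * q z * H t \<omega>)"
        by (simp add: E_def S_def algebra_simps)
      with elim show ?case by (simp only: D max_absorb2 exp_add[symmetric])
    qed
    then have "expectation (\<lambda>\<omega>. D \<omega> * exp (- q z * max 0 (S \<omega>))) = expectation (\<lambda>\<omega>. exp (- (c0 * time_integral rt t \<omega>
        + (c1 + a1 * q z) * time_integral lam1 t \<omega> + (c2 + a2 * q z) * time_integral lam2 t \<omega> + a3 * q z * H t \<omega>)))"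
      by (intro integral_cong_AE) measurable
    also have "\<dots> = expectation (\<lambda>\<omega>. exp (- c0 * time_integral rt t \<omega>))
        * expectation (\<lambda>\<omega>. exp (- (c1 + a1 * q z) * time_integral lam1 t \<omega>))
        * expectation (\<lambda>\<omega>. exp (- (c2 + a2 * q z) * time_integral lam2 t \<omega>))
        * expectation (\<lambda>\<omega>. exp (- (a3 * q z) * H t \<omega>))"
      using a c q[of z] by (intro expectation_exp_functionals t add_nonneg_nonneg mult_nonneg_nonneg)
    finally show ?thesis .
  qed
  have "expectation (\<lambda>\<omega>. D \<omega> * prob (survives y (max 0 (S \<omega>)))) = expectation (\<lambda>\<omega>. D \<omega> * prob (survives y (S \<omega>)))"
  proof (rule integral_cong_AE)
    show "AE \<omega> in M. D \<omega> * prob (survives y (max 0 (S \<omega>))) = D \<omega> * prob (survives y (S \<omega>))"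
      using S_nonneg by eventually_elim (simp add: max_absorb2)
  qed measurable
  also have "\<dots> = expectation (\<lambda>\<omega>. D \<omega> * of_bool (ereal (S \<omega>) < first_passage_time (X y) \<omega>))"
    unfolding D_def S_def E_def by (rule expectation_discounted_survival[OF t, symmetric])
  also have "\<dots> = expectation (\<lambda>\<omega>. exp (- E \<omega>) * of_bool (ereal (S \<omega>) < first_passage_time (X y) \<omega>))"
    by (intro Bochner_Integration.integral_cong) (simp_all add: D)
  finally have survival: "expectation (\<lambda>\<omega>. D \<omega> * prob (survives y (max 0 (S \<omega>))))
      = expectation (\<lambda>\<omega>. exp (- E \<omega>) * of_bool (ereal (S \<omega>) < first_passage_time (X y) \<omega>))" .
  have "((\<lambda>z. sine_kernel \<beta> y z * expectation (\<lambda>\<omega>. D \<omega> * exp (- q z * max 0 (S \<omega>))))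
      has_integral pi * exp (\<beta> * y) * expectation (\<lambda>\<omega>. D \<omega> * prob (survives y (max 0 (S \<omega>))))) UNIV"
    unfolding q_def by (rule sine_kernel_has_integral_survival) (use y in \<open>auto simp: D_def\<close>)
  then show ?thesis
    unfolding transform survival unfolding E_def S_def .
qed

lemma processes_measurable:
  assumes "0 \<le> t"
  shows "rt t \<in> borel_measurable M" "lam1 t \<in> borel_measurable M" "lam2 t \<in> borel_measurable M"
proof -
  define Z where "Z i = [W t, rt t, lam1 t, lam2 t, H t] ! i" for i
  have Z: "Z 0 = W t" "Z (Suc 0) = rt t" "Z 2 = lam1 t" "Z 3 = lam2 t" "Z 4 = H t"
    by (simp_all add: Z_def eval_nat_numeral)
  have "indep_vars (\<lambda>_. borel) Z {..<5}"
    by (rule indep_vars_functionals) (simp_all add: Z measurable_path_algebra assms)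
  then have rv: "Z i \<in> borel_measurable M" if "i < 5" for i
    using that by (simp add: indep_vars_def2)
  show "rt t \<in> borel_measurable M" "lam1 t \<in> borel_measurable M" "lam2 t \<in> borel_measurable M"
    using rv[of "Suc 0"] rv[of 2] rv[of 3] by (simp_all add: Z)
qed

end

text \<open>The default probability and the zero recovery price are two instances of
  \<open>price_has_integral\<close>, with discount weights all 0 and with weights 1,
  \<open>m\<^sub>1\<close>, \<open>m\<^sub>2\<close>. The default-free bond only needs the
  factorised transform.\<close>

theorem proposition4:
  fixes M :: "'a measure"
    and W W\<^sub>1 W\<^sub>r J rt lam1 lam2 G\<^sub>3 V L :: "real \<Rightarrow> 'a \<Rightarrow> real"
    and K :: "real \<Rightarrow> real"
    and a b c a' b' c' a\<^sub>r b\<^sub>r c\<^sub>r \<alpha>\<^sub>1 \<alpha>\<^sub>2 \<alpha>\<^sub>3 m\<^sub>1 m\<^sub>2 \<sigma> \<beta> x \<rho> l\<^sub>1 l\<^sub>2 R :: real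
    and X G r :: "real \<Rightarrow> 'a \<Rightarrow> real"
    and t2 :: "'a \<Rightarrow> ereal"
    and \<psi>\<^sub>1 \<psi>\<^sub>2 \<psi>\<^sub>r :: "real \<Rightarrow> real \<Rightarrow> real \<Rightarrow> real"
    and \<psi>\<^sub>3 f g :: "real \<Rightarrow> real \<Rightarrow> real"
    and q :: "real \<Rightarrow> real"
  defines "X \<equiv> \<lambda>t \<omega>. x + \<sigma> * W t \<omega> + \<beta> * \<sigma>\<^sup>2 * t"
    and "G \<equiv> \<lambda>t \<omega>. \<alpha>\<^sub>1 * time_integral lam1 t \<omega> + \<alpha>\<^sub>2 * time_integral lam2 t \<omega> + \<alpha>\<^sub>3 * G\<^sub>3 t \<omega>"
    and "r \<equiv> \<lambda>t \<omega>. rt t \<omega> + m\<^sub>1 * lam1 t \<omega> + m\<^sub>2 * lam2 t \<omega>"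
    and "t2 \<equiv> default_time X G"
    and "\<psi>\<^sub>1 \<equiv> laplace_exponent_given M lam1"
    and "\<psi>\<^sub>2 \<equiv> laplace_exponent_given M lam2"
    and "\<psi>\<^sub>r \<equiv> laplace_exponent_given M rt"
    and "\<psi>\<^sub>3 \<equiv> laplace_exponent M G\<^sub>3"
    and "q \<equiv> \<lambda>z. \<sigma>\<^sup>2 * (z\<^sup>2 + \<beta>\<^sup>2) / 2"
    and "f \<equiv> \<lambda>t z. z * sin (z * x) / (z\<^sup>2 + \<beta>\<^sup>2) *
               exp (- (\<psi>\<^sub>1 (\<alpha>\<^sub>1 * q z) t l\<^sub>1 + \<psi>\<^sub>2 (\<alpha>\<^sub>2 * q z) t l\<^sub>2) - \<psi>\<^sub>3 (\<alpha>\<^sub>3 * q z) t)"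
    and "g \<equiv> \<lambda>t z. z * sin (z * x) / (z\<^sup>2 + \<beta>\<^sup>2) *
               exp (- (\<psi>\<^sub>1 (m\<^sub>1 + \<alpha>\<^sub>1 * q z) t l\<^sub>1 + \<psi>\<^sub>2 (m\<^sub>2 + \<alpha>\<^sub>2 * q z) t l\<^sub>2)
                    - \<psi>\<^sub>3 (\<alpha>\<^sub>3 * q z) t)"
  assumes prob: "prob_space M"
    and cir_params: "0 < a" "0 < b" "0 < c" "0 < a\<^sub>r" "0 < b\<^sub>r" "0 < c\<^sub>r"
    and jump_params: "0 < a'" "0 < b'" "0 < c'"
    and lam1: "CIR_process M a b c W\<^sub>1 lam1"
    and rt: "CIR_process M a\<^sub>r b\<^sub>r c\<^sub>r W\<^sub>r rt"
    and J: "subordinator M J" "levy_khintchine M J 0 (exponential_levy_measure a' c')"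
    and lam2: "jump_OU_process M b' J lam2"
    and G\<^sub>3: "subordinator M G\<^sub>3"
    and W: "standard_brownian_motion M W"
    and indep: "indep_processes M [W, rt, lam1, lam2, G\<^sub>3]"
    and weights: "\<alpha>\<^sub>1 \<in> {0..1}" "\<alpha>\<^sub>2 \<in> {0..1}" "\<alpha>\<^sub>3 \<in> {0..1}" "\<alpha>\<^sub>1 + \<alpha>\<^sub>2 + \<alpha>\<^sub>3 = 1"
    and time_change: "normalized_time_change M G"
    and rate_params: "0 \<le> m\<^sub>1" "0 \<le> m\<^sub>2"
    and bm_params: "0 < \<sigma>" "\<beta> < 0"
    and firm: "\<And>t \<omega>. 0 \<le> t \<Longrightarrow> \<omega> \<in> space M \<Longrightarrow> 0 < V t \<omega>" "\<And>t. 0 \<le> t \<Longrightarrow> 0 < K t"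
    and leverage: "\<And>t \<omega>. 0 \<le> t \<Longrightarrow> \<omega> \<in> space M \<Longrightarrow> L t \<omega> = ln (V t \<omega> / K t)"
      "\<And>t \<omega>. 0 \<le> t \<Longrightarrow> \<omega> \<in> space M \<Longrightarrow> L t \<omega> = X (G t \<omega>) \<omega>"
    and recovery: "R < 1"
    and initial: "0 < x" "AE \<omega> in M. L 0 \<omega> = x" "AE \<omega> in M. rt 0 \<omega> = \<rho>"
      "AE \<omega> in M. lam1 0 \<omega> = l\<^sub>1" "AE \<omega> in M. lam2 0 \<omega> = l\<^sub>2"
  shows "(\<forall>t>0. f t integrable_on UNIV \<and>
             measure M {\<omega> \<in> space M. t2 \<omega> \<le> ereal t}
               = 1 - exp (- \<beta> * x) / pi * integral UNIV (f t)) \<and>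
         (\<forall>T\<ge>0. bond_price M r T
               = exp (- \<psi>\<^sub>r 1 T \<rho> - (\<psi>\<^sub>1 m\<^sub>1 T l\<^sub>1 + \<psi>\<^sub>2 m\<^sub>2 T l\<^sub>2))) \<and>
         (\<forall>T\<ge>0. treasury_recovery_price M r t2 R T
               = (1 - R) * zero_recovery_price M r t2 T + R * bond_price M r T) \<and>
         (\<forall>T\<ge>0. g T integrable_on UNIV \<and>
             zero_recovery_price M r t2 T
               = exp (- \<beta> * x - \<psi>\<^sub>r 1 T \<rho>) / pi * integral UNIV (g T))"
proof -
  interpret prob_space M by (rule prob)
  have BM: "brownian_motion M (natural_filtration M W) W"
    using W by (simp add: standard_brownian_motion_def)
  have lam1_path: "continuous_on {0..} (\<lambda>t. lam1 t \<omega>)" "0 \<le> t \<Longrightarrow> 0 \<le> lam1 t \<omega>" if "\<omega> \<in> space M" for \<omega> t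
    using lam1 that by (auto simp: CIR_process_def)
  have rt_path: "continuous_on {0..} (\<lambda>t. rt t \<omega>)" "0 \<le> t \<Longrightarrow> 0 \<le> rt t \<omega>" if "\<omega> \<in> space M" for \<omega> t
    using rt that by (auto simp: CIR_process_def)
  have lam2_path: "cadlag (\<lambda>t. lam2 t \<omega>)" "0 \<le> t \<Longrightarrow> 0 \<le> lam2 t \<omega>" if "\<omega> \<in> space M" for \<omega> t
    using lam2 that by (auto simp: jump_OU_process_def)
  have G\<^sub>3_path: "cadlag (\<lambda>t. G\<^sub>3 t \<omega>)" "mono_on {0..} (\<lambda>t. G\<^sub>3 t \<omega>)" if "\<omega> \<in> space M" for \<omega>
    using G\<^sub>3 that by (auto simp: subordinator_def)
  have G\<^sub>3_0: "AE \<omega> in M. G\<^sub>3 0 \<omega> = 0" using G\<^sub>3 by (simp add: subordinator_def)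
  interpret cm: credit_model M W \<sigma> \<beta> rt lam1 lam2 G\<^sub>3
    by unfold_locales
      (use BM bm_params indep continuous_on_imp_cadlag[OF rt_path(1)] rt_path(2)
        continuous_on_imp_cadlag[OF lam1_path(1)] lam1_path(2) lam2_path G\<^sub>3_path(2) G\<^sub>3_0 in blast)+
  note \<alpha> = weights(1-3)[unfolded atLeastAtMost_iff, THEN conjunct1]
  have X: "X = cm.X x" by (simp add: X_def cm.X_def fun_eq_iff)
  have G_mono: "mono_on {0..} (\<lambda>t. G t \<omega>)" if "\<omega> \<in> space M" for \<omega>
  proof (rule mono_onI)
    fix s t :: real assume st: "s \<in> {0..}" "t \<in> {0..}" "s \<le> t"
    show "G s \<omega> \<le> G t \<omega>"
      unfolding G_def
      using mono_onD[OF mono_on_time_integral[of lam1, OF cm.lam1[OF that]] st]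
        mono_onD[OF mono_on_time_integral[of lam2, OF cm.lam2[OF that]] st]
        mono_onD[OF cm.H(2)[OF that] st] \<alpha>
      by (intro add_mono mult_left_mono)
  qed
  have G_right: "continuous (at_right t) (\<lambda>t. G t \<omega>)" if "\<omega> \<in> space M" "0 \<le> t" for \<omega> t
  proof -
    have "continuous (at_right t) (\<lambda>t. time_integral lam1 t \<omega>)" "continuous (at_right t) (\<lambda>t. time_integral lam2 t \<omega>)"
      using continuous_on_imp_cadlag[OF continuous_on_time_integral[of lam1, OF cm.lam1(1)[OF that(1)]]]
        continuous_on_imp_cadlag[OF continuous_on_time_integral[of lam2, OF cm.lam2(1)[OF that(1)]]] that(2)
      by (simp_all add: cadlag_def)
    moreover have "continuous (at_right t) (\<lambda>t. G\<^sub>3 t \<omega>)" using G\<^sub>3_path(1)[OF that(1)] that(2) by (simp add: cadlag_def)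
    ultimately show ?thesis unfolding G_def by (intro continuous_intros)
  qed
  \<comment> \<open>Default is translated into a comparison of the clock with the passage time, the
    only form in which it enters the expectations.\<close>
  have survive_iff: "ereal t < t2 \<omega> \<longleftrightarrow> ereal (G t \<omega>) < first_passage_time (cm.X x) \<omega>" if "\<omega> \<in> space M" "0 \<le> t" for \<omega> t
    using default_time_le_iff[of G \<omega> t X, OF G_mono[OF that(1)] G_right[OF that] that(2)]
    unfolding t2_def X[symmetric] by (simp add: not_le[symmetric])
  have r_integral: "time_integral r t \<omega> = 1 * time_integral rt t \<omega> + m\<^sub>1 * time_integral lam1 t \<omega> + m\<^sub>2 * time_integral lam2 t \<omega>"
    if "\<omega> \<in> space M" for \<omega> t
  proof -
    have "set_integrable lborel {0..t} (\<lambda>s. rt s \<omega>)" "set_integrable lborel {0..t} (\<lambda>s. m\<^sub>1 * lam1 s \<omega>)"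
      "set_integrable lborel {0..t} (\<lambda>s. m\<^sub>2 * lam2 s \<omega>)"
      using cm.rt(1)[OF that] cm.lam1(1)[OF that] cm.lam2(1)[OF that] by (auto intro: cadlag_set_integrable)
    then show ?thesis unfolding time_integral_def r_def by simp
  qed
  have exp_\<psi>\<^sub>r: "exp (- \<psi>\<^sub>r u t \<rho>) = expectation (\<lambda>\<omega>. exp (- u * time_integral rt t \<omega>))" if "0 \<le> t" "0 \<le> u" for u t
    unfolding \<psi>\<^sub>r_def using that initial
    by (intro exp_laplace_exponent_given cm.functionals_measurable cm.processes_measurable cm.time_integrals_nonneg) auto
  have exp_\<psi>\<^sub>1: "exp (- \<psi>\<^sub>1 u t l\<^sub>1) = expectation (\<lambda>\<omega>. exp (- u * time_integral lam1 t \<omega>))" if "0 \<le> t" "0 \<le> u" for u t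
    unfolding \<psi>\<^sub>1_def using that initial
    by (intro exp_laplace_exponent_given cm.functionals_measurable cm.processes_measurable cm.time_integrals_nonneg) auto
  have exp_\<psi>\<^sub>2: "exp (- \<psi>\<^sub>2 u t l\<^sub>2) = expectation (\<lambda>\<omega>. exp (- u * time_integral lam2 t \<omega>))" if "0 \<le> t" "0 \<le> u" for u t
    unfolding \<psi>\<^sub>2_def using that initial
    by (intro exp_laplace_exponent_given cm.functionals_measurable cm.processes_measurable cm.time_integrals_nonneg) auto
  have exp_\<psi>\<^sub>3: "exp (- \<psi>\<^sub>3 u t) = expectation (\<lambda>\<omega>. exp (- u * G\<^sub>3 t \<omega>))" if "0 \<le> t" "0 \<le> u" for u t
    unfolding \<psi>\<^sub>3_def using that
    by (intro exp_laplace_exponent cm.functionals_measurable cm.AE_H_nonneg)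
  have q: "0 \<le> q z" for z by (simp add: q_def)
  note [measurable] = cm.functionals_measurable
  define A where "A t = {\<omega> \<in> space M. ereal (G t \<omega>) < first_passage_time (cm.X x) \<omega>}" for t
  have A[measurable]: "A t \<in> sets M" if "0 \<le> t" for t
  proof -
    note [measurable] = cm.functionals_measurable[OF that]
    show ?thesis unfolding A_def G_def by measurable
  qed
  have default: "f t integrable_on UNIV \<and> measure M {\<omega> \<in> space M. t2 \<omega> \<le> ereal t}
      = 1 - exp (- \<beta> * x) / pi * integral UNIV (f t)" if t: "0 \<le> t" for t
  proof -
    have f_eq: "f t = (\<lambda>z. sine_kernel \<beta> x z *
        (expectation (\<lambda>\<omega>. exp (- 0 * time_integral rt t \<omega>))
          * expectation (\<lambda>\<omega>. exp (- (0 + \<alpha>\<^sub>1 * q z) * time_integral lam1 t \<omega>))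
          * expectation (\<lambda>\<omega>. exp (- (0 + \<alpha>\<^sub>2 * q z) * time_integral lam2 t \<omega>))
          * expectation (\<lambda>\<omega>. exp (- (\<alpha>\<^sub>3 * q z) * G\<^sub>3 t \<omega>))))"
    proof
      fix z
      have "exp (- (\<psi>\<^sub>1 (\<alpha>\<^sub>1 * q z) t l\<^sub>1 + \<psi>\<^sub>2 (\<alpha>\<^sub>2 * q z) t l\<^sub>2) - \<psi>\<^sub>3 (\<alpha>\<^sub>3 * q z) t)
          = exp (- \<psi>\<^sub>1 (\<alpha>\<^sub>1 * q z) t l\<^sub>1) * exp (- \<psi>\<^sub>2 (\<alpha>\<^sub>2 * q z) t l\<^sub>2) * exp (- \<psi>\<^sub>3 (\<alpha>\<^sub>3 * q z) t)"
        unfolding exp_add[symmetric] by simp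
      then show "f t z = sine_kernel \<beta> x z *
        (expectation (\<lambda>\<omega>. exp (- 0 * time_integral rt t \<omega>))
          * expectation (\<lambda>\<omega>. exp (- (0 + \<alpha>\<^sub>1 * q z) * time_integral lam1 t \<omega>))
          * expectation (\<lambda>\<omega>. exp (- (0 + \<alpha>\<^sub>2 * q z) * time_integral lam2 t \<omega>))
          * expectation (\<lambda>\<omega>. exp (- (\<alpha>\<^sub>3 * q z) * G\<^sub>3 t \<omega>)))"
        using \<alpha> q[of z] t by (simp add: f_def sine_kernel_def exp_\<psi>\<^sub>1 exp_\<psi>\<^sub>2 exp_\<psi>\<^sub>3 prob_space)
    qed
    have survival: "expectation (\<lambda>\<omega>. exp (- (0 * time_integral rt t \<omega> + 0 * time_integral lam1 t \<omega> + 0 * time_integral lam2 t \<omega>))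
        * of_bool (ereal (\<alpha>\<^sub>1 * time_integral lam1 t \<omega> + \<alpha>\<^sub>2 * time_integral lam2 t \<omega> + \<alpha>\<^sub>3 * G\<^sub>3 t \<omega>) < first_passage_time (cm.X x) \<omega>))
      = expectation (indicator (A t))"
      by (intro Bochner_Integration.integral_cong) (auto simp: A_def G_def)
    have "(f t has_integral pi * exp (\<beta> * x) * expectation (indicator (A t))) UNIV"
      using cm.price_has_integral[OF t initial(1) order_refl order_refl order_refl \<alpha>]
      unfolding f_eq q_def survival .
    then have f: "(f t has_integral pi * exp (\<beta> * x) * prob (A t)) UNIV"
      using A[OF t] by (simp add: A_def Int_def conj_ac)
    have "{\<omega> \<in> space M. t2 \<omega> \<le> ereal t} = space M - A t"
      using survive_iff[OF _ t] by (auto simp: A_def not_less[symmetric])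
    then have "prob {\<omega> \<in> space M. t2 \<omega> \<le> ereal t} = 1 - prob (A t)"
      using prob_compl[OF A[OF t]] by simp
    moreover have "exp (- \<beta> * x) / pi * (pi * exp (\<beta> * x) * prob (A t)) = prob (A t)"
      by (simp add: exp_minus)
    ultimately show ?thesis using f by (auto simp: integral_unique)
  qed
  have discount: "integrable M (\<lambda>\<omega>. exp (- time_integral r t \<omega>))"
    "integrable M (\<lambda>\<omega>. exp (- time_integral r t \<omega>) * indicator {\<omega>. ereal t < t2 \<omega>} \<omega>)" if t: "0 \<le> t" for t
  proof -
    note [measurable] = cm.functionals_measurable[OF t] A[OF t]
    define E where "E \<omega> = 1 * time_integral rt t \<omega> + m\<^sub>1 * time_integral lam1 t \<omega> + m\<^sub>2 * time_integral lam2 t \<omega>" for \<omega>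
    have [measurable]: "E \<in> borel_measurable M" unfolding E_def[abs_def] by measurable
    have E: "0 \<le> E \<omega>" if "\<omega> \<in> space M" for \<omega>
      unfolding E_def using cm.time_integrals_nonneg[OF that, of t] rate_params by simp
    have "integrable M (\<lambda>\<omega>. exp (- E \<omega>))"
      by (rule integrable_const_bound[where B = 1]) (use E in auto)
    then show "integrable M (\<lambda>\<omega>. exp (- time_integral r t \<omega>))"
      by (rule Bochner_Integration.integrable_cong[THEN iffD1, rotated -1]) (simp_all add: r_integral E_def)
    have "integrable M (\<lambda>\<omega>. exp (- E \<omega>) * indicator (A t) \<omega>)"
      by (rule integrable_const_bound[where B = 1]) (use E in \<open>auto simp: indicator_def\<close>)
    then show "integrable M (\<lambda>\<omega>. exp (- time_integral r t \<omega>) * indicator {\<omega>. ereal t < t2 \<omega>} \<omega>)"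
      by (rule Bochner_Integration.integrable_cong[THEN iffD1, rotated -1])
        (simp_all add: r_integral E_def A_def survive_iff t indicator_def)
  qed
  have bond: "bond_price M r T = exp (- \<psi>\<^sub>r 1 T \<rho> - (\<psi>\<^sub>1 m\<^sub>1 T l\<^sub>1 + \<psi>\<^sub>2 m\<^sub>2 T l\<^sub>2))" if T: "0 \<le> T" for T
  proof -
    \<comment> \<open>The zero multiple of the subordinator gives the exponent the four-term shape
      of the joint transform.\<close>
    have "bond_price M r T = expectation (\<lambda>\<omega>. exp (- (1 * time_integral rt T \<omega> + m\<^sub>1 * time_integral lam1 T \<omega>
        + m\<^sub>2 * time_integral lam2 T \<omega> + 0 * G\<^sub>3 T \<omega>)))"
      unfolding bond_price_def by (intro Bochner_Integration.integral_cong) (simp_all add: r_integral)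
    also have "\<dots> = exp (- \<psi>\<^sub>r 1 T \<rho>) * exp (- \<psi>\<^sub>1 m\<^sub>1 T l\<^sub>1) * exp (- \<psi>\<^sub>2 m\<^sub>2 T l\<^sub>2)"
      using T rate_params
      by (subst cm.expectation_exp_functionals) (simp_all add: exp_\<psi>\<^sub>r exp_\<psi>\<^sub>1 exp_\<psi>\<^sub>2 prob_space)
    also have "\<dots> = exp (- \<psi>\<^sub>r 1 T \<rho> - (\<psi>\<^sub>1 m\<^sub>1 T l\<^sub>1 + \<psi>\<^sub>2 m\<^sub>2 T l\<^sub>2))"
      unfolding exp_add[symmetric] by simp
    finally show ?thesis .
  qed
  have treasury: "treasury_recovery_price M r t2 R T = (1 - R) * zero_recovery_price M r t2 T + R * bond_price M r T"
    if T: "0 \<le> T" for T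
  proof -
    have "treasury_recovery_price M r t2 R T = expectation (\<lambda>\<omega>.
        (1 - R) * (exp (- time_integral r T \<omega>) * indicator {\<omega>. ereal T < t2 \<omega>} \<omega>) + R * exp (- time_integral r T \<omega>))"
      unfolding treasury_recovery_price_def
      by (intro Bochner_Integration.integral_cong) (auto simp: indicator_def algebra_simps)
    then show ?thesis
      using discount[OF T] by (simp add: zero_recovery_price_def bond_price_def)
  qed
  have zero_recovery: "g T integrable_on UNIV \<and> zero_recovery_price M r t2 T
      = exp (- \<beta> * x - \<psi>\<^sub>r 1 T \<rho>) / pi * integral UNIV (g T)" if T: "0 \<le> T" for T
  proof -
    \<comment> \<open>The short-rate factor does not depend on z and is absent from
      \<open>g\<close>; it is inserted to match the general formula and divided out
      afterwards.\<close>
    have "exp (- \<psi>\<^sub>r 1 T \<rho>) * g T z = sine_kernel \<beta> x z *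
        (expectation (\<lambda>\<omega>. exp (- 1 * time_integral rt T \<omega>))
          * expectation (\<lambda>\<omega>. exp (- (m\<^sub>1 + \<alpha>\<^sub>1 * q z) * time_integral lam1 T \<omega>))
          * expectation (\<lambda>\<omega>. exp (- (m\<^sub>2 + \<alpha>\<^sub>2 * q z) * time_integral lam2 T \<omega>))
          * expectation (\<lambda>\<omega>. exp (- (\<alpha>\<^sub>3 * q z) * G\<^sub>3 T \<omega>)))" for z
    proof -
      have "exp (- (\<psi>\<^sub>1 (m\<^sub>1 + \<alpha>\<^sub>1 * q z) T l\<^sub>1 + \<psi>\<^sub>2 (m\<^sub>2 + \<alpha>\<^sub>2 * q z) T l\<^sub>2) - \<psi>\<^sub>3 (\<alpha>\<^sub>3 * q z) T)
          = exp (- \<psi>\<^sub>1 (m\<^sub>1 + \<alpha>\<^sub>1 * q z) T l\<^sub>1) * exp (- \<psi>\<^sub>2 (m\<^sub>2 + \<alpha>\<^sub>2 * q z) T l\<^sub>2) * exp (- \<psi>\<^sub>3 (\<alpha>\<^sub>3 * q z) T)"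
        unfolding exp_add[symmetric] by simp
      moreover have "0 \<le> m\<^sub>1 + \<alpha>\<^sub>1 * q z" "0 \<le> m\<^sub>2 + \<alpha>\<^sub>2 * q z" "0 \<le> \<alpha>\<^sub>3 * q z"
        using \<alpha> q[of z] rate_params by simp_all
      ultimately show ?thesis
        using T by (simp only: f_def g_def sine_kernel_def exp_\<psi>\<^sub>r[OF T zero_le_one] exp_\<psi>\<^sub>1[OF T] exp_\<psi>\<^sub>2[OF T] exp_\<psi>\<^sub>3[OF T] mult_ac)
    qed
    moreover have "expectation (\<lambda>\<omega>. exp (- (1 * time_integral rt T \<omega> + m\<^sub>1 * time_integral lam1 T \<omega> + m\<^sub>2 * time_integral lam2 T \<omega>))
        * of_bool (ereal (\<alpha>\<^sub>1 * time_integral lam1 T \<omega> + \<alpha>\<^sub>2 * time_integral lam2 T \<omega> + \<alpha>\<^sub>3 * G\<^sub>3 T \<omega>) < first_passage_time (cm.X x) \<omega>))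
      = zero_recovery_price M r t2 T"
      unfolding zero_recovery_price_def
      by (intro Bochner_Integration.integral_cong) (simp_all add: r_integral survive_iff T G_def indicator_def)
    ultimately have "((\<lambda>z. exp (- \<psi>\<^sub>r 1 T \<rho>) * g T z) has_integral pi * exp (\<beta> * x) * zero_recovery_price M r t2 T) UNIV"
      using cm.price_has_integral[OF T initial(1) zero_le_one rate_params \<alpha>] by (simp only: q_def)
    from has_integral_mult_right[OF this, of "exp (\<psi>\<^sub>r 1 T \<rho>)"]
    have g: "(g T has_integral exp (\<psi>\<^sub>r 1 T \<rho>) * (pi * exp (\<beta> * x) * zero_recovery_price M r t2 T)) UNIV"
      by (simp add: mult.assoc[symmetric] exp_add[symmetric])
    have "exp (- \<beta> * x - \<psi>\<^sub>r 1 T \<rho>) / pi * (exp (\<psi>\<^sub>r 1 T \<rho>) * (pi * exp (\<beta> * x) * zero_recovery_price M r t2 T))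
        = zero_recovery_price M r t2 T"
      by (simp add: exp_diff exp_minus)
    then show ?thesis using g by (auto simp: integral_unique)
  qed
  show ?thesis
    using default bond treasury zero_recovery by auto
qed

end
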